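(* The map $f\mapsto \widetilde{M}f$ is continuous from $BV(\mathbb{R})$ to $BV(\mathbb{R})$ (with respect to the norm $\|\cdot\|_{BV}$ on both sides).
   Context: For a function $g:\mathbb{R}\to\mathbb{R}$, its (pointwise) total variation is $\mathrm{Var}(g)=\sup\sum_{i=1}^{K}|g(a_i)-g(a_{i-1})|$, the supremum being over all $K\in\mathbb{N}$ and all finite sequences $a_0<a_1<\dots<a_K$ in $\mathbb{R}$. $BV(\mathbb{R})$ is the space of functions $f:\mathbb{R}\to\mathbb{R}$ (defined at every point) with $\mathrm{Var}(f)<\infty$, endowed with the norm $\|f\|_{BV}:=|f(-\infty)|+\mathrm{Var}(f)$, where $f(-\infty):=\lim_{x\to-\infty}f(x)$. The uncentered Hardy--Littlewood maximal operator is $\widetilde{M}f(x):=\sup_{I\ni x}\frac{1}{m(I)}\int_I|f|$, where the supremum is over all bounded intervals $I$ of positive length containing $x$ and $m$ is Lebesgue measure. It is known (Aldaz and Pérez Lázaro) that for $f\in BV(\mathbb{R})$ one has $\mathrm{Var}(\widetilde{M}f)\le \mathrm{Var}(f)$ and $\widetilde{M}f$ is absolutely continuous; in particular $\widetilde{M}$ maps $BV(\mathbb{R})$ to itself. *)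

theory Defs
  imports "HOL-Analysis.Analysis"
begin

definition total_variation :: "(real \<Rightarrow> real) \<Rightarrow> ennreal" where
  "total_variation g =
     (SUP (K, a) \<in> {(K :: nat, a :: nat \<Rightarrow> real). strict_mono_on {0..K} a}.
        ennreal (\<Sum>i<K. \<bar>g (a (Suc i)) - g (a i)\<bar>))"

definition BV :: "(real \<Rightarrow> real) set" where
  "BV = {f. total_variation f < \<infinity>}"

text \<open>The limit at minus infinity exists for every \<^term>\<open>f \<in> BV\<close>; see \<open>BV_tendsto_at_bot\<close> below.\<close>

definition BV_norm :: "(real \<Rightarrow> real) \<Rightarrow> real" where
  "BV_norm f = \<bar>Lim at_bot f\<bar> + enn2real (total_variation f)"

definition BV_dist :: "(real \<Rightarrow> real) \<Rightarrow> (real \<Rightarrow> real) \<Rightarrow> real" where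
  "BV_dist f g = BV_norm (\<lambda>x. f x - g x)"

text \<open>
  The intervals may be open, closed or half-open. For \<^term>\<open>f \<in> BV\<close> the function is bounded and
  Borel measurable, so the integrals exist and the supremum is taken over a bounded set of reals.
\<close>

definition uncentered_maximal :: "(real \<Rightarrow> real) \<Rightarrow> real \<Rightarrow> real" where
  "uncentered_maximal f x =
     (SUP I \<in> {I. is_interval I \<and> bounded I \<and> measure lborel I > 0 \<and> x \<in> I}.
        (LINT t:I|lborel. \<bar>f t\<bar>) / measure lborel I)"

lemma total_variation_ge:
  assumes "strict_mono_on {0..K} (a :: nat \<Rightarrow> real)"
  shows "ennreal (\<Sum>i<K. \<bar>g (a (Suc i)) - g (a i)\<bar>) \<le> total_variation g"
  unfolding total_variation_def using assms by (intro SUP_upper2[of "(K, a)"]) auto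

lemma total_variation_le:
  assumes "\<And>K (a :: nat \<Rightarrow> real). strict_mono_on {0..K} a \<Longrightarrow>
    ennreal (\<Sum>i<K. \<bar>g (a (Suc i)) - g (a i)\<bar>) \<le> c"
  shows "total_variation g \<le> c"
  unfolding total_variation_def using assms by (intro SUP_least) auto

lemma total_variation_diff_le:
  "total_variation (\<lambda>x. f x - g x) \<le> total_variation f + total_variation g"
proof (rule total_variation_le)
  fix K and a :: "nat \<Rightarrow> real"
  assume a: "strict_mono_on {0..K} a"
  have "ennreal (\<Sum>i<K. \<bar>(f (a (Suc i)) - g (a (Suc i))) - (f (a i) - g (a i))\<bar>)
     \<le> ennreal ((\<Sum>i<K. \<bar>f (a (Suc i)) - f (a i)\<bar>) + (\<Sum>i<K. \<bar>g (a (Suc i)) - g (a i)\<bar>))"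
    by (intro ennreal_leI, unfold sum.distrib[symmetric], intro sum_mono) linarith
  also have "\<dots> = ennreal (\<Sum>i<K. \<bar>f (a (Suc i)) - f (a i)\<bar>)
      + ennreal (\<Sum>i<K. \<bar>g (a (Suc i)) - g (a i)\<bar>)"
    by (intro ennreal_plus sum_nonneg) auto
  also have "\<dots> \<le> total_variation f + total_variation g"
    by (intro add_mono total_variation_ge a)
  finally show "ennreal (\<Sum>i<K. \<bar>(f (a (Suc i)) - g (a (Suc i))) - (f (a i) - g (a i))\<bar>)
     \<le> total_variation f + total_variation g" .
qed

lemma BV_diff:
  assumes "f \<in> BV" "g \<in> BV"
  shows "(\<lambda>x. f x - g x) \<in> BV"
  using assms total_variation_diff_le[of f g] unfolding BV_def
  by (auto simp: ennreal_add_less_top intro: le_less_trans)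

lemma abs_diff_le_total_variation:
  "ennreal \<bar>g y - g x\<bar> \<le> total_variation g"
proof -
  have *: "ennreal \<bar>g y - g x\<bar> \<le> total_variation g" if "x < y" for x y
  proof -
    have "strict_mono_on {0..1} (\<lambda>i::nat. if i = 0 then x else y)"
      using that by (auto simp: strict_mono_on_def)
    from total_variation_ge[OF this, of g] show ?thesis by simp
  qed
  show ?thesis
    using *[of x y] *[of y x] by (cases x y rule: linorder_cases) (auto simp: abs_minus_commute)
qed

lemma BV_tendsto_at_bot:
  assumes f: "f \<in> BV"
  shows "(f \<longlongrightarrow> Lim at_bot f) at_bot"
proof -
  obtain V where V: "total_variation f = ennreal V" "V \<ge> 0"
    using f unfolding BV_def by (cases "total_variation f") auto
  have osc: "\<exists>N. \<forall>x<N. \<forall>y<N. \<bar>f y - f x\<bar> < e" if e: "e > 0" for e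
  proof -
    have "\<exists>K a. strict_mono_on {0..K} (a :: nat \<Rightarrow> real) \<and>
        (\<Sum>i<K. \<bar>f (a (Suc i)) - f (a i)\<bar>) > V - e"
    proof (rule ccontr)
      assume H: "\<not> ?thesis"
      have *: "(\<Sum>i<K. \<bar>f (a (Suc i)) - f (a i)\<bar>) \<le> V - e"
        if "strict_mono_on {0..K} (a :: nat \<Rightarrow> real)" for K a
        using H that by (meson not_less)
      have nn: "V - e \<ge> 0"
        using *[of 0 real] strict_monoD by (force intro: strict_mono_onI)
      have "total_variation f \<le> ennreal (V - e)"
        by (intro total_variation_le ennreal_leI *)
      with V nn e show False by simp
    qed
    then obtain K and a :: "nat \<Rightarrow> real" where a: "strict_mono_on {0..K} a"
      and s: "(\<Sum>i<K. \<bar>f (a (Suc i)) - f (a i)\<bar>) > V - e" by blast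
    have *: "\<bar>f y - f x\<bar> < e" if xy: "x < y" "y < a 0" for x y
    proof -
      define b where "b i = (if i = 0 then x else if i = 1 then y else a (i - 2))" for i :: nat
      have a0: "a 0 \<le> a i" if "i \<le> K" for i
        using strict_mono_onD[OF a, of 0 i] that by (cases "i = 0") auto
      have "strict_mono_on {0..Suc (Suc K)} b"
      proof (rule strict_mono_onI)
        fix i j assume ij: "i \<in> {0..Suc (Suc K)}" "j \<in> {0..Suc (Suc K)}" "i < j"
        show "b i < b j"
        proof (cases "i \<ge> 2")
          case True
          then show ?thesis using ij strict_mono_onD[OF a, of "i - 2" "j - 2"]
            by (auto simp: b_def)
        next
          case False
          moreover have "a 0 \<le> a (j - 2)" using ij by (intro a0) auto
          ultimately show ?thesis using ij xy by (auto simp: b_def)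
        qed
      qed
      from total_variation_ge[OF this, of f]
      have "(\<Sum>i<Suc (Suc K). \<bar>f (b (Suc i)) - f (b i)\<bar>) \<le> V"
        using V by (simp add: ennreal_le_iff del: sum.lessThan_Suc)
      moreover have "(\<Sum>i<Suc (Suc K). \<bar>f (b (Suc i)) - f (b i)\<bar>)
          = \<bar>f y - f x\<bar> + (\<bar>f (a 0) - f y\<bar> + (\<Sum>i<K. \<bar>f (a (Suc i)) - f (a i)\<bar>))"
        by (simp only: sum.lessThan_Suc_shift) (simp add: b_def)
      ultimately show ?thesis using s by linarith
    qed
    have "\<bar>f y - f x\<bar> < e" if "x < a 0" "y < a 0" for x y
      using *[of x y] *[of y x] that e
      by (cases x y rule: linorder_cases) (auto simp: abs_minus_commute)
    then show ?thesis by blast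
  qed
  have "Cauchy (\<lambda>n. f (- real n))"
  proof (rule metric_CauchyI)
    fix e :: real assume "e > 0"
    then obtain N where N: "\<And>x y. x < N \<Longrightarrow> y < N \<Longrightarrow> \<bar>f y - f x\<bar> < e" using osc by blast
    obtain M :: nat where "real M > - N" using reals_Archimedean2 by blast
    then show "\<exists>M. \<forall>m\<ge>M. \<forall>n\<ge>M. dist (f (- real m)) (f (- real n)) < e"
      by (intro exI[of _ M]) (auto simp: dist_real_def intro!: N)
  qed
  then obtain L where L: "(\<lambda>n. f (- real n)) \<longlonglongrightarrow> L"
    using Cauchy_convergent convergent_def by blast
  have "(f \<longlongrightarrow> L) at_bot"
  proof (rule tendstoI)
    fix e :: real assume e: "e > 0"
    then obtain N where N: "\<And>x y. x < N \<Longrightarrow> y < N \<Longrightarrow> \<bar>f y - f x\<bar> < e / 2"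
      using osc[of "e / 2"] by auto
    have "dist (f x) L < e" if "x < N" for x
    proof -
      obtain M :: nat where M: "real M > - N" using reals_Archimedean2 by blast
      have "\<bar>f x - L\<bar> \<le> e / 2"
      proof (rule tendsto_upperbound)
        show "(\<lambda>n. \<bar>f x - f (- real n)\<bar>) \<longlonglongrightarrow> \<bar>f x - L\<bar>"
          by (intro tendsto_intros L)
        show "\<forall>\<^sub>F n in sequentially. \<bar>f x - f (- real n)\<bar> \<le> e / 2"
          using eventually_ge_at_top[of M]
        proof eventually_elim
          case (elim n)
          then have "- real n < N" using M by linarith
          from N[OF this that] show ?case by simp
        qed
      qed simp
      then show ?thesis using e by (simp add: dist_real_def)
    qed
    then show "\<forall>\<^sub>F x in at_bot. dist (f x) L < e"
      using eventually_gt_at_bot by (auto simp: eventually_at_bot_dense)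
  qed
  moreover from this have "Lim at_bot f = L"
    by (intro tendsto_Lim) (auto simp: trivial_limit_at_bot_linorder)
  ultimately show ?thesis by simp
qed

lemma BV_norm_eq_0_iff:
  assumes "f \<in> BV"
  shows "BV_norm f = 0 \<longleftrightarrow> (\<forall>x. f x = 0)"
proof
  assume "BV_norm f = 0"
  then have lim: "Lim at_bot f = 0" and "enn2real (total_variation f) = 0"
    unfolding BV_norm_def by (auto simp: add_nonneg_eq_0_iff)
  with assms have "total_variation f = 0" by (auto simp: BV_def enn2real_eq_0_iff)
  then have c: "f y = f x" for x y
    using abs_diff_le_total_variation[of f y x] by (simp add: ennreal_eq_0_iff)
  have "f = (\<lambda>_. f 0)" using c by blast
  then have "(f \<longlongrightarrow> f 0) at_bot" by (metis tendsto_const)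
  moreover have "(f \<longlongrightarrow> 0) at_bot" using BV_tendsto_at_bot[OF assms] lim by simp
  ultimately have "f 0 = 0"
    using tendsto_unique trivial_limit_at_bot_linorder by blast
  then show "\<forall>x. f x = 0" using c by metis
next
  assume "\<forall>x. f x = 0"
  then have f: "f = (\<lambda>_. 0)" by auto
  have "total_variation f \<le> 0" by (rule total_variation_le) (simp add: f)
  moreover have "Lim at_bot f = 0"
    unfolding f by (intro tendsto_Lim) (auto simp: trivial_limit_at_bot_linorder)
  ultimately show "BV_norm f = 0" by (simp add: BV_norm_def)
qed

lemma BV_norm_diff_le:
  assumes "f \<in> BV" "g \<in> BV"
  shows "BV_norm (\<lambda>x. f x - g x) \<le> BV_norm f + BV_norm g"
proof -
  have "Lim at_bot (\<lambda>x. f x - g x) = Lim at_bot f - Lim at_bot g"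
    by (intro tendsto_Lim tendsto_diff BV_tendsto_at_bot assms)
      (auto simp: trivial_limit_at_bot_linorder)
  moreover have "enn2real (total_variation (\<lambda>x. f x - g x))
      \<le> enn2real (total_variation f + total_variation g)"
    using assms by (intro enn2real_mono total_variation_diff_le) (auto simp: BV_def ennreal_add_less_top)
  moreover have "\<dots> = enn2real (total_variation f) + enn2real (total_variation g)"
    using assms by (intro enn2real_plus) (auto simp: BV_def)
  ultimately show ?thesis unfolding BV_norm_def by linarith
qed

lemma BV_dist_commute: "BV_dist f g = BV_dist g f"
proof -
  have "total_variation (\<lambda>x. f x - g x) = total_variation (\<lambda>x. g x - f x)"
    unfolding total_variation_def
    by (intro SUP_cong refl) (auto intro!: arg_cong[of _ _ ennreal] sum.cong)
  moreover have "\<bar>Lim at_bot (\<lambda>x. f x - g x)\<bar> = \<bar>Lim at_bot (\<lambda>x. g x - f x)\<bar>"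
  proof (cases "\<exists>l. ((\<lambda>x. f x - g x) \<longlongrightarrow> l) at_bot")
    case True
    then obtain l where l: "((\<lambda>x. f x - g x) \<longlongrightarrow> l) at_bot" by blast
    have "((\<lambda>x. g x - f x) \<longlongrightarrow> - l) at_bot" using tendsto_minus[OF l] by simp
    with l have "Lim at_bot (\<lambda>x. f x - g x) = l" "Lim at_bot (\<lambda>x. g x - f x) = - l"
      by (auto intro!: tendsto_Lim simp: trivial_limit_at_bot_linorder)
    then show ?thesis by simp
  next
    case False
    have "\<not> ((\<lambda>x. g x - f x) \<longlongrightarrow> l) at_bot" for l
    proof
      assume "((\<lambda>x. g x - f x) \<longlongrightarrow> l) at_bot"
      from tendsto_minus[OF this] False show False by auto
    qed
    with False show ?thesis by (simp add: Topological_Spaces.Lim_def)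
  qed
  ultimately show ?thesis by (simp add: BV_dist_def BV_norm_def)
qed

interpretation BV: Metric_space BV BV_dist
proof
  fix f g h
  show "0 \<le> BV_dist f g" by (simp add: BV_dist_def BV_norm_def)
  show "BV_dist f g = BV_dist g f" by (rule BV_dist_commute)
  assume fg: "f \<in> BV" "g \<in> BV"
  show "BV_dist f g = 0 \<longleftrightarrow> f = g"
    unfolding BV_dist_def BV_norm_eq_0_iff[OF BV_diff[OF fg]] by auto
  assume h: "h \<in> BV"
  have "BV_dist f h = BV_norm (\<lambda>x. (f x - g x) - (h x - g x))" by (simp add: BV_dist_def)
  also have "\<dots> \<le> BV_dist f g + BV_dist h g"
    unfolding BV_dist_def by (intro BV_norm_diff_le BV_diff fg h)
  finally show "BV_dist f h \<le> BV_dist f g + BV_dist g h" by (simp add: BV_dist_commute)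
qed

end

theory Submission
  imports Defs
begin

text \<open>
  An average over an interval containing \<open>x\<close> is a convex combination of an average over an interval
  ending at \<open>x\<close> and one starting at \<open>x\<close>, so the maximal function of \<open>f\<close> is the maximum of the two
  one-sided maximal functions of the absolute value of \<open>f\<close>. Taking absolute values, hence maxima,
  is continuous on \<open>BV\<close>, and by reflection it remains to treat the left-sided operator on
  left-continuous \<open>f\<close>.

  Let \<open>u \<ge> f\<close> be the left maximal function of \<open>f\<close>. It only increases along with \<open>f\<close>, so its increments
  are bounded by the positive variation of \<open>f\<close>. For \<open>f\<^sub>n \<longlonglongrightarrow> f\<close> with maximal functions \<open>u\<^sub>n\<close>, let
  \<open>E s t\<close> be the upper limit of the variation of \<open>u\<^sub>n - u\<close> on \<open>[s, t]\<close>. It is subadditive, it has no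
  atoms because \<open>u\<^sub>n\<close> converges uniformly, it vanishes on intervals where \<open>u\<close> stays away from \<open>f\<close>
  (there \<open>u\<close> has a derivative of bounded variation), and \<open>E \<le> 6 N\<close> for the negative variation \<open>N\<close> of
  \<open>f\<close>. Since \<open>f\<close> cannot decrease where it coincides with \<open>u\<close>, its decrements are bounded by
  \<open>N - E / 6\<close>; this function being superadditive, \<open>N \<le> N - E / 6\<close>, that is, \<open>E = 0\<close>.
\<close>

subsection \<open>Variation on a compact interval\<close>

text \<open>Uniform convergence comes for free, since maximal functions differ by at most the
  supremum of the difference of the functions. The operator is not linear, however, so the variation
  of a difference of maximal functions is not controlled in the same way, and the argument with
  derivatives only works where maximising intervals have length bounded below. Where
  \<open>u\<close> touches \<open>f\<close> they may shrink to a point. There the sign structure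
  helps: increments of \<open>u - f\<close> are at most the negative variation \<open>N\<close> of
  \<open>f\<close>, so its variation is at most \<open>2 N\<close> plus the initial gap. Used for
  \<open>f\<close> and for its approximation, this costs \<open>4 N\<close> plus two gaps. Starting
  just after the last point up to which \<open>E\<close> vanishes, where \<open>f\<close> comes
  close to \<open>u\<close>, each gap costs at most one more \<open>N\<close>: hence the 6. A
  decrease at a contact point is excluded because larger values of \<open>f\<close> on the left
  would push an average above \<open>u\<close>. The end is a self-improvement: \<open>N\<close> is
  the least superadditive bound for the decrements, so nothing positive can be subtracted from
  it.\<close>

definition variation_on :: "(real \<Rightarrow> real) \<Rightarrow> real \<Rightarrow> real \<Rightarrow> real" where
  "variation_on g s t = Sup {S. \<exists>K a. strict_mono_on {0..K::nat} a \<and> a 0 = s \<and> a K = t \<and>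
     S = (\<Sum>i<K. \<bar>g (a (Suc i)) - g (a i)\<bar>)}"

lemma BV_sum_le:
  assumes "g \<in> BV" "strict_mono_on {0..K} (a :: nat \<Rightarrow> real)"
  shows "(\<Sum>i<K. \<bar>g (a (Suc i)) - g (a i)\<bar>) \<le> enn2real (total_variation g)"
proof -
  have "ennreal (\<Sum>i<K. \<bar>g (a (Suc i)) - g (a i)\<bar>) \<le> ennreal (enn2real (total_variation g))"
    using total_variation_ge[OF assms(2), of g] assms(1) by (simp add: BV_def)
  then show ?thesis by (simp add: ennreal_le_iff)
qed

lemma variation_on_ge_sum:
  assumes "g \<in> BV" "strict_mono_on {0..K} (a :: nat \<Rightarrow> real)"
  shows "(\<Sum>i<K. \<bar>g (a (Suc i)) - g (a i)\<bar>) \<le> variation_on g (a 0) (a K)"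
  unfolding variation_on_def
proof (rule cSup_upper)
  show "bdd_above {S. \<exists>Ka aa. strict_mono_on {0..Ka} aa \<and> aa 0 = a 0 \<and> aa Ka = a K \<and>
     S = (\<Sum>i<Ka. \<bar>g (aa (Suc i)) - g (aa i)\<bar>)}"
    using BV_sum_le[OF assms(1)] by (auto simp: bdd_above_def)
qed (use assms in blast)

lemma partition_set_nonempty:
  assumes "s \<le> t"
  shows "\<exists>K a. strict_mono_on {0..K::nat} a \<and> a 0 = s \<and> a K = (t::real)"
proof (cases "s = t")
  case True
  then show ?thesis by (intro exI[of _ 0] exI[of _ "\<lambda>_. s"]) (auto intro: strict_mono_onI)
next
  case False
  then show ?thesis using assms
    by (intro exI[of _ 1] exI[of _ "\<lambda>i. if i = 0 then s else t"]) (auto intro: strict_mono_onI)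
qed

lemma variation_on_le_sums:
  assumes "s \<le> t"
    and "\<And>K a. strict_mono_on {0..K::nat} a \<Longrightarrow> a 0 = s \<Longrightarrow> a K = t \<Longrightarrow>
      (\<Sum>i<K. \<bar>g (a (Suc i)) - g (a i)\<bar>) \<le> c"
  shows "variation_on g s t \<le> c"
  unfolding variation_on_def
proof (rule cSup_least)
  obtain K and a :: "nat \<Rightarrow> real" where "strict_mono_on {0..K} a" "a 0 = s" "a K = t"
    using partition_set_nonempty[OF assms(1)] by blast
  then show "{S. \<exists>K a. strict_mono_on {0..K::nat} a \<and> a 0 = s \<and> a K = t \<and>
     S = (\<Sum>i<K. \<bar>g (a (Suc i)) - g (a i)\<bar>)} \<noteq> {}" by blast
qed (use assms in blast)

text \<open>Most variation estimates below rest on this telescoping: it suffices to dominate single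
  increments by a superadditive interval function \<open>G\<close>. Signed increments of a function
  may enter \<open>G\<close> freely because they are additive.\<close>

lemma sum_le_superadditive:
  fixes a :: "nat \<Rightarrow> real" and g :: "real \<Rightarrow> real"
  assumes a: "strict_mono_on {0..K} a" and "s \<le> a 0" "a K \<le> t"
    and G: "\<And>x y. s \<le> x \<Longrightarrow> x \<le> y \<Longrightarrow> y \<le> t \<Longrightarrow> \<bar>g y - g x\<bar> \<le> G x y"
    and add: "\<And>x y z. s \<le> x \<Longrightarrow> x \<le> y \<Longrightarrow> y \<le> z \<Longrightarrow> z \<le> t \<Longrightarrow> G x y + G y z \<le> G x z"
  shows "(\<Sum>i<K. \<bar>g (a (Suc i)) - g (a i)\<bar>) \<le> G (a 0) (a K)"
proof -
  have mono: "a i \<le> a j" if "i \<le> j" "j \<le> K" for i j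
    using strict_mono_onD[OF a, of i j] that by (cases "i = j") auto
  have "(\<Sum>i<k. \<bar>g (a (Suc i)) - g (a i)\<bar>) \<le> G (a 0) (a k)" if "k \<le> K" for k
    using that
  proof (induction k)
    case 0
    have "a 0 \<le> t" using mono[of 0 K] assms(3) by auto
    then show ?case using G[of "a 0" "a 0"] assms(2) by auto
  next
    case (Suc k)
    have "a k \<le> a (Suc k)" "a (Suc k) \<le> a K" "a 0 \<le> a k" using mono[of k "Suc k"] mono[of "Suc k" K] mono[of 0 k] Suc.prems by auto
    then show ?case
      using Suc.IH Suc.prems G[of "a k" "a (Suc k)"] add[of "a 0" "a k" "a (Suc k)"] assms(2,3)
      by auto
  qed
  then show ?thesis by simp
qed

lemma variation_on_le:
  assumes "s \<le> t"
    and "\<And>x y. s \<le> x \<Longrightarrow> x \<le> y \<Longrightarrow> y \<le> t \<Longrightarrow> \<bar>g y - g x\<bar> \<le> G x y"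
    and "\<And>x y z. s \<le> x \<Longrightarrow> x \<le> y \<Longrightarrow> y \<le> z \<Longrightarrow> z \<le> t \<Longrightarrow> G x y + G y z \<le> G x z"
  shows "variation_on g s t \<le> G s t"
proof (rule variation_on_le_sums[OF assms(1)])
  fix K and a :: "nat \<Rightarrow> real"
  assume "strict_mono_on {0..K} a" "a 0 = s" "a K = t"
  then show "(\<Sum>i<K. \<bar>g (a (Suc i)) - g (a i)\<bar>) \<le> G s t"
    using sum_le_superadditive[of K a s t g G] assms by simp
qed

lemma total_variation_le_superadditive:
  assumes "\<And>x y. x \<le> y \<Longrightarrow> \<bar>g y - g x\<bar> \<le> G x y"
    and "\<And>x y z. x \<le> y \<Longrightarrow> y \<le> z \<Longrightarrow> G x y + G y z \<le> G x z"
    and "\<And>x y. x \<le> y \<Longrightarrow> G x y \<le> c"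
  shows "total_variation g \<le> ennreal c"
proof (rule total_variation_le)
  fix K and a :: "nat \<Rightarrow> real"
  assume a: "strict_mono_on {0..K} a"
  have "a 0 \<le> a K" using strict_mono_onD[OF a, of 0 K] by (cases "K = 0") auto
  then have "(\<Sum>i<K. \<bar>g (a (Suc i)) - g (a i)\<bar>) \<le> c"
    using sum_le_superadditive[OF a, of "a 0" "a K" g G] assms(1,2) assms(3)[of "a 0" "a K"] by force
  then show "ennreal (\<Sum>i<K. \<bar>g (a (Suc i)) - g (a i)\<bar>) \<le> ennreal c" by (rule ennreal_leI)
qed

lemma BV_superadditiveI:
  assumes "\<And>x y. x \<le> y \<Longrightarrow> \<bar>g y - g x\<bar> \<le> G x y"
    and "\<And>x y z. x \<le> y \<Longrightarrow> y \<le> z \<Longrightarrow> G x y + G y z \<le> G x z"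
    and "\<And>x y. x \<le> y \<Longrightarrow> G x y \<le> c"
  shows "g \<in> BV"
  using total_variation_le_superadditive[of g G c, OF assms] by (auto simp: BV_def intro: le_less_trans)

lemma abs_diff_le_variation_on:
  assumes "g \<in> BV" "x \<le> y"
  shows "\<bar>g y - g x\<bar> \<le> variation_on g x y"
proof (cases "x = y")
  case True
  then show ?thesis using variation_on_ge_sum[OF assms(1), of 0 "\<lambda>_. x"] by (auto intro: strict_mono_onI)
next
  case False
  then have "strict_mono_on {0..1} (\<lambda>i::nat. if i = 0 then x else y)"
    using assms by (auto intro: strict_mono_onI)
  from variation_on_ge_sum[OF assms(1) this] show ?thesis by simp
qed

lemma variation_on_nonneg: "g \<in> BV \<Longrightarrow> x \<le> y \<Longrightarrow> 0 \<le> variation_on g x y"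
  using abs_diff_le_variation_on[of g x y] by linarith

lemma variation_on_superadditive:
  assumes g: "g \<in> BV" and xyz: "x \<le> y" "y \<le> z"
  shows "variation_on g x y + variation_on g y z \<le> variation_on g x z"
proof -
  have *: "(\<Sum>i<K. \<bar>g (a (Suc i)) - g (a i)\<bar>) + (\<Sum>i<L. \<bar>g (b (Suc i)) - g (b i)\<bar>)
      \<le> variation_on g x z"
    if a: "strict_mono_on {0..K} a" "a 0 = x" "a K = y"
      and b: "strict_mono_on {0..L} b" "b 0 = y" "b L = z" for K L :: nat and a b
  proof -
    define c where "c i = (if i \<le> K then a i else b (i - K))" for i
    have aK: "a i \<le> y" if "i \<le> K" for i
      using strict_mono_onD[OF a(1), of i K] a that by (cases "i = K") auto
    have bL: "y < b i" if "0 < i" "i \<le> L" for i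
      using strict_mono_onD[OF b(1), of 0 i] b that by auto
    have "strict_mono_on {0..K + L} c"
    proof (rule strict_mono_onI)
      fix i j assume ij: "i \<in> {0..K + L}" "j \<in> {0..K + L}" "i < j"
      consider "j \<le> K" | "i \<le> K" "K < j" | "K < i" using ij by linarith
      then show "c i < c j"
      proof cases
        case 2
        then have "a i \<le> y" "y < b (j - K)" using ij by (auto intro!: aK bL)
        then show ?thesis using 2 by (simp add: c_def)
      qed (use ij strict_mono_onD[OF a(1), of i j] strict_mono_onD[OF b(1), of "i - K" "j - K"]
          in \<open>auto simp: c_def\<close>)
    qed
    from variation_on_ge_sum[OF g this]
    have "(\<Sum>i<K + L. \<bar>g (c (Suc i)) - g (c i)\<bar>) \<le> variation_on g x z"
      using a b by (cases "L = 0") (auto simp: c_def)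
    moreover have "(\<Sum>i<K + L. \<bar>g (c (Suc i)) - g (c i)\<bar>)
       = (\<Sum>i<K. \<bar>g (c (Suc i)) - g (c i)\<bar>) + (\<Sum>i<L. \<bar>g (c (Suc (K + i))) - g (c (K + i))\<bar>)"
      by (induction L) (simp_all add: add.assoc)
    moreover have "(\<Sum>i<K. \<bar>g (c (Suc i)) - g (c i)\<bar>) = (\<Sum>i<K. \<bar>g (a (Suc i)) - g (a i)\<bar>)"
      by (intro sum.cong) (auto simp: c_def)
    moreover have "(\<Sum>i<L. \<bar>g (c (Suc (K + i))) - g (c (K + i))\<bar>) = (\<Sum>i<L. \<bar>g (b (Suc i)) - g (b i)\<bar>)"
      using a b by (intro sum.cong) (auto simp: c_def Suc_diff_le)
    ultimately show ?thesis by linarith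
  qed
  have "variation_on g x y \<le> variation_on g x z - variation_on g y z"
  proof (rule variation_on_le_sums[OF xyz(1)])
    fix K and a :: "nat \<Rightarrow> real"
    assume a: "strict_mono_on {0..K} a" "a 0 = x" "a K = y"
    \<comment> \<open>The two suprema are taken one after the other: a partition of the first
      interval stays fixed while the second one varies.\<close>
    have "variation_on g y z \<le> variation_on g x z - (\<Sum>i<K. \<bar>g (a (Suc i)) - g (a i)\<bar>)"
      using *[OF a] by (intro variation_on_le_sums[OF xyz(2)]) (simp add: le_diff_eq add.commute)
    then show "(\<Sum>i<K. \<bar>g (a (Suc i)) - g (a i)\<bar>) \<le> variation_on g x z - variation_on g y z" by linarith
  qed
  then show ?thesis by linarith
qed

lemma variation_on_same [simp]:
  assumes "g \<in> BV" shows "variation_on g x x = 0"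
  using variation_on_superadditive[OF assms, of x x x] variation_on_nonneg[OF assms, of x x] by simp

text \<open>Instead of refining partitions by \<open>y\<close>, clip both endpoints at
  \<open>y\<close> from above and from below. The sum \<open>G\<close> of the two variations is
  superadditive, dominates increments even across \<open>y\<close>, and equals the right-hand side
  at \<open>x\<close> and \<open>z\<close>.\<close>

lemma variation_on_add:
  assumes g: "g \<in> BV" and xyz: "x \<le> y" "y \<le> z"
  shows "variation_on g x z = variation_on g x y + variation_on g y z"
proof (rule antisym)
  define G where "G p q = variation_on g (min p y) (min q y) + variation_on g (max p y) (max q y)" for p q
  have "variation_on g x z \<le> G x z"
  proof (rule variation_on_le)
    fix p q assume "x \<le> p" "p \<le> q" "q \<le> z"
    have "\<bar>g (min q y) - g (min p y)\<bar> \<le> variation_on g (min p y) (min q y)"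
      "\<bar>g (max q y) - g (max p y)\<bar> \<le> variation_on g (max p y) (max q y)"
      using \<open>p \<le> q\<close> by (auto intro!: abs_diff_le_variation_on[OF g])
    then show "\<bar>g q - g p\<bar> \<le> G p q"
      using \<open>p \<le> q\<close> by (cases "p \<le> y"; cases "q \<le> y") (auto simp: G_def min_def max_def)
  next
    fix p q r assume "x \<le> p" "p \<le> q" "q \<le> r" "r \<le> z"
    then have "min p y \<le> min q y" "min q y \<le> min r y" "max p y \<le> max q y" "max q y \<le> max r y"
      by auto
    then show "G p q + G q r \<le> G p r"
      using variation_on_superadditive[OF g, of "min p y" "min q y" "min r y"]
        variation_on_superadditive[OF g, of "max p y" "max q y" "max r y"]
      by (simp add: G_def)
  qed (use xyz in auto)
  then show "variation_on g x z \<le> variation_on g x y + variation_on g y z"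
    using xyz by (simp add: G_def)
qed (rule variation_on_superadditive[OF g xyz])

lemma variation_on_mono:
  assumes g: "g \<in> BV" and "x' \<le> x" "x \<le> y" "y \<le> y'"
  shows "variation_on g x y \<le> variation_on g x' y'"
  using variation_on_add[OF g, of x' x y'] variation_on_add[OF g, of x y y'] assms
    variation_on_nonneg[OF g, of x' x] variation_on_nonneg[OF g, of y y'] by simp

lemma variation_on_le_total:
  assumes "g \<in> BV" "x \<le> y"
  shows "variation_on g x y \<le> enn2real (total_variation g)"
  by (rule variation_on_le_sums[OF assms(2)]) (rule BV_sum_le[OF assms(1)])

lemma total_variation_le_variation_on:
  assumes "g \<in> BV" "\<And>x y. x \<le> y \<Longrightarrow> variation_on g x y \<le> c"
  shows "enn2real (total_variation g) \<le> c"
proof -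
  have "0 \<le> c" using assms(2)[of 0 0] assms(1) by simp
  moreover have "total_variation g \<le> ennreal c"
    by (rule total_variation_le_superadditive[where G = "variation_on g"])
      (use assms in \<open>auto intro: abs_diff_le_variation_on variation_on_superadditive\<close>)
  ultimately show ?thesis by (metis enn2real_leI)
qed

lemma variation_on_linear_le:
  assumes "f \<in> BV" "g \<in> BV" "s \<le> t" "0 \<le> a" "0 \<le> b"
    and "\<And>x y. s \<le> x \<Longrightarrow> x \<le> y \<Longrightarrow> y \<le> t \<Longrightarrow> \<bar>h y - h x\<bar> \<le> a * \<bar>f y - f x\<bar> + b * \<bar>g y - g x\<bar>"
  shows "variation_on h s t \<le> a * variation_on f s t + b * variation_on g s t"
proof (rule variation_on_le[where G = "\<lambda>x y. a * variation_on f x y + b * variation_on g x y"])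
  fix x y assume xy: "s \<le> x" "x \<le> y" "y \<le> t"
  have "a * \<bar>f y - f x\<bar> + b * \<bar>g y - g x\<bar> \<le> a * variation_on f x y + b * variation_on g x y"
    using assms xy by (intro add_mono mult_left_mono abs_diff_le_variation_on) auto
  then show "\<bar>h y - h x\<bar> \<le> a * variation_on f x y + b * variation_on g x y"
    using assms(6)[OF xy] by linarith
next
  fix x y z assume "s \<le> x" "x \<le> y" "y \<le> z" "z \<le> t"
  then show "a * variation_on f x y + b * variation_on g x y + (a * variation_on f y z + b * variation_on g y z)
      \<le> a * variation_on f x z + b * variation_on g x z"
    using assms by (simp add: variation_on_add[of _ x y z] algebra_simps)
qed (use assms in auto)

lemma BV_linear:
  assumes "f \<in> BV" "g \<in> BV" "0 \<le> a" "0 \<le> b"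
    and "\<And>x y. x \<le> y \<Longrightarrow> \<bar>h y - h x\<bar> \<le> a * \<bar>f y - f x\<bar> + b * \<bar>g y - g x\<bar>"
  shows "h \<in> BV"
proof (rule BV_superadditiveI[where G = "\<lambda>x y. a * variation_on f x y + b * variation_on g x y"])
  fix x y :: real assume xy: "x \<le> y"
  have "a * \<bar>f y - f x\<bar> + b * \<bar>g y - g x\<bar> \<le> a * variation_on f x y + b * variation_on g x y"
    using assms xy by (intro add_mono mult_left_mono abs_diff_le_variation_on) auto
  then show "\<bar>h y - h x\<bar> \<le> a * variation_on f x y + b * variation_on g x y"
    using assms(5)[OF xy] by linarith
  show "a * variation_on f x y + b * variation_on g x y
      \<le> a * enn2real (total_variation f) + b * enn2real (total_variation g)"
    using assms xy by (intro add_mono mult_left_mono variation_on_le_total) auto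
next
  fix x y z :: real assume "x \<le> y" "y \<le> z"
  then show "a * variation_on f x y + b * variation_on g x y + (a * variation_on f y z + b * variation_on g y z)
      \<le> a * variation_on f x z + b * variation_on g x z"
    using assms by (simp add: variation_on_add[of _ x y z] algebra_simps)
qed

lemma variation_on_diff_le:
  assumes "f \<in> BV" "g \<in> BV" "s \<le> t"
  shows "variation_on (\<lambda>x. f x - g x) s t \<le> variation_on f s t + variation_on g s t"
  using variation_on_linear_le[OF assms, of 1 1 "\<lambda>x. f x - g x"] by simp

text \<open>The supremum of the variations inside \<open>I\<close> is finite and nearly exhausted by
  one pair \<open>x0\<close>, \<open>y0\<close>. By additivity at most \<open>e\<close> is left for
  anything outside. The interval may be open or unbounded, which yields one-sided neighbourhoods and
  tails at once.\<close>

lemma variation_on_small_at_ends: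
  assumes g: "g \<in> BV" and I: "is_interval I" "I \<noteq> {}" and e: "0 < e"
  shows "\<exists>x0\<in>I. \<exists>y0\<in>I. x0 \<le> y0 \<and>
    (\<forall>x\<in>I. \<forall>y\<in>I. x \<le> y \<longrightarrow> y \<le> x0 \<or> y0 \<le> x \<longrightarrow> variation_on g x y \<le> e)"
proof -
  define S where "S = {variation_on g x y | x y. x \<in> I \<and> y \<in> I \<and> x \<le> y}"
  have bdd: "bdd_above S"
    using variation_on_le_total[OF g] by (auto simp: S_def bdd_above_def)
  have "S \<noteq> {}" using I(2) by (auto simp: S_def)
  then obtain v where "v \<in> S" "Sup S - e < v"
    using less_cSup_iff[OF _ bdd, of "Sup S - e"] e by auto
  then obtain x0 y0 where xy0: "x0 \<in> I" "y0 \<in> I" "x0 \<le> y0" "Sup S - e < variation_on g x0 y0"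
    by (auto simp: S_def)
  have "variation_on g x y \<le> e" if xy: "x \<in> I" "y \<in> I" "x \<le> y" "y \<le> x0 \<or> y0 \<le> x" for x y
    using xy(4)
  proof
    assume "y \<le> x0"
    moreover have "variation_on g x y0 \<in> S" using xy xy0 \<open>y \<le> x0\<close> by (force simp: S_def)
    ultimately show ?thesis using variation_on_add[OF g, of x y y0] variation_on_add[OF g, of y x0 y0]
        variation_on_nonneg[OF g, of y x0] cSup_upper[OF _ bdd, of "variation_on g x y0"] xy xy0 by auto
  next
    assume "y0 \<le> x"
    moreover have "variation_on g x0 y \<in> S" using xy xy0 \<open>y0 \<le> x\<close> by (force simp: S_def)
    ultimately show ?thesis using variation_on_add[OF g, of x0 y0 y] variation_on_add[OF g, of y0 x y]
        variation_on_nonneg[OF g, of y0 x] cSup_upper[OF _ bdd, of "variation_on g x0 y"] xy xy0 by auto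
  qed
  with xy0 show ?thesis by blast
qed

text \<open>The point \<open>z\<close> itself is left out because \<open>g\<close> may jump
  there.\<close>

lemma variation_on_small_right:
  assumes "g \<in> BV" "0 < e"
  obtains r where "0 < r" "\<And>x y. z < x \<Longrightarrow> x \<le> y \<Longrightarrow> y < z + r \<Longrightarrow> variation_on g x y \<le> e"
proof -
  have "{z<..<z + 1} \<noteq> {}" by simp
  from variation_on_small_at_ends[OF assms(1) is_interval_oo this assms(2)]
  obtain x0 where x0: "x0 \<in> {z<..<z + 1}"
    and le: "\<forall>x\<in>{z<..<z + 1}. \<forall>y\<in>{z<..<z + 1}. x \<le> y \<longrightarrow> y \<le> x0 \<longrightarrow> variation_on g x y \<le> e"
    by meson
  show ?thesis
  proof (rule that[of "x0 - z"])
    fix x y assume "z < x" "x \<le> y" "y < z + (x0 - z)"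
    then show "variation_on g x y \<le> e" using x0 le by simp
  qed (use x0 in simp)
qed

lemma variation_on_small_left:
  assumes "g \<in> BV" "0 < e"
  obtains r where "0 < r" "\<And>x y. z - r < x \<Longrightarrow> x \<le> y \<Longrightarrow> y < z \<Longrightarrow> variation_on g x y \<le> e"
proof -
  have "{z - 1<..<z} \<noteq> {}" by simp
  from variation_on_small_at_ends[OF assms(1) is_interval_oo this assms(2)]
  obtain x0 where x0: "x0 \<in> {z - 1<..<z}"
    and le: "\<forall>x\<in>{z - 1<..<z}. \<forall>y\<in>{z - 1<..<z}. x \<le> y \<longrightarrow> x0 \<le> x \<longrightarrow> variation_on g x y \<le> e"
    by meson
  show ?thesis
  proof (rule that[of "z - x0"])
    fix x y assume "z - (z - x0) < x" "x \<le> y" "y < z"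
    then show "variation_on g x y \<le> e" using x0 le by simp
  qed (use x0 in simp)
qed

lemma variation_on_small_tails:
  assumes "g \<in> BV" "0 < e"
  obtains X where "\<And>x y. x \<le> y \<Longrightarrow> y \<le> - X \<or> X \<le> x \<Longrightarrow> variation_on g x y \<le> e"
proof -
  obtain x0 y0 where "\<And>x y. x \<le> y \<Longrightarrow> y \<le> x0 \<or> y0 \<le> x \<Longrightarrow> variation_on g x y \<le> e"
    using variation_on_small_at_ends[OF assms(1) is_interval_univ UNIV_not_empty assms(2)]
    by (metis UNIV_I)
  then show ?thesis using that[of "max (- x0) y0"] by (auto simp: minus_max_eq_min)
qed

subsection \<open>Convergence in the norm of bounded variation\<close>

lemma abs_le_BV_norm:
  assumes "g \<in> BV"
  shows "\<bar>g x\<bar> \<le> BV_norm g"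
proof -
  have "((\<lambda>y. \<bar>g x - g y\<bar>) \<longlongrightarrow> \<bar>g x - Lim at_bot g\<bar>) at_bot"
    by (intro tendsto_intros BV_tendsto_at_bot[OF assms])
  moreover have "\<forall>\<^sub>F y in at_bot. \<bar>g x - g y\<bar> \<le> enn2real (total_variation g)"
    using eventually_le_at_bot[of x]
  proof eventually_elim
    case (elim y)
    show ?case
      using abs_diff_le_variation_on[OF assms elim] variation_on_le_total[OF assms elim] by linarith
  qed
  ultimately have "\<bar>g x - Lim at_bot g\<bar> \<le> enn2real (total_variation g)"
    by (rule tendsto_upperbound) (simp add: trivial_limit_at_bot_linorder)
  then show ?thesis unfolding BV_norm_def by linarith
qed

lemma variation_on_le_BV_norm:
  assumes "g \<in> BV" "x \<le> y"
  shows "variation_on g x y \<le> BV_norm g"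
  using variation_on_le_total[OF assms] unfolding BV_norm_def by linarith

lemma BV_norm_le:
  assumes "g \<in> BV" "\<And>x. \<bar>g x\<bar> \<le> a" "\<And>x y. x \<le> y \<Longrightarrow> variation_on g x y \<le> b"
  shows "BV_norm g \<le> a + b"
proof -
  have "((\<lambda>y. \<bar>g y\<bar>) \<longlongrightarrow> \<bar>Lim at_bot g\<bar>) at_bot"
    by (intro tendsto_intros BV_tendsto_at_bot[OF assms(1)])
  then have "\<bar>Lim at_bot g\<bar> \<le> a"
    by (rule tendsto_upperbound) (auto simp: assms(2) trivial_limit_at_bot_linorder)
  moreover have "enn2real (total_variation g) \<le> b"
    by (rule total_variation_le_variation_on[OF assms(1,3)])
  ultimately show ?thesis unfolding BV_norm_def by linarith
qed

lemma BV_norm_nonneg: "0 \<le> BV_norm g"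
  by (simp add: BV_norm_def)

text \<open>Continuity is proved along sequences, since the defect used later is an upper limit
  along one. Membership in \<open>BV\<close> is included so that the derived facts carry no side
  conditions.\<close>

definition BV_LIMSEQ :: "(nat \<Rightarrow> real \<Rightarrow> real) \<Rightarrow> (real \<Rightarrow> real) \<Rightarrow> bool" where
  "BV_LIMSEQ F f \<longleftrightarrow> (\<forall>n. F n \<in> BV) \<and> f \<in> BV \<and> (\<lambda>n. BV_dist (F n) f) \<longlonglongrightarrow> 0"

lemma BV_LIMSEQ_I:
  assumes "\<And>n. F n \<in> BV" "f \<in> BV"
    and "\<And>e. 0 < e \<Longrightarrow> \<forall>\<^sub>F n in sequentially. \<forall>x. \<bar>F n x - f x\<bar> \<le> e"
    and "\<And>e. 0 < e \<Longrightarrow> \<forall>\<^sub>F n in sequentially. \<forall>x y. x \<le> y \<longrightarrow> variation_on (\<lambda>x. F n x - f x) x y \<le> e"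
  shows "BV_LIMSEQ F f"
proof -
  have "(\<lambda>n. BV_dist (F n) f) \<longlonglongrightarrow> 0"
  proof (rule LIMSEQ_I)
    fix e :: real assume e: "0 < e"
    have "\<forall>\<^sub>F n in sequentially. \<forall>x. \<bar>F n x - f x\<bar> \<le> e / 3"
      "\<forall>\<^sub>F n in sequentially. \<forall>x y. x \<le> y \<longrightarrow> variation_on (\<lambda>x. F n x - f x) x y \<le> e / 3"
      using assms(3)[of "e / 3"] assms(4)[of "e / 3"] e by (simp_all only: zero_less_divide_iff zero_less_numeral simp_thms)
    then have "\<forall>\<^sub>F n in sequentially. norm (BV_dist (F n) f - 0) < e"
    proof eventually_elim
      case (elim n)
      then have "BV_dist (F n) f \<le> e / 3 + e / 3"
        unfolding BV_dist_def by (intro BV_norm_le BV_diff assms) auto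
      then show "norm (BV_dist (F n) f - 0) < e"
        using e by (simp add: BV_dist_def BV_norm_nonneg)
    qed
    then show "\<exists>no. \<forall>n\<ge>no. norm (BV_dist (F n) f - 0) < e" by (simp add: eventually_sequentially)
  qed
  with assms show ?thesis by (simp add: BV_LIMSEQ_def)
qed

lemma BV_LIMSEQ_D:
  assumes "BV_LIMSEQ F f"
  shows "F n \<in> BV" "f \<in> BV" "\<bar>F n x - f x\<bar> \<le> BV_dist (F n) f"
    "x \<le> y \<Longrightarrow> variation_on (\<lambda>x. F n x - f x) x y \<le> BV_dist (F n) f"
    "0 \<le> BV_dist (F n) f" "(\<lambda>n. BV_dist (F n) f) \<longlonglongrightarrow> 0"
  using assms abs_le_BV_norm[OF BV_diff[of "F n" f]] variation_on_le_BV_norm[OF BV_diff[of "F n" f]]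
  by (auto simp: BV_LIMSEQ_def BV_dist_def BV_norm_nonneg)

lemma BV_LIMSEQ_linear:
  assumes F: "BV_LIMSEQ F f" and G: "BV_LIMSEQ G g"
  shows "BV_LIMSEQ (\<lambda>n x. a * F n x + b * G n x) (\<lambda>x. a * f x + b * g x)"
proof (rule BV_LIMSEQ_I)
  have lin: "(\<lambda>x. a * f x + b * g x) \<in> BV" if "f \<in> BV" "g \<in> BV" for f g
  proof (rule BV_linear[OF that, of "\<bar>a\<bar>" "\<bar>b\<bar>"])
    fix x y
    have "a * f y + b * g y - (a * f x + b * g x) = a * (f y - f x) + b * (g y - g x)"
      by (simp add: algebra_simps)
    then show "\<bar>a * f y + b * g y - (a * f x + b * g x)\<bar> \<le> \<bar>a\<bar> * \<bar>f y - f x\<bar> + \<bar>b\<bar> * \<bar>g y - g x\<bar>"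
      by (metis abs_mult abs_triangle_ineq)
  qed auto
  show "(\<lambda>x. a * F n x + b * G n x) \<in> BV" for n using lin BV_LIMSEQ_D(1)[OF F] BV_LIMSEQ_D(1)[OF G] by blast
  show "(\<lambda>x. a * f x + b * g x) \<in> BV" using lin BV_LIMSEQ_D(2)[OF F] BV_LIMSEQ_D(2)[OF G] by blast
  let ?d = "\<lambda>n. \<bar>a\<bar> * BV_dist (F n) f + \<bar>b\<bar> * BV_dist (G n) g"
  have lim: "?d \<longlonglongrightarrow> 0"
    using tendsto_add[OF tendsto_mult_left[OF BV_LIMSEQ_D(6)[OF F], of "\<bar>a\<bar>"]
        tendsto_mult_left[OF BV_LIMSEQ_D(6)[OF G], of "\<bar>b\<bar>"]] by simp
  fix e :: real assume e: "0 < e"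
  have ev: "\<forall>\<^sub>F n in sequentially. ?d n \<le> e"
    using order_tendstoD(2)[OF lim e] by eventually_elim simp
  have eq: "(a * F n x + b * G n x) - (a * f x + b * g x) = a * (F n x - f x) + b * (G n x - g x)" for n x
    by (simp add: algebra_simps)
  show "\<forall>\<^sub>F n in sequentially. \<forall>x. \<bar>(a * F n x + b * G n x) - (a * f x + b * g x)\<bar> \<le> e"
    using ev
  proof eventually_elim
    case (elim n)
    have "\<bar>(a * F n x + b * G n x) - (a * f x + b * g x)\<bar> \<le> ?d n" for x
    proof -
      have "\<bar>a * (F n x - f x) + b * (G n x - g x)\<bar> \<le> \<bar>a\<bar> * \<bar>F n x - f x\<bar> + \<bar>b\<bar> * \<bar>G n x - g x\<bar>"
        by (metis abs_mult abs_triangle_ineq)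
      also have "\<dots> \<le> ?d n"
        by (intro add_mono mult_left_mono BV_LIMSEQ_D F G) auto
      finally show ?thesis by (simp add: eq)
    qed
    with elim show ?case by (meson order_trans)
  qed
  show "\<forall>\<^sub>F n in sequentially. \<forall>x y. x \<le> y \<longrightarrow>
      variation_on (\<lambda>x. (a * F n x + b * G n x) - (a * f x + b * g x)) x y \<le> e"
    using ev
  proof eventually_elim
    case (elim n)
    have "variation_on (\<lambda>x. (a * F n x + b * G n x) - (a * f x + b * g x)) s t \<le> ?d n" if "s \<le> t" for s t
    proof -
      have "variation_on (\<lambda>x. (a * F n x + b * G n x) - (a * f x + b * g x)) s t
        \<le> \<bar>a\<bar> * variation_on (\<lambda>x. F n x - f x) s t + \<bar>b\<bar> * variation_on (\<lambda>x. G n x - g x) s t"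
      proof (rule variation_on_linear_le)
        fix x y
        have "(a * F n y + b * G n y - (a * f y + b * g y)) - (a * F n x + b * G n x - (a * f x + b * g x))
          = a * ((F n y - f y) - (F n x - f x)) + b * ((G n y - g y) - (G n x - g x))"
          by (simp add: algebra_simps)
        then show "\<bar>(a * F n y + b * G n y - (a * f y + b * g y)) - (a * F n x + b * G n x - (a * f x + b * g x))\<bar>
          \<le> \<bar>a\<bar> * \<bar>(F n y - f y) - (F n x - f x)\<bar> + \<bar>b\<bar> * \<bar>(G n y - g y) - (G n x - g x)\<bar>"
          by (metis abs_mult abs_triangle_ineq)
      qed (use that BV_LIMSEQ_D[OF F] BV_LIMSEQ_D[OF G] in \<open>auto intro: BV_diff\<close>)
      also have "\<dots> \<le> ?d n"
        by (intro add_mono mult_left_mono BV_LIMSEQ_D F G that) auto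
      finally show ?thesis .
    qed
    with elim show ?case by (meson order_trans)
  qed
qed

subsection \<open>The absolute value\<close>

text \<open>Isolates the values near zero, where the absolute value fails to be linear.\<close>

definition clamp_real :: "real \<Rightarrow> real \<Rightarrow> real" where
  "clamp_real \<delta> t = max (- \<delta>) (min t \<delta>)"

text \<open>Both the clamped part and the rest are nondecreasing functions of the argument, so their
  increments never cancel.\<close>

lemma clamp_real_split:
  assumes "0 \<le> \<delta>"
  shows "\<bar>b - a\<bar> = \<bar>clamp_real \<delta> b - clamp_real \<delta> a\<bar> + \<bar>(b - clamp_real \<delta> b) - (a - clamp_real \<delta> a)\<bar>"
  using assms by (auto simp: clamp_real_def max_def min_def abs_if)

lemma clamp_real_diff_le:
  assumes "0 \<le> \<delta>"
  shows "\<bar>clamp_real \<delta> b - clamp_real \<delta> a\<bar> \<le> 2 * \<delta>"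
  using assms by (auto simp: clamp_real_def max_def min_def abs_if)

lemma BV_compose_lipschitz:
  assumes "g \<in> BV" "\<And>s t. \<bar>c s - c t\<bar> \<le> \<bar>s - (t :: real)\<bar>"
  shows "(\<lambda>x. c (g x)) \<in> BV"
  by (rule BV_linear[OF assms(1,1), of 1 0]) (auto simp: assms(2))

lemma BV_abs: "g \<in> BV \<Longrightarrow> (\<lambda>x. \<bar>g x\<bar>) \<in> BV"
  by (rule BV_compose_lipschitz[where c = abs]) auto

lemma BV_clamp:
  assumes "g \<in> BV" "0 \<le> \<delta>"
  shows "(\<lambda>x. clamp_real \<delta> (g x)) \<in> BV" "(\<lambda>x. g x - clamp_real \<delta> (g x)) \<in> BV"
proof -
  have "\<bar>clamp_real \<delta> s - clamp_real \<delta> t\<bar> \<le> \<bar>s - t\<bar>"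
    "\<bar>(s - clamp_real \<delta> s) - (t - clamp_real \<delta> t)\<bar> \<le> \<bar>s - t\<bar>" for s t
    using clamp_real_split[OF assms(2), of s t] by linarith+
  then show "(\<lambda>x. clamp_real \<delta> (g x)) \<in> BV" "(\<lambda>x. g x - clamp_real \<delta> (g x)) \<in> BV"
    using assms(1) by (auto intro: BV_compose_lipschitz BV_compose_lipschitz[where c = "\<lambda>t. t - clamp_real \<delta> t"])
qed

lemma variation_on_clamp:
  assumes g: "g \<in> BV" and \<delta>: "0 \<le> \<delta>" and st: "s \<le> t"
  shows "variation_on (\<lambda>x. clamp_real \<delta> (g x)) s t
    + variation_on (\<lambda>x. g x - clamp_real \<delta> (g x)) s t \<le> variation_on g s t"
proof -
  let ?c = "\<lambda>x. clamp_real \<delta> (g x)" and ?r = "\<lambda>x. g x - clamp_real \<delta> (g x)"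
  \<comment> \<open>Subtracting an absolute increment, which is subadditive in the interval, keeps
    superadditivity. This bounds the rest; a second pass then replaces the increments by the clamped
    variation.\<close>
  have r: "variation_on ?r x y \<le> variation_on g x y - \<bar>?c y - ?c x\<bar>" if "x \<le> y" for x y
  proof (rule variation_on_le[OF that])
    fix p q :: real assume "p \<le> q"
    then show "\<bar>?r q - ?r p\<bar> \<le> variation_on g p q - \<bar>?c q - ?c p\<bar>"
      using abs_diff_le_variation_on[OF g, of p q] clamp_real_split[OF \<delta>, of "g q" "g p"] by linarith
  next
    fix p q r :: real assume "p \<le> q" "q \<le> r"
    then show "variation_on g p q - \<bar>?c q - ?c p\<bar> + (variation_on g q r - \<bar>?c r - ?c q\<bar>)
       \<le> variation_on g p r - \<bar>?c r - ?c p\<bar>"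
      using variation_on_add[OF g, of p q r] by linarith
  qed
  have "variation_on ?c s t \<le> variation_on g s t - variation_on ?r s t"
  proof (rule variation_on_le[OF st])
    fix p q :: real assume "p \<le> q"
    then show "\<bar>?c q - ?c p\<bar> \<le> variation_on g p q - variation_on ?r p q" using r[of p q] by linarith
  next
    fix p q r :: real assume "p \<le> q" "q \<le> r"
    then show "variation_on g p q - variation_on ?r p q + (variation_on g q r - variation_on ?r q r)
       \<le> variation_on g p r - variation_on ?r p r"
      using variation_on_add[OF g, of p q r] variation_on_add[OF BV_clamp(2)[OF g \<delta>], of p q r] by linarith
  qed
  then show ?thesis by linarith
qed

lemma BV_near_optimal_partition:
  assumes "g \<in> BV" "0 < e"
  obtains K and a :: "nat \<Rightarrow> real" where "strict_mono_on {0..K} a"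
    "enn2real (total_variation g) - e < (\<Sum>i<K. \<bar>g (a (Suc i)) - g (a i)\<bar>)"
proof -
  have "\<exists>x y. x \<le> y \<and> enn2real (total_variation g) - e < variation_on g x y"
  proof (rule ccontr)
    assume "\<not> ?thesis"
    then have "enn2real (total_variation g) \<le> enn2real (total_variation g) - e"
      by (intro total_variation_le_variation_on[OF assms(1)]) force
    with assms(2) show False by simp
  qed
  then obtain x y where xy: "x \<le> y" "enn2real (total_variation g) - e < variation_on g x y" by blast
  then show ?thesis
    using variation_on_le_sums[OF xy(1), of g "enn2real (total_variation g) - e"] that by (meson not_less)
qed

text \<open>
  The variation of \<open>g\<close> splits into that of its clamped part and that of the rest, and along a
  near-optimal partition the rest keeps nearly everything once \<open>\<delta>\<close> is small; this is stable under
  perturbations of \<open>g\<close>.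
\<close>

lemma variation_on_clamp_small:
  assumes F: "BV_LIMSEQ F f" and e: "0 < e"
  obtains \<delta> where "0 < \<delta>"
    "\<forall>\<^sub>F n in sequentially. \<forall>x y. x \<le> y \<longrightarrow> variation_on (\<lambda>x. clamp_real \<delta> (F n x)) x y \<le> e"
proof -
  note f = BV_LIMSEQ_D(2)[OF F] and Fn = BV_LIMSEQ_D(1)[OF F]
  let ?T = "\<lambda>g. enn2real (total_variation g)"
  obtain K and a :: "nat \<Rightarrow> real" where a: "strict_mono_on {0..K} a"
    and Ka: "?T f - e / 4 < (\<Sum>i<K. \<bar>f (a (Suc i)) - f (a i)\<bar>)"
    using BV_near_optimal_partition[OF f, of "e / 4"] e by auto
  have aK: "a 0 \<le> a K" using strict_mono_onD[OF a, of 0 K] by (cases "K = 0") auto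
  \<comment> \<open>Each of the \<open>K\<close> increments loses at most
    \<open>2 * \<delta>\<close> by clamping, in total at most \<open>e / 4\<close>. Two further
    losses of \<open>e / 4\<close> come from the partition and from \<open>F n - f\<close>; the
    fourth is the excess of the variation of \<open>F n\<close> over that of
    \<open>f\<close>.\<close>
  define \<delta> where "\<delta> = e / (8 * (real K + 1))"
  have \<delta>: "0 < \<delta>" using e by (simp add: \<delta>_def)
  have K\<delta>: "2 * real K * \<delta> \<le> e / 4"
    using e by (simp add: \<delta>_def field_simps)
  have "\<forall>\<^sub>F n in sequentially. BV_dist (F n) f < e / 4"
    using order_tendstoD(2)[OF BV_LIMSEQ_D(6)[OF F], of "e / 4"] e by simp
  then have "\<forall>\<^sub>F n in sequentially. \<forall>x y. x \<le> y \<longrightarrow> variation_on (\<lambda>x. clamp_real \<delta> (F n x)) x y \<le> e"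
  proof eventually_elim
    case (elim n)
    let ?r = "\<lambda>x. F n x - clamp_real \<delta> (F n x)" and ?w = "\<lambda>x. F n x - f x"
    have w: "?w \<in> BV" by (intro BV_diff f Fn)
    have r: "?r \<in> BV" and c: "(\<lambda>x. clamp_real \<delta> (F n x)) \<in> BV" using BV_clamp[OF Fn] \<delta> by auto
    have "(\<Sum>i<K. \<bar>f (a (Suc i)) - f (a i)\<bar>)
      \<le> (\<Sum>i<K. \<bar>?r (a (Suc i)) - ?r (a i)\<bar> + \<bar>?w (a (Suc i)) - ?w (a i)\<bar> + 2 * \<delta>)"
    proof (rule sum_mono)
      fix i
      show "\<bar>f (a (Suc i)) - f (a i)\<bar>
        \<le> \<bar>?r (a (Suc i)) - ?r (a i)\<bar> + \<bar>?w (a (Suc i)) - ?w (a i)\<bar> + 2 * \<delta>"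
        using clamp_real_diff_le[of \<delta> "F n (a (Suc i))" "F n (a i)"] \<delta> by linarith
    qed
    also have "\<dots> = (\<Sum>i<K. \<bar>?r (a (Suc i)) - ?r (a i)\<bar>) + (\<Sum>i<K. \<bar>?w (a (Suc i)) - ?w (a i)\<bar>) + 2 * real K * \<delta>"
      by (simp add: sum.distrib)
    also have "\<dots> \<le> variation_on ?r (a 0) (a K) + e / 4 + e / 4"
      using variation_on_ge_sum[OF r a] variation_on_ge_sum[OF w a]
        BV_LIMSEQ_D(4)[OF F aK, of n] elim K\<delta> by linarith
    finally have r_ge: "?T f - 3 * e / 4 \<le> variation_on ?r (a 0) (a K)" using Ka by linarith
    show ?case
    proof (intro allI impI)
      fix x y :: real assume xy: "x \<le> y"
      \<comment> \<open>The interval is enlarged to contain the whole partition, so that the lower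
        bound for the rest applies inside it.\<close>
      define s t where "s = min x (a 0)" and "t = max y (a K)"
      have st: "s \<le> x" "y \<le> t" "s \<le> a 0" "a K \<le> t" "s \<le> t" using xy by (auto simp: s_def t_def)
      have "variation_on (F n) s t \<le> variation_on f s t + variation_on ?w s t"
        using variation_on_linear_le[OF f w st(5), of 1 1 "F n"] by simp
      also have "\<dots> \<le> ?T f + e / 4"
        using variation_on_le_total[OF f st(5)] BV_LIMSEQ_D(4)[OF F st(5), of n] elim by linarith
      finally have "variation_on (F n) s t \<le> ?T f + e / 4" .
      moreover have "variation_on ?r (a 0) (a K) \<le> variation_on ?r s t"
        using st aK by (intro variation_on_mono r) auto
      moreover have "variation_on (\<lambda>x. clamp_real \<delta> (F n x)) x y \<le> variation_on (\<lambda>x. clamp_real \<delta> (F n x)) s t"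
        using st xy by (intro variation_on_mono c) auto
      ultimately show "variation_on (\<lambda>x. clamp_real \<delta> (F n x)) x y \<le> e"
        using variation_on_clamp[OF Fn less_imp_le[OF \<delta>] st(5), of n] r_ge by linarith
    qed
  qed
  with \<delta> that show ?thesis by blast
qed

text \<open>With all four values on one side of zero the left-hand side is the linear difference. If
  all lie in the clamping window, the clamp is the identity and the triangle inequality suffices.
  Otherwise a pair \<open>a\<close>, \<open>a'\<close> or \<open>b\<close>, \<open>b'\<close> is at
  least \<open>\<delta> / 2\<close> away from zero on one side while some other value has the
  opposite sign, so a clamped increment is at least \<open>\<delta> / 2\<close>; the left-hand side
  is at most \<open>\<delta> / 2\<close> by closeness.\<close>

lemma abs_increments_close:
  fixes a b a' b' \<delta> :: real
  assumes "\<bar>a' - a\<bar> \<le> \<delta> / 4" "\<bar>b' - b\<bar> \<le> \<delta> / 4"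
  shows "\<bar>(\<bar>b'\<bar> - \<bar>b\<bar>) - (\<bar>a'\<bar> - \<bar>a\<bar>)\<bar> \<le> \<bar>(b' - b) - (a' - a)\<bar>
    + (2 * \<bar>clamp_real \<delta> b' - clamp_real \<delta> a'\<bar> + 2 * \<bar>clamp_real \<delta> b - clamp_real \<delta> a\<bar>)"
proof -
  define c where "c = clamp_real \<delta>"
  have \<delta>: "0 \<le> \<delta>" using assms(1) abs_ge_zero[of "a' - a"] by linarith
  have far: "\<delta> / 2 \<le> \<bar>c s - c t\<bar>" "\<delta> / 2 \<le> \<bar>c t - c s\<bar>"
    if "\<delta> / 2 \<le> s \<and> t \<le> 0 \<or> s \<le> - \<delta> / 2 \<and> 0 \<le> t" for s t
    using that \<delta> by (auto simp: c_def clamp_real_def max_def min_def)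
  have small: "\<bar>(\<bar>b'\<bar> - \<bar>b\<bar>) - (\<bar>a'\<bar> - \<bar>a\<bar>)\<bar> \<le> \<delta> / 2"
    using assms by linarith
  have "\<bar>(\<bar>b'\<bar> - \<bar>b\<bar>) - (\<bar>a'\<bar> - \<bar>a\<bar>)\<bar> \<le> \<bar>(b' - b) - (a' - a)\<bar>
    + (2 * \<bar>c b' - c a'\<bar> + 2 * \<bar>c b - c a\<bar>)"
  proof (cases "a \<le> 0 \<and> b \<le> 0 \<and> a' \<le> 0 \<and> b' \<le> 0 \<or> 0 \<le> a \<and> 0 \<le> b \<and> 0 \<le> a' \<and> 0 \<le> b'")
    case True
    then have "\<bar>(\<bar>b'\<bar> - \<bar>b\<bar>) - (\<bar>a'\<bar> - \<bar>a\<bar>)\<bar> = \<bar>(b' - b) - (a' - a)\<bar>"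
      by (elim disjE conjE) (simp_all add: abs_if)
    then show ?thesis by simp
  next
    case signs: False
    show ?thesis
    proof (cases "\<bar>a\<bar> \<le> \<delta> \<and> \<bar>b\<bar> \<le> \<delta> \<and> \<bar>a'\<bar> \<le> \<delta> \<and> \<bar>b'\<bar> \<le> \<delta>")
      case True
      have "c t = t" if "\<bar>t\<bar> \<le> \<delta>" for t using that by (auto simp: c_def clamp_real_def)
      then have "c a = a" "c b = b" "c a' = a'" "c b' = b'" using True by auto
      moreover have "\<bar>(\<bar>b'\<bar> - \<bar>b\<bar>) - (\<bar>a'\<bar> - \<bar>a\<bar>)\<bar> \<le> \<bar>b' - a'\<bar> + \<bar>b - a\<bar>" by linarith
      moreover have "L \<le> W + (2 * \<bar>x\<bar> + 2 * \<bar>y\<bar>)" if "L \<le> \<bar>x\<bar> + \<bar>y\<bar>" "0 \<le> W" for L W x y :: real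
        using that by linarith
      ultimately show ?thesis by (metis abs_ge_zero)
    next
      case False
      then consider "\<delta> < a \<or> \<delta> < a'" | "a < - \<delta> \<or> a' < - \<delta>" | "\<delta> < b \<or> \<delta> < b'" | "b < - \<delta> \<or> b' < - \<delta>"
        by linarith
      then have "\<delta> / 2 \<le> \<bar>c b' - c a'\<bar> \<or> \<delta> / 2 \<le> \<bar>c b - c a\<bar>"
      proof cases
        case 1
        then have "\<delta> / 2 \<le> a" "\<delta> / 2 \<le> a'" using assms by linarith+
        then show ?thesis using far(2)[of a b] far(2)[of a' b'] signs \<delta> by linarith
      next
        case 2
        then have "a \<le> - \<delta> / 2" "a' \<le> - \<delta> / 2" using assms by linarith+
        then show ?thesis using far(2)[of a b] far(2)[of a' b'] signs \<delta> by linarith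
      next
        case 3
        then have "\<delta> / 2 \<le> b" "\<delta> / 2 \<le> b'" using assms by linarith+
        then show ?thesis using far(1)[of b a] far(1)[of b' a'] signs \<delta> by linarith
      next
        case 4
        then have "b \<le> - \<delta> / 2" "b' \<le> - \<delta> / 2" using assms by linarith+
        then show ?thesis using far(1)[of b a] far(1)[of b' a'] signs \<delta> by linarith
      qed
      moreover have "L \<le> W + (2 * x + 2 * y)"
        if "L \<le> \<delta> / 2" "\<delta> / 2 \<le> x \<or> \<delta> / 2 \<le> y" "0 \<le> W" "0 \<le> x" "0 \<le> y" for L W x y :: real
        using that \<delta> by linarith
      ultimately show ?thesis using small by simp
    qed
  qed
  then show ?thesis by (simp add: c_def)
qed

lemma BV_LIMSEQ_abs:
  assumes F: "BV_LIMSEQ F f"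
  shows "BV_LIMSEQ (\<lambda>n x. \<bar>F n x\<bar>) (\<lambda>x. \<bar>f x\<bar>)"
proof (rule BV_LIMSEQ_I)
  note f = BV_LIMSEQ_D(2)[OF F] and Fn = BV_LIMSEQ_D(1)[OF F]
  show "(\<lambda>x. \<bar>F n x\<bar>) \<in> BV" for n by (rule BV_abs[OF Fn])
  show "(\<lambda>x. \<bar>f x\<bar>) \<in> BV" by (rule BV_abs[OF f])
  fix e :: real assume e: "0 < e"
  have "\<forall>\<^sub>F n in sequentially. BV_dist (F n) f < e"
    using order_tendstoD(2)[OF BV_LIMSEQ_D(6)[OF F] e] .
  then show "\<forall>\<^sub>F n in sequentially. \<forall>x. \<bar>\<bar>F n x\<bar> - \<bar>f x\<bar>\<bar> \<le> e"
  proof eventually_elim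
    case (elim n)
    show ?case
    proof
      fix x show "\<bar>\<bar>F n x\<bar> - \<bar>f x\<bar>\<bar> \<le> e"
        using BV_LIMSEQ_D(3)[OF F, of n x] elim by linarith
    qed
  qed
  \<comment> \<open>The constant sequence lets the clamping lemma provide a threshold for
    \<open>f\<close> itself.\<close>
  have const: "BV_LIMSEQ (\<lambda>_. f) f" using f BV_norm_eq_0_iff[OF BV_diff[OF f f]] by (simp add: BV_LIMSEQ_def BV_dist_def)
  obtain \<delta>1 where \<delta>1: "0 < \<delta>1"
    "\<forall>\<^sub>F n in sequentially. \<forall>x y. x \<le> y \<longrightarrow> variation_on (\<lambda>x. clamp_real \<delta>1 (F n x)) x y \<le> e / 8"
    using variation_on_clamp_small[OF F, of "e / 8"] e by auto
  obtain \<delta>2 where \<delta>2: "0 < \<delta>2"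
    "\<And>x y. x \<le> y \<Longrightarrow> variation_on (\<lambda>x. clamp_real \<delta>2 (f x)) x y \<le> e / 8"
    using variation_on_clamp_small[OF const, of "e / 8"] e by auto
  define \<delta> where "\<delta> = min \<delta>1 \<delta>2"
  have \<delta>: "0 < \<delta>" using \<delta>1 \<delta>2 by (simp add: \<delta>_def)
  \<comment> \<open>Clamped increments grow with the threshold, so the smaller of the two thresholds
    serves both \<open>F n\<close> and \<open>f\<close>.\<close>
  have clamp_mono: "variation_on (\<lambda>x. clamp_real \<delta> (g x)) x y \<le> variation_on (\<lambda>x. clamp_real d (g x)) x y"
    if "g \<in> BV" "\<delta> \<le> d" "x \<le> y" for g d x y
  proof -
    have c: "(\<lambda>x. clamp_real d (g x)) \<in> BV" using BV_clamp[OF that(1), of d] that \<delta> by auto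
    have "\<bar>clamp_real \<delta> s - clamp_real \<delta> t\<bar> \<le> \<bar>clamp_real d s - clamp_real d t\<bar>" for s t
      using that(2) \<delta> by (auto simp: clamp_real_def max_def min_def abs_if)
    then show ?thesis using variation_on_linear_le[OF c c that(3), of 1 0] by simp
  qed
  have "\<forall>\<^sub>F n in sequentially. BV_dist (F n) f < min (\<delta> / 4) (e / 4)"
    using order_tendstoD(2)[OF BV_LIMSEQ_D(6)[OF F], of "min (\<delta> / 4) (e / 4)"] e \<delta> by simp
  with \<delta>1(2) show "\<forall>\<^sub>F n in sequentially. \<forall>x y. x \<le> y \<longrightarrow> variation_on (\<lambda>x. \<bar>F n x\<bar> - \<bar>f x\<bar>) x y \<le> e"
  proof eventually_elim
    case (elim n)
    let ?C = "\<lambda>g x. clamp_real \<delta> (g x)" and ?w = "\<lambda>x. F n x - f x"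
    have c: "?C (F n) \<in> BV" "?C f \<in> BV" using BV_clamp(1) \<delta> f Fn by auto
    have w: "?w \<in> BV" by (intro BV_diff f Fn)
    have "variation_on (\<lambda>x. \<bar>F n x\<bar> - \<bar>f x\<bar>) s t \<le> e" if "s \<le> t" for s t
    proof -
      let ?G = "\<lambda>x y. variation_on ?w x y + (2 * variation_on (?C (F n)) x y + 2 * variation_on (?C f) x y)"
      have "variation_on (\<lambda>x. \<bar>F n x\<bar> - \<bar>f x\<bar>) s t \<le> ?G s t"
      proof (rule variation_on_le[OF that])
        fix x y :: real assume "x \<le> y"
        have "\<bar>F n z - f z\<bar> \<le> \<delta> / 4" for z using BV_LIMSEQ_D(3)[OF F, of n z] elim(2) by simp
        from abs_increments_close[OF this this]
        show "\<bar>\<bar>F n y\<bar> - \<bar>f y\<bar> - (\<bar>F n x\<bar> - \<bar>f x\<bar>)\<bar> \<le> ?G x y"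
          using abs_diff_le_variation_on[OF w \<open>x \<le> y\<close>] abs_diff_le_variation_on[OF c(1) \<open>x \<le> y\<close>]
            abs_diff_le_variation_on[OF c(2) \<open>x \<le> y\<close>] by (smt (verit))
      next
        fix x y z :: real assume "x \<le> y" "y \<le> z"
        then show "?G x y + ?G y z \<le> ?G x z"
          by (simp add: variation_on_add[OF w, of x y z] variation_on_add[OF c(1), of x y z]
              variation_on_add[OF c(2), of x y z])
      qed
      also have "\<dots> \<le> e / 4 + (2 * (e / 8) + 2 * (e / 8))"
      proof -
        have "variation_on ?w s t \<le> e / 4" using BV_LIMSEQ_D(4)[OF F that, of n] elim(2) by linarith
        moreover have "variation_on (?C (F n)) s t \<le> e / 8"
          using clamp_mono[OF Fn[of n] _ that, of \<delta>1] elim(1) that by (force simp: \<delta>_def)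
        moreover have "variation_on (?C f) s t \<le> e / 8"
          using clamp_mono[OF f _ that, of \<delta>2] \<delta>2(2)[OF that] by (force simp: \<delta>_def)
        ultimately show ?thesis by linarith
      qed
      also have "\<dots> \<le> e" using e by simp
      finally show ?thesis .
    qed
    then show ?case by blast
  qed
qed

lemma BV_LIMSEQ_max:
  assumes F: "BV_LIMSEQ F f" and G: "BV_LIMSEQ G g"
  shows "BV_LIMSEQ (\<lambda>n x. max (F n x) (G n x)) (\<lambda>x. max (f x) (g x))"
proof -
  \<comment> \<open>The factors \<open>1\<close> and \<open>- 1\<close> are written out to match the
    shape of \<open>BV_LIMSEQ_linear\<close>.\<close>
  have max_eq: "max a b = 1 / 2 * (1 * a + 1 * b) + 1 / 2 * \<bar>1 * a + (- 1) * b\<bar>" for a b :: real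
    by (auto simp: max_def abs_if field_simps)
  show ?thesis
    unfolding max_eq by (intro BV_LIMSEQ_linear BV_LIMSEQ_abs F G)
qed

subsection \<open>Left limits\<close>

text \<open>Reduces measurability, integrability, countability of discontinuities and existence of
  left limits to monotone functions. The witness \<open>p\<close> is the signed variation from the
  base point 0.\<close>

lemma BV_jordan:
  assumes f: "f \<in> BV"
  obtains p q where "mono p" "mono q" "\<And>x. f x = p x - q x"
proof -
  define p where "p x = (if 0 \<le> x then variation_on f 0 x else - variation_on f x 0)" for x
  have p: "variation_on f x y \<le> p y - p x" if "x \<le> y" for x y
    using that variation_on_add[OF f, of 0 x y] variation_on_add[OF f, of x 0 y]
      variation_on_add[OF f, of x y 0] by (auto simp: p_def)
  have "mono p"
  proof (rule monoI)
    fix x y :: real assume "x \<le> y"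
    then show "p x \<le> p y" using p[of x y] variation_on_nonneg[OF f, of x y] by simp
  qed
  moreover have "mono (\<lambda>x. p x - f x)"
  proof (rule monoI)
    fix x y :: real assume "x \<le> y"
    then show "p x - f x \<le> p y - f y" using p[of x y] abs_diff_le_variation_on[OF f, of x y] by simp
  qed
  ultimately show ?thesis using that[of p "\<lambda>x. p x - f x"] by simp
qed

lemma BV_borel_measurable:
  assumes f: "f \<in> BV" shows "f \<in> borel_measurable borel"
proof -
  obtain p q where "mono p" "mono q" "\<And>x. f x = p x - q x" using BV_jordan[OF f] by blast
  then have "f = (\<lambda>x. p x - q x)" "p \<in> borel_measurable borel" "q \<in> borel_measurable borel"
    by (auto intro: borel_measurable_mono)
  then show ?thesis by simp
qed

lemma BV_integrable_on:
  assumes f: "f \<in> BV" shows "f integrable_on {a..b}"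
proof -
  obtain p q where "mono p" "mono q" "\<And>x. f x = p x - q x" using BV_jordan[OF f] by blast
  then have "f = (\<lambda>x. p x - q x)" "p integrable_on {a..b}" "q integrable_on {a..b}"
    by (auto intro!: integrable_on_mono_on simp: mono_on_def mono_def)
  then show ?thesis by (simp add: integrable_diff)
qed

lemma BV_countable_discont:
  assumes f: "f \<in> BV" shows "countable {x. \<not> isCont f x}"
proof -
  obtain p q where pq: "mono p" "mono q" "\<And>x. f x = p x - q x" using BV_jordan[OF f] by blast
  then have "f = (\<lambda>x. p x - q x)" by auto
  then have "{x. \<not> isCont f x} \<subseteq> {x. \<not> isCont p x} \<union> {x. \<not> isCont q x}"
    by (auto intro: continuous_diff)
  then show ?thesis using mono_ctble_discont pq by (meson countable_Un countable_subset)
qed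

lemma mono_tendsto_at_left:
  fixes p :: "real \<Rightarrow> real"
  assumes "mono p" shows "\<exists>l. (p \<longlongrightarrow> l) (at_left x)"
proof (intro exI increasing_tendsto)
  have bdd: "bdd_above (p ` {..<x})"
    using assms by (auto simp: bdd_above_def mono_def intro!: exI[of _ "p x"])
  show "\<forall>\<^sub>F y in at_left x. p y \<le> Sup (p ` {..<x})"
    using bdd by (auto simp: eventually_at_filter intro!: cSUP_upper eventuallyI)
  fix c assume "c < Sup (p ` {..<x})"
  then obtain y where "y < x" "c < p y"
    using less_cSUP_iff[OF _ bdd, of c] by (auto simp: lt_ex)
  then show "\<forall>\<^sub>F y in at_left x. c < p y"
    using assms unfolding eventually_at_left_field
    by (intro exI[of _ y]) (auto simp: mono_def intro: less_le_trans)
qed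

text \<open>Passing to left limits changes \<open>f\<close> only on a countable set, hence no
  average, but makes \<open>f\<close> lie below its left maximal function at every point.\<close>

definition left_lim :: "(real \<Rightarrow> real) \<Rightarrow> real \<Rightarrow> real" where
  "left_lim f x = Lim (at_left x) f"

lemma left_lim_eqI: "(f \<longlongrightarrow> l) (at_left x) \<Longrightarrow> left_lim f x = l"
  by (simp add: left_lim_def tendsto_Lim)

lemma tendsto_left_lim:
  assumes f: "f \<in> BV"
  shows "(f \<longlongrightarrow> left_lim f x) (at_left x)"
proof -
  obtain p q where pq: "mono p" "mono q" "\<And>x. f x = p x - q x" using BV_jordan[OF f] by blast
  obtain l m where "(p \<longlongrightarrow> l) (at_left x)" "(q \<longlongrightarrow> m) (at_left x)"
    using mono_tendsto_at_left pq by blast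
  from tendsto_diff[OF this] have "(f \<longlongrightarrow> l - m) (at_left x)" using pq(3) by (simp add: fun_eq_iff[THEN iffD2, of f "\<lambda>x. p x - q x"])
  then show ?thesis using left_lim_eqI by force
qed

lemma left_lim_diff:
  assumes "f \<in> BV" "g \<in> BV"
  shows "left_lim (\<lambda>x. f x - g x) x = left_lim f x - left_lim g x"
  by (intro left_lim_eqI tendsto_diff tendsto_left_lim assms)

lemma abs_left_lim_le:
  assumes "f \<in> BV" "\<And>x. \<bar>f x\<bar> \<le> d"
  shows "\<bar>left_lim f x\<bar> \<le> d"
  using tendsto_rabs[OF tendsto_left_lim[OF assms(1)]]
  by (rule tendsto_upperbound) (auto simp: assms(2))

text \<open>A sum for \<open>left_lim f\<close> is the limit of sums for \<open>f\<close> over the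
  same partition shifted to the left by \<open>1 / (real n + 1)\<close>.\<close>

lemma total_variation_left_lim:
  assumes f: "f \<in> BV"
  shows "total_variation (left_lim f) \<le> total_variation f"
proof -
  have "total_variation (left_lim f) \<le> ennreal (enn2real (total_variation f))"
  proof (rule total_variation_le, rule ennreal_leI)
    fix K and a :: "nat \<Rightarrow> real" assume a: "strict_mono_on {0..K} a"
    have lim: "(\<lambda>n. f (x - 1 / (real n + 1))) \<longlonglongrightarrow> left_lim f x" for x
    proof (rule filterlim_compose[OF tendsto_left_lim[OF f]])
      have "(\<lambda>n. x - 1 / (real n + 1)) \<longlonglongrightarrow> x - 0"
        by (intro tendsto_diff tendsto_const) (use LIMSEQ_inverse_real_of_nat in \<open>simp add: inverse_eq_divide add.commute\<close>)
      then show "filterlim (\<lambda>n. x - 1 / (real n + 1)) (at_left x) sequentially"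
        by (auto simp: filterlim_at)
    qed
    show "(\<Sum>i<K. \<bar>left_lim f (a (Suc i)) - left_lim f (a i)\<bar>) \<le> enn2real (total_variation f)"
    proof (rule LIMSEQ_le_const2)
      show "(\<lambda>n. \<Sum>i<K. \<bar>f (a (Suc i) - 1 / (real n + 1)) - f (a i - 1 / (real n + 1))\<bar>)
          \<longlonglongrightarrow> (\<Sum>i<K. \<bar>left_lim f (a (Suc i)) - left_lim f (a i)\<bar>)"
        by (intro tendsto_intros lim)
      have "(\<Sum>i<K. \<bar>f (a (Suc i) - c) - f (a i - c)\<bar>) \<le> enn2real (total_variation f)" for c
        by (rule BV_sum_le[OF f, of K "\<lambda>i. a i - c"]) (use a in \<open>auto simp: strict_mono_on_def\<close>)
      then show "\<exists>N. \<forall>n\<ge>N. (\<Sum>i<K. \<bar>f (a (Suc i) - 1 / (real n + 1)) - f (a i - 1 / (real n + 1))\<bar>)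
          \<le> enn2real (total_variation f)" by blast
    qed
  qed
  then show ?thesis using f by (simp add: BV_def)
qed

lemma BV_left_lim: "f \<in> BV \<Longrightarrow> left_lim f \<in> BV"
  using total_variation_left_lim[of f] by (auto simp: BV_def intro: le_less_trans)

lemma left_lim_left_continuous:
  assumes f: "f \<in> BV"
  shows "(left_lim f \<longlongrightarrow> left_lim f x) (at_left x)"
proof (rule tendstoI)
  fix e :: real assume e: "0 < e"
  then obtain y where y: "y < x" "\<And>t. y < t \<Longrightarrow> t < x \<Longrightarrow> dist (f t) (left_lim f x) < e / 2"
    using tendstoD[OF tendsto_left_lim[OF f], of "e / 2" x] by (auto simp: eventually_at_left_field)
  have "dist (left_lim f t) (left_lim f x) < e" if "y < t" "t < x" for t
  proof -
    have "((\<lambda>s. dist (f s) (left_lim f x)) \<longlongrightarrow> dist (left_lim f t) (left_lim f x)) (at_left t)"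
      by (intro tendsto_intros tendsto_left_lim f)
    moreover have "\<forall>\<^sub>F s in at_left t. dist (f s) (left_lim f x) \<le> e / 2"
      using y that unfolding eventually_at_left_field
      by (intro exI[of _ y]) (auto intro!: less_imp_le)
    ultimately have "dist (left_lim f t) (left_lim f x) \<le> e / 2" by (rule tendsto_upperbound) simp
    then show ?thesis using e by simp
  qed
  then show "\<forall>\<^sub>F t in at_left x. dist (left_lim f t) (left_lim f x) < e"
    using y unfolding eventually_at_left_field by blast
qed

lemma integral_left_lim:
  assumes f: "f \<in> BV"
  shows "integral S (left_lim f) = integral S f"
proof (rule integral_spike)
  show "negligible {x. \<not> isCont f x}"
    using countable_imp_null_set_lborel[OF BV_countable_discont[OF f]]
    by (simp add: negligible_iff_null_sets null_sets_completionI)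
  fix x assume "x \<in> S - {x. \<not> isCont f x}"
  then have "(f \<longlongrightarrow> f x) (at_left x)"
    by (auto simp: isCont_def intro: filterlim_at_split[THEN iffD1, THEN conjunct1])
  then show "f x = left_lim f x" using left_lim_eqI by force
qed

lemma BV_LIMSEQ_left_lim:
  assumes F: "BV_LIMSEQ F f"
  shows "BV_LIMSEQ (\<lambda>n. left_lim (F n)) (left_lim f)"
proof (rule BV_LIMSEQ_I)
  note f = BV_LIMSEQ_D(2)[OF F] and Fn = BV_LIMSEQ_D(1)[OF F]
  show "left_lim (F n) \<in> BV" "left_lim f \<in> BV" for n by (intro BV_left_lim f Fn)+
  have w: "(\<lambda>x. F n x - f x) \<in> BV" for n by (intro BV_diff f Fn)
  have eq: "(\<lambda>x. left_lim (F n) x - left_lim f x) = left_lim (\<lambda>x. F n x - f x)" for n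
    by (auto simp: left_lim_diff[OF Fn f])
  fix e :: real assume e: "0 < e"
  have ev: "\<forall>\<^sub>F n in sequentially. BV_dist (F n) f \<le> e"
    using order_tendstoD(2)[OF BV_LIMSEQ_D(6)[OF F] e] by eventually_elim simp
  then show "\<forall>\<^sub>F n in sequentially. \<forall>x. \<bar>left_lim (F n) x - left_lim f x\<bar> \<le> e"
  proof eventually_elim
    case (elim n)
    have "\<bar>left_lim (\<lambda>x. F n x - f x) x\<bar> \<le> BV_dist (F n) f" for x
      using BV_LIMSEQ_D(3)[OF F] by (intro abs_left_lim_le w)
    then show ?case using elim unfolding eq[symmetric] by (meson order_trans)
  qed
  from ev show "\<forall>\<^sub>F n in sequentially. \<forall>x y. x \<le> y \<longrightarrow>
      variation_on (\<lambda>x. left_lim (F n) x - left_lim f x) x y \<le> e"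
  proof eventually_elim
    case (elim n)
    have "variation_on (left_lim (\<lambda>x. F n x - f x)) x y \<le> e" if "x \<le> y" for x y
    proof -
      have "variation_on (left_lim (\<lambda>x. F n x - f x)) x y \<le> enn2real (total_variation (left_lim (\<lambda>x. F n x - f x)))"
        by (intro variation_on_le_total BV_left_lim w that)
      also have "\<dots> \<le> enn2real (total_variation (\<lambda>x. F n x - f x))"
        using w[of n] by (intro enn2real_mono total_variation_left_lim) (auto simp: BV_def)
      also have "\<dots> \<le> BV_dist (F n) f" by (simp add: BV_dist_def BV_norm_def)
      finally show ?thesis using elim by linarith
    qed
    then show ?case unfolding eq by blast
  qed
qed

subsection \<open>The one-sided maximal operator\<close>

text \<open>The absolute value is taken beforehand, so this is a supremum of averages of a signed
  function and may be negative. The integral is the gauge integral.\<close>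

definition left_maximal :: "(real \<Rightarrow> real) \<Rightarrow> real \<Rightarrow> real" where
  "left_maximal f x = (SUP a\<in>{..<x}. integral {a..x} f / (x - a))"

lemma BV_integral_le:
  assumes "f \<in> BV" "a \<le> b" "\<And>t. a \<le> t \<Longrightarrow> t \<le> b \<Longrightarrow> f t \<le> c"
  shows "integral {a..b} f \<le> c * (b - a)"
  using integral_le[OF BV_integrable_on[OF assms(1), of a b] integrable_const_ivl[of c a b]] assms by (simp add: mult.commute)

lemma BV_integral_ge:
  assumes "f \<in> BV" "a \<le> b" "\<And>t. a \<le> t \<Longrightarrow> t \<le> b \<Longrightarrow> c \<le> f t"
  shows "c * (b - a) \<le> integral {a..b} f"
  using integral_le[OF integrable_const_ivl[of c a b] BV_integrable_on[OF assms(1), of a b]] assms by (simp add: mult.commute)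

lemma BV_integral_combine:
  assumes "f \<in> BV" "a \<le> b" "b \<le> c"
  shows "integral {a..c} f = integral {a..b} f + integral {b..c} f"
  using Henstock_Kurzweil_Integration.integral_combine[OF assms(2,3) BV_integrable_on[OF assms(1)]] by simp

lemma left_maximal_le:
  assumes "\<And>a. a < x \<Longrightarrow> integral {a..x} f \<le> c * (x - a)"
  shows "left_maximal f x \<le> c"
  unfolding left_maximal_def
  by (rule cSUP_least) (use assms lt_ex[of x] in \<open>auto simp: divide_le_eq\<close>)

lemma left_maximal_ge:
  assumes f: "f \<in> BV" and "a \<le> x"
  shows "integral {a..x} f \<le> left_maximal f x * (x - a)"
proof (cases "a = x")
  case False
  then have "a < x" using assms by simp
  have "bdd_above ((\<lambda>a. integral {a..x} f / (x - a)) ` {..<x})"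
    unfolding bdd_above_def
  proof (intro exI ballI)
    fix v assume "v \<in> (\<lambda>a. integral {a..x} f / (x - a)) ` {..<x}"
    then obtain b where "b < x" "v = integral {b..x} f / (x - b)" by auto
    moreover have "f t \<le> BV_norm f" for t using abs_le_BV_norm[OF f, of t] by linarith
    ultimately show "v \<le> BV_norm f" using BV_integral_le[OF f, of b x "BV_norm f"] by (simp add: divide_le_eq)
  qed
  from cSUP_upper[OF _ this, of a] \<open>a < x\<close> have "integral {a..x} f / (x - a) \<le> left_maximal f x"
    by (simp add: left_maximal_def)
  then show ?thesis using \<open>a < x\<close> by (simp add: divide_le_eq)
qed simp

lemma left_maximal_bounds:
  assumes f: "f \<in> BV" and "\<And>x. \<bar>f x\<bar> \<le> S"
  shows "\<bar>left_maximal f x\<bar> \<le> S"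
proof -
  have b: "f t \<le> S" "- S \<le> f t" for t using assms(2)[of t] by linarith+
  have "left_maximal f x \<le> S" using b by (intro left_maximal_le BV_integral_le f) auto
  moreover have "- S \<le> left_maximal f x"
    using left_maximal_ge[OF f, of "x - 1" x] BV_integral_ge[OF f, of "x - 1" x "- S"] b by simp
  ultimately show ?thesis by linarith
qed

lemma left_maximal_diff:
  assumes f: "f \<in> BV" and g: "g \<in> BV" and "\<And>x. \<bar>f x - g x\<bar> \<le> d"
  shows "\<bar>left_maximal f x - left_maximal g x\<bar> \<le> d"
proof -
  have *: "left_maximal f x \<le> left_maximal g x + d"
    if f: "f \<in> BV" and g: "g \<in> BV" and d: "\<And>x. \<bar>f x - g x\<bar> \<le> d" for f g
  proof (rule left_maximal_le)
    fix a assume a: "a < x"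
    have "integral {a..x} f - integral {a..x} g = integral {a..x} (\<lambda>t. f t - g t)"
      by (simp add: Henstock_Kurzweil_Integration.integral_diff BV_integrable_on f g)
    also have "\<dots> \<le> d * (x - a)"
    proof (intro BV_integral_le BV_diff f g)
      fix t show "f t - g t \<le> d" using d[of t] by linarith
    qed (use a in simp)
    finally show "integral {a..x} f \<le> (left_maximal g x + d) * (x - a)"
      using left_maximal_ge[OF g, of a x] a by (simp add: algebra_simps)
  qed
  have "\<bar>g x - f x\<bar> \<le> d" for x using assms(3)[of x] by linarith
  then show ?thesis using *[OF f g assms(3)] *[OF g f] by fastforce
qed

text \<open>An average over an interval that starts before \<open>x\<close> and ends at
  \<open>y\<close> splits at \<open>x\<close>; the first piece is controlled by the value at
  \<open>x\<close>, the second by \<open>f\<close> in between. The values of \<open>f\<close> at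
  \<open>x\<close> and \<open>y\<close> do not enter, which matters at jumps.\<close>

lemma left_maximal_step:
  assumes f: "f \<in> BV" and "x \<le> y" "left_maximal f x \<le> c"
    and c: "\<And>t. x < t \<Longrightarrow> t < y \<Longrightarrow> f t \<le> c"
  shows "left_maximal f y \<le> c"
proof (cases "x = y")
  case False
  then have xy: "x < y" using assms by simp
  have int: "integral {a..y} f \<le> c * (y - a)" if "x \<le> a" "a < y" for a
  proof -
    \<comment> \<open>The bound on \<open>f\<close> is known only strictly between the
      endpoints.\<close>
    have "integral {a..y} f = integral {a<..<y} f"
      by (metis box_real(1) box_real(2) integral_open_interval)
    also have "\<dots> \<le> integral {a<..<y} (\<lambda>_. c)"
      using c that BV_integrable_on[OF f, of a y]
      by (intro integral_le) (auto simp: integrable_on_open_interval_real)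
    also have "\<dots> = integral {a..y} (\<lambda>_. c)"
      by (metis box_real(1) box_real(2) integral_open_interval)
    also have "\<dots> = c * (y - a)" using that by simp
    finally show ?thesis .
  qed
  show ?thesis
  proof (rule left_maximal_le)
    fix a assume a: "a < y"
    show "integral {a..y} f \<le> c * (y - a)"
    proof (cases "x \<le> a")
      case False
      then have "integral {a..x} f \<le> c * (x - a)"
        using left_maximal_ge[OF f, of a x] mult_right_mono[OF assms(3), of "x - a"] by linarith
      then show ?thesis
        using int[of x] xy False BV_integral_combine[OF f, of a x y] by (simp add: algebra_simps)
    qed (use int a in simp)
  qed
qed (use assms in simp)

text \<open>Lower semicontinuity: a nearly optimal left end \<open>a\<close> is kept fixed while the
  right end moves.\<close>

lemma left_maximal_lower_near:
  assumes f: "f \<in> BV" and e: "0 < e"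
  obtains r where "0 < r" "\<And>y. \<bar>y - x\<bar> < r \<Longrightarrow> left_maximal f x - e \<le> left_maximal f y"
proof -
  define c where "c = left_maximal f x - e"
  obtain a where a: "a < x" "(c + e / 2) * (x - a) < integral {a..x} f"
    using left_maximal_le[of x f "c + e / 2"] e by (force simp: c_def)
  \<comment> \<open>Moving the right end by less than \<open>r\<close> changes the integral by at
    most \<open>BV_norm f * r\<close> and \<open>c\<close> times the length by at most
    \<open>\<bar>c\<bar> * r\<close>; the summand 1 only makes \<open>S\<close> positive. The slack
    available is \<open>e / 2 * (x - a)\<close>.\<close>
  define S where "S = BV_norm f + \<bar>c\<bar> + 1"
  have S: "0 < S" by (simp add: S_def BV_norm_nonneg add_nonneg_pos)
  define r where "r = min (x - a) (e * (x - a) / (2 * S))"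
  have r: "0 < r" using a e S by (simp add: r_def)
  have rS: "S * r \<le> e / 2 * (x - a)"
    using S by (simp add: r_def min_def field_simps)
  have "c \<le> left_maximal f y" if y: "\<bar>y - x\<bar> < r" for y
  proof -
    have ay: "a < y" using y unfolding r_def by linarith
    have fb: "f t \<le> BV_norm f" "- BV_norm f \<le> f t" for t using abs_le_BV_norm[OF f, of t] by linarith+
    have "integral {a..x} f - BV_norm f * \<bar>y - x\<bar> \<le> integral {a..y} f"
    proof (cases "x \<le> y")
      case True
      then show ?thesis using BV_integral_combine[OF f, of a x y] a
          BV_integral_ge[OF f True, of "- BV_norm f"] fb by simp
    next
      case False
      then show ?thesis using BV_integral_combine[OF f, of a y x] ay
          BV_integral_le[OF f, of y x "BV_norm f"] fb by simp
    qed
    moreover have "c * (y - x) \<le> \<bar>c\<bar> * \<bar>y - x\<bar>"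
      by (metis abs_ge_self abs_mult)
    then have "c * (y - a) \<le> c * (x - a) + \<bar>c\<bar> * \<bar>y - x\<bar>"
      by (simp add: right_diff_distrib)
    moreover have "(BV_norm f + \<bar>c\<bar>) * \<bar>y - x\<bar> \<le> S * r"
      using y S by (intro mult_mono) (auto simp: S_def BV_norm_nonneg)
    ultimately have "c * (y - a) \<le> integral {a..y} f"
      using rS a(2) unfolding distrib_right by linarith
    also have "\<dots> \<le> left_maximal f y * (y - a)" using ay by (intro left_maximal_ge f) simp
    finally show ?thesis using ay by simp
  qed
  with r that show ?thesis unfolding c_def by blast
qed

lemma left_continuousD:
  fixes f :: "real \<Rightarrow> real"
  assumes "\<forall>x. (f \<longlongrightarrow> f x) (at_left x)" "0 < e"
  obtains r where "0 < r" "\<And>t. x - r < t \<Longrightarrow> t \<le> x \<Longrightarrow> \<bar>f t - f x\<bar> \<le> e"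
proof -
  obtain b where b: "b < x" "\<And>t. b < t \<Longrightarrow> t < x \<Longrightarrow> dist (f t) (f x) < e"
    using tendstoD[OF assms(1)[rule_format, of x] assms(2)] by (auto simp: eventually_at_left_field)
  have "\<bar>f t - f x\<bar> \<le> e" if "x - (x - b) < t" "t \<le> x" for t
    using b(2)[of t] that assms(2) by (cases "t = x") (auto simp: dist_real_def)
  then show ?thesis using that[of "x - b"] b(1) by auto
qed

text \<open>Short averages ending at \<open>x\<close> approach \<open>f x\<close> by left
  continuity; at a point whose value lies above the left limit this could fail.\<close>

lemma le_left_maximal:
  assumes f: "f \<in> BV" and cont: "\<forall>x. (f \<longlongrightarrow> f x) (at_left x)"
  shows "f x \<le> left_maximal f x"
proof (rule field_le_epsilon)
  fix e :: real assume e: "0 < e"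
  obtain r where r: "0 < r" "\<And>t. x - r < t \<Longrightarrow> t \<le> x \<Longrightarrow> \<bar>f t - f x\<bar> \<le> e"
    using left_continuousD[OF cont e] by blast
  have "(f x - e) * (r / 2) \<le> integral {x - r / 2..x} f"
  proof -
    have "f x - e \<le> f t" if "x - r / 2 \<le> t" "t \<le> x" for t
      using r(2)[of t] that r(1) by linarith
    then show ?thesis using BV_integral_ge[OF f, of "x - r / 2" x "f x - e"] r(1) by simp
  qed
  also have "\<dots> \<le> left_maximal f x * (r / 2)" using left_maximal_ge[OF f, of "x - r / 2" x] r(1) by simp
  finally show "f x \<le> left_maximal f x + e" using r(1) by simp
qed

section \<open>Positive and negative variation, and the variation of the maximal function\<close>

definition pos_variation_on :: "(real \<Rightarrow> real) \<Rightarrow> real \<Rightarrow> real \<Rightarrow> real" where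
  "pos_variation_on f x y = (variation_on f x y + (f y - f x)) / 2"

definition neg_variation_on :: "(real \<Rightarrow> real) \<Rightarrow> real \<Rightarrow> real \<Rightarrow> real" where
  "neg_variation_on f x y = (variation_on f x y - (f y - f x)) / 2"

lemma pos_variation_on_add:
  "f \<in> BV \<Longrightarrow> x \<le> y \<Longrightarrow> y \<le> z \<Longrightarrow> pos_variation_on f x z = pos_variation_on f x y + pos_variation_on f y z"
  by (simp add: pos_variation_on_def variation_on_add[of f x y z] field_simps)

lemma neg_variation_on_add:
  "f \<in> BV \<Longrightarrow> x \<le> y \<Longrightarrow> y \<le> z \<Longrightarrow> neg_variation_on f x z = neg_variation_on f x y + neg_variation_on f y z"
  by (simp add: neg_variation_on_def variation_on_add[of f x y z] field_simps)

lemma pos_variation_on_bounds: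
  assumes "f \<in> BV" "x \<le> y"
  shows "0 \<le> pos_variation_on f x y" "f y - f x \<le> pos_variation_on f x y"
    "pos_variation_on f x y \<le> variation_on f x y"
  using abs_diff_le_variation_on[OF assms] by (simp_all add: pos_variation_on_def)

lemma neg_variation_on_bounds:
  assumes "f \<in> BV" "x \<le> y"
  shows "0 \<le> neg_variation_on f x y" "f x - f y \<le> neg_variation_on f x y"
    "neg_variation_on f x y \<le> variation_on f x y"
  using abs_diff_le_variation_on[OF assms] by (simp_all add: neg_variation_on_def)

lemma left_maximal_increase:
  assumes f: "f \<in> BV" and cont: "\<forall>x. (f \<longlongrightarrow> f x) (at_left x)" and xy: "x \<le> y"
  shows "left_maximal f y - left_maximal f x \<le> pos_variation_on f x y"
proof -
  have "left_maximal f y \<le> left_maximal f x + pos_variation_on f x y"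
  proof (rule left_maximal_step[OF f xy])
    show "left_maximal f x \<le> left_maximal f x + pos_variation_on f x y"
      using pos_variation_on_bounds[OF f xy] by simp
    fix t assume t: "x < t" "t < y"
    have "f t \<le> f x + pos_variation_on f x t" using pos_variation_on_bounds[OF f, of x t] t by simp
    also have "\<dots> \<le> left_maximal f x + pos_variation_on f x y"
      using le_left_maximal[OF f cont, of x] pos_variation_on_add[OF f, of x t y]
        pos_variation_on_bounds[OF f, of t y] t by simp
    finally show "f t \<le> left_maximal f x + pos_variation_on f x y" .
  qed
  then show ?thesis by simp
qed

text \<open>An increment \<open>i\<close> bounded above by \<open>P\<close>, with \<open>P\<close>
  nonnegative, satisfies \<open>\<bar>i\<bar> \<le> 2 * P - i\<close>. For \<open>P\<close> the
  positive variation of \<open>f\<close> the right-hand side is additive and bounded.\<close>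

lemma BV_left_maximal:
  assumes f: "f \<in> BV" and cont: "\<forall>x. (f \<longlongrightarrow> f x) (at_left x)"
  shows "left_maximal f \<in> BV"
proof (rule BV_superadditiveI[where G = "\<lambda>x y. 2 * pos_variation_on f x y - (left_maximal f y - left_maximal f x)"])
  fix x y :: real assume xy: "x \<le> y"
  show "\<bar>left_maximal f y - left_maximal f x\<bar> \<le> 2 * pos_variation_on f x y - (left_maximal f y - left_maximal f x)"
    using left_maximal_increase[OF f cont xy] pos_variation_on_bounds[OF f xy] by linarith
  show "2 * pos_variation_on f x y - (left_maximal f y - left_maximal f x)
    \<le> 2 * enn2real (total_variation f) + 2 * BV_norm f"
    using pos_variation_on_bounds(3)[OF f xy] variation_on_le_total[OF f xy]
      left_maximal_bounds[OF f abs_le_BV_norm[OF f], of x] left_maximal_bounds[OF f abs_le_BV_norm[OF f], of y]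
    by linarith
next
  fix x y z :: real assume "x \<le> y" "y \<le> z"
  then show "2 * pos_variation_on f x y - (left_maximal f y - left_maximal f x)
     + (2 * pos_variation_on f y z - (left_maximal f z - left_maximal f y))
    \<le> 2 * pos_variation_on f x z - (left_maximal f z - left_maximal f x)"
    using pos_variation_on_add[OF f, of x y z] by linarith
qed

lemma variation_on_left_maximal:
  assumes f: "f \<in> BV" and cont: "\<forall>x. (f \<longlongrightarrow> f x) (at_left x)" and st: "s \<le> t"
  shows "variation_on (left_maximal f) s t
    \<le> 2 * pos_variation_on f s t - (left_maximal f t - left_maximal f s)"
proof (rule variation_on_le[OF st])
  fix x y :: real assume xy: "x \<le> y"
  show "\<bar>left_maximal f y - left_maximal f x\<bar> \<le> 2 * pos_variation_on f x y - (left_maximal f y - left_maximal f x)"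
    using left_maximal_increase[OF f cont xy] pos_variation_on_bounds[OF f xy] by linarith
next
  fix x y z :: real assume "x \<le> y" "y \<le> z"
  then show "2 * pos_variation_on f x y - (left_maximal f y - left_maximal f x)
     + (2 * pos_variation_on f y z - (left_maximal f z - left_maximal f y))
    \<le> 2 * pos_variation_on f x z - (left_maximal f z - left_maximal f x)"
    using pos_variation_on_add[OF f, of x y z] by linarith
qed

text \<open>Increments of \<open>f\<close> are positive minus negative variation, and those of the
  maximal function are at most the positive one, so increments of the difference are at most the
  negative variation. The same bound by \<open>2 * N - i\<close> now telescopes, and the final gap
  is dropped because it is nonnegative.\<close>

lemma variation_on_left_maximal_diff_self:
  assumes f: "f \<in> BV" and cont: "\<forall>x. (f \<longlongrightarrow> f x) (at_left x)" and st: "s \<le> t"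
  shows "variation_on (\<lambda>x. left_maximal f x - f x) s t
    \<le> 2 * neg_variation_on f s t + (left_maximal f s - f s)"
proof -
  let ?G = "\<lambda>x y. 2 * neg_variation_on f x y + (f y - f x) - (left_maximal f y - left_maximal f x)"
  have "variation_on (\<lambda>x. left_maximal f x - f x) s t \<le> ?G s t"
  proof (rule variation_on_le[OF st])
    fix x y :: real assume xy: "x \<le> y"
    have "f y - f x = pos_variation_on f x y - neg_variation_on f x y"
      by (simp add: pos_variation_on_def neg_variation_on_def field_simps)
    then show "\<bar>(left_maximal f y - f y) - (left_maximal f x - f x)\<bar> \<le> ?G x y"
      using left_maximal_increase[OF f cont xy] neg_variation_on_bounds[OF f xy] by linarith
  next
    fix x y z :: real assume "x \<le> y" "y \<le> z"
    then show "?G x y + ?G y z \<le> ?G x z"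
      using neg_variation_on_add[OF f, of x y z] by linarith
  qed
  then show ?thesis using le_left_maximal[OF f cont, of t] by linarith
qed

text \<open>A crude bound without cancellation. It serves where \<open>f\<close> and its maximal
  function themselves vary little: next to a point and far out.\<close>

lemma left_maximal_diff_variation_le:
  assumes f: "f \<in> BV" "\<forall>x. (f \<longlongrightarrow> f x) (at_left x)" and g: "g \<in> BV" "\<forall>x. (g \<longlongrightarrow> g x) (at_left x)"
    and d: "\<And>x. \<bar>g x - f x\<bar> \<le> d" "\<And>x y. x \<le> y \<Longrightarrow> variation_on (\<lambda>x. g x - f x) x y \<le> d" and xy: "x \<le> y"
  shows "variation_on (\<lambda>x. left_maximal g x - left_maximal f x) x y
    \<le> 2 * variation_on f x y + 2 * variation_on (left_maximal f) x y + 4 * d"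
proof -
  let ?u = "left_maximal f" and ?v = "left_maximal g"
  have "variation_on (\<lambda>x. ?v x - ?u x) x y \<le> variation_on ?v x y + variation_on ?u x y"
    by (intro variation_on_diff_le BV_left_maximal f g xy)
  moreover have "variation_on ?v x y \<le> 2 * pos_variation_on g x y - (?v y - ?v x)"
    by (rule variation_on_left_maximal[OF g xy])
  moreover have "pos_variation_on g x y \<le> variation_on f x y + d"
  proof -
    have "variation_on g x y \<le> variation_on f x y + variation_on (\<lambda>x. g x - f x) x y"
      using variation_on_linear_le[OF f(1) BV_diff[OF g(1) f(1)] xy, of 1 1 g] by simp
    then show ?thesis using pos_variation_on_bounds(3)[OF g(1) xy] d(2)[OF xy] by linarith
  qed
  moreover have "\<bar>?v x - ?u x\<bar> \<le> d" "\<bar>?v y - ?u y\<bar> \<le> d"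
    using left_maximal_diff[OF g(1) f(1) d(1)] by blast+
  moreover have "\<bar>?u y - ?u x\<bar> \<le> variation_on ?u x y"
    by (intro abs_diff_le_variation_on BV_left_maximal f xy)
  ultimately show ?thesis by linarith
qed

subsection \<open>Intervals on which the maximal function stays above the function\<close>

text \<open>As the left end tends to minus infinity, the averages tend to the limit of
  \<open>f\<close> there.\<close>

lemma Lim_at_bot_le_left_maximal:
  assumes f: "f \<in> BV"
  shows "Lim at_bot f \<le> left_maximal f x"
proof (rule ccontr)
  assume "\<not> ?thesis"
  then obtain m where m: "left_maximal f x < m" "m < Lim at_bot f" using dense[of "left_maximal f x"] by force
  define S where "S = BV_norm f"
  have "\<forall>\<^sub>F t in at_bot. m < f t" using order_tendstoD(1)[OF BV_tendsto_at_bot[OF f] m(2)] .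
  then obtain R0 where R0: "\<And>t. t \<le> R0 \<Longrightarrow> m < f t" by (auto simp: eventually_at_bot_linorder)
  define R where "R = min R0 x"
  \<comment> \<open>The first summand lets the gain \<open>(m - left_maximal f x) * T\<close> beat
    the error \<open>(\<bar>m\<bar> + S) * (x - R)\<close> from \<open>[R, x]\<close>; the rest puts
    \<open>a\<close> to the left of \<open>R\<close> and makes the inequality strict.\<close>
  define T where "T = (\<bar>m\<bar> + S) * (x - R) / (m - left_maximal f x) + (x - R) + 1"
  have mS: "0 \<le> (\<bar>m\<bar> + S) * (x - R)" by (simp add: S_def BV_norm_nonneg R_def)
  have pos: "0 < m - left_maximal f x" "0 \<le> x - R" using m(1) by (simp_all add: R_def)
  have T: "x - R < T"
    unfolding T_def using divide_nonneg_pos[OF mS pos(1)] by linarith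
  have T': "(\<bar>m\<bar> + S) * (x - R) < (m - left_maximal f x) * T"
  proof -
    have "(m - left_maximal f x) * T
      = (\<bar>m\<bar> + S) * (x - R) + (m - left_maximal f x) * ((x - R) + 1)"
      unfolding T_def add.assoc distrib_left[of _ "_ / _"] using pos by simp
    moreover have "0 < (m - left_maximal f x) * ((x - R) + 1)" using pos by (intro mult_pos_pos) auto
    ultimately show ?thesis by linarith
  qed
  define a where "a = x - T"
  have a: "a \<le> R" using T by (simp add: a_def)
  have fb: "- S \<le> f t" for t using abs_le_BV_norm[OF f, of t] unfolding S_def by linarith
  have "m * (R - a) \<le> integral {a..R} f"
  proof (rule BV_integral_ge[OF f a])
    fix t assume "t \<le> R" then show "m \<le> f t" using R0[of t] unfolding R_def by linarith
  qed
  moreover have "- S * (x - R) \<le> integral {R..x} f"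
    using fb by (intro BV_integral_ge f) (auto simp: R_def)
  moreover have "integral {a..x} f = integral {a..R} f + integral {R..x} f"
    using a by (intro BV_integral_combine f) (auto simp: R_def)
  moreover have "integral {a..x} f \<le> left_maximal f x * T"
    using left_maximal_ge[OF f, of a x] a by (simp add: a_def R_def)
  ultimately have "(m - left_maximal f x) * T \<le> m * (x - R) + S * (x - R)"
    by (simp add: a_def algebra_simps)
  also have "\<dots> \<le> (\<bar>m\<bar> + S) * (x - R)"
    unfolding distrib_right[symmetric] by (intro mult_right_mono) (auto simp: R_def)
  finally show False using T' by linarith
qed

text \<open>Averages with left end beyond \<open>p\<close> are at most \<open>c\<close>, and those
  with far left end are close to the limit at minus infinity. Both stay away from the supremum,
  which is therefore attained on a compact set of left ends.\<close>

lemma left_maximal_attained: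
  assumes f: "f \<in> BV" and p: "p < x" and L: "Lim at_bot f < left_maximal f x"
    and le: "\<And>t. p \<le> t \<Longrightarrow> t \<le> x \<Longrightarrow> f t \<le> c" and c: "c < left_maximal f x"
  shows "\<exists>a\<le>p. integral {a..x} f = left_maximal f x * (x - a)"
proof -
  define u where "u = left_maximal f x"
  define S where "S = BV_norm f"
  have fb: "f t \<le> S" for t using abs_le_BV_norm[OF f, of t] unfolding S_def by linarith
  obtain m where m: "Lim at_bot f < m" "m < u" using dense[of "Lim at_bot f" u] L by (force simp: u_def)
  have "\<forall>\<^sub>F t in at_bot. f t < m" using order_tendstoD(2)[OF BV_tendsto_at_bot[OF f] m(1)] .
  then obtain R0 where R0: "\<And>t. t \<le> R0 \<Longrightarrow> f t < m" by (auto simp: eventually_at_bot_linorder)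
  define R where "R = min R0 p"
  define \<eta> where "\<eta> = (u - m) / 2"
  have \<eta>: "0 < \<eta>" using m by (simp add: \<eta>_def)
  \<comment> \<open>Left of \<open>R'\<close> the contribution \<open>(S - m) * (x - R)\<close> of
    \<open>[R, x]\<close> is absorbed by \<open>\<eta> * (x - a)\<close>, so averages stay below the
    midpoint \<open>u - \<eta>\<close> of \<open>m\<close> and \<open>u\<close>.\<close>
  define R' where "R' = min R (x - (S - m) * (x - R) / \<eta>)"
  have far: "integral {a..x} f \<le> (u - \<eta>) * (x - a)" if a: "a \<le> R'" for a
  proof -
    have aR: "a \<le> R" "R \<le> x" using a p by (auto simp: R'_def R_def)
    have "integral {a..R} f \<le> m * (R - a)"
    proof (rule BV_integral_le[OF f aR(1)])
      fix t assume "t \<le> R" then show "f t \<le> m" using R0[of t] unfolding R_def by linarith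
    qed
    moreover have "integral {R..x} f \<le> S * (x - R)" using fb aR by (intro BV_integral_le f) auto
    moreover have "(S - m) * (x - R) \<le> \<eta> * (x - a)"
    proof -
      have "(S - m) * (x - R) / \<eta> \<le> x - a" using a unfolding R'_def by linarith
      then show ?thesis using \<eta> by (simp add: divide_le_eq mult.commute)
    qed
    moreover have "(u - \<eta>) * (x - a) = m * (x - a) + \<eta> * (x - a)" by (simp add: \<eta>_def field_simps)
    ultimately show ?thesis using BV_integral_combine[OF f aR] by (simp add: algebra_simps)
  qed
  have Rp: "R' \<le> p" by (auto simp: R'_def R_def)
  have "continuous_on {R'..p} (\<lambda>a. integral {a..x} f / (x - a))"
  proof (intro continuous_intros)
    show "continuous_on {R'..p} (\<lambda>a. integral {a..x} f)"
      using continuous_on_subset[OF indefinite_integral_continuous_1'[OF BV_integrable_on[OF f]], of "{R'..p}" R' x] p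
      by auto
  qed (use p in auto)
  from continuous_attains_sup[OF compact_Icc _ this] Rp
  obtain a where a: "R' \<le> a" "a \<le> p"
    and max: "\<And>b. R' \<le> b \<Longrightarrow> b \<le> p \<Longrightarrow> integral {b..x} f / (x - b) \<le> integral {a..x} f / (x - a)"
    by fastforce
  define v where "v = integral {a..x} f / (x - a)"
  have "u \<le> max v (max (u - \<eta>) c)"
    unfolding u_def
  proof (rule left_maximal_le)
    fix b assume b: "b < x"
    consider "b \<le> R'" | "R' \<le> b" "b \<le> p" | "p \<le> b" by linarith
    then have "\<exists>k\<in>{v, u - \<eta>, c}. integral {b..x} f \<le> k * (x - b)"
    proof cases
      case 1
      then show ?thesis using far[OF 1] by blast
    next
      case 2
      then show ?thesis using max[of b] b by (auto simp: v_def divide_le_eq)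
    next
      case 3
      then show ?thesis using BV_integral_le[OF f, of b x c] le b by force
    qed
    then obtain k where k: "k \<in> {v, u - \<eta>, c}" "integral {b..x} f \<le> k * (x - b)" by blast
    have "k \<le> max v (max (left_maximal f x - \<eta>) c)" using k(1) by (auto simp: u_def)
    then have "k * (x - b) \<le> max v (max (left_maximal f x - \<eta>) c) * (x - b)"
      using b by (intro mult_right_mono) auto
    with k(2) show "integral {b..x} f \<le> max v (max (left_maximal f x - \<eta>) c) * (x - b)" by linarith
  qed
  then have "u \<le> v" using c \<eta> by (auto simp: u_def)
  moreover have "v \<le> u" using left_maximal_ge[OF f, of a x] a p by (simp add: v_def u_def divide_le_eq)
  ultimately have "integral {a..x} f = u * (x - a)" using a p by (simp add: v_def field_simps)
  with a show ?thesis by (auto simp: u_def)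
qed

text \<open>
  Where \<open>u = left_maximal f\<close> exceeds \<open>f\<close>, its derivative is \<open>-\<kappa>(x) (u(x) - f(x))\<close> with
  \<open>\<kappa>(x) = 1 / (x - a(x))\<close> for a maximiser \<open>a(x)\<close> (and \<open>\<kappa>(x) = 0\<close> if the supremum is only reached
  as \<open>a\<close> tends to minus infinity). Maximisers move left as \<open>x\<close> moves right, so \<open>\<kappa>\<close> is
  monotone and this derivative has bounded variation; the lemma says so in terms of difference
  quotients.
\<close>

lemma left_maximal_slopes:
  fixes f :: "real \<Rightarrow> real"
  defines "u \<equiv> left_maximal f"
  assumes f: "f \<in> BV" and S: "\<And>x. \<bar>f x\<bar> \<le> S" "\<And>x y. x \<le> y \<Longrightarrow> variation_on f x y \<le> S"
    and h: "0 < h" and pt: "p + h \<le> t0"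
    and le: "\<And>t. p \<le> t \<Longrightarrow> t \<le> t0 \<Longrightarrow> f t \<le> c0"
    and ge: "\<And>x. p + h \<le> x \<Longrightarrow> x \<le> t0 \<Longrightarrow> c0 < u x"
  obtains \<Gamma> where "\<Gamma> t0 - \<Gamma> (p + h) \<le> 6 * S / h"
    and "\<And>x y. p + h \<le> x \<Longrightarrow> x \<le> y \<Longrightarrow> y \<le> t0 \<Longrightarrow> \<Gamma> x \<le> \<Gamma> y"
    and "\<And>s t. p + h \<le> s \<Longrightarrow> s \<le> t \<Longrightarrow> t \<le> t0 \<Longrightarrow>
      \<exists>c. \<forall>x y. s \<le> x \<longrightarrow> x \<le> y \<longrightarrow> y \<le> t \<longrightarrow> \<bar>u y - u x - c * (y - x)\<bar> \<le> (\<Gamma> t - \<Gamma> s) * (y - x)"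
proof -
  define L where "L = Lim at_bot f"
  define A where "A a b = integral {a..b} f" for a b
  have A_add: "A a c = A a b + A b c" if "a \<le> b" "b \<le> c" for a b c
    unfolding A_def using BV_integral_combine[OF f that] .
  have A_le: "A a x \<le> u x * (x - a)" if "a \<le> x" for a x
    unfolding A_def u_def using left_maximal_ge[OF f that] .
  have S0: "0 \<le> S" using S(1)[of 0] by linarith
  have uS: "\<bar>u x\<bar> \<le> S" for x unfolding u_def by (rule left_maximal_bounds[OF f S(1)])
  have L: "L \<le> u x" for x unfolding L_def u_def by (rule Lim_at_bot_le_left_maximal[OF f])
  have dec: "u y \<le> u x" if "p + h \<le> x" "x \<le> y" "y \<le> t0" for x y
    unfolding u_def
  proof (rule left_maximal_step[OF f that(2) order_refl])
    fix t assume "x < t" "t < y"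
    then show "f t \<le> left_maximal f x" using le[of t] ge[of x] that h unfolding u_def by linarith
  qed
  \<comment> \<open>The margin \<open>h\<close> between \<open>p\<close> and \<open>x\<close> makes
    maximising intervals at least \<open>h\<close> long, whence
    \<open>\<kappa> x \<le> 1 / h\<close>.\<close>
  define a where "a x = (SOME a. a \<le> p \<and> A a x = u x * (x - a))" for x
  have a: "a x \<le> p" "A (a x) x = u x * (x - a x)" if "p + h \<le> x" "x \<le> t0" "L < u x" for x
  proof -
    have "\<exists>a\<le>p. A a x = u x * (x - a)"
      unfolding A_def u_def
    proof (rule left_maximal_attained[OF f, of p x c0])
      show "f t \<le> c0" if "p \<le> t" "t \<le> x" for t using le[of t] that \<open>x \<le> t0\<close> by linarith
    qed (use that h ge[of x] in \<open>auto simp: L_def u_def\<close>)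
    from someI_ex[OF this] show "a x \<le> p" "A (a x) x = u x * (x - a x)" by (auto simp: a_def)
  qed
  \<comment> \<open>Exchange of left ends: \<open>A (a y) y - A (a x) y\<close> equals
    \<open>A (a y) x - A (a x) x\<close>. Optimality of \<open>a y\<close> bounds the first from
    below, optimality of \<open>a x\<close> the second from above, and together they give
    \<open>(u x - u y) * (a x - a y) \<ge> 0\<close>.\<close>
  have a_mono: "a y \<le> a x" if xy: "p + h \<le> x" "x < y" "y \<le> t0" "L < u y" for x y
  proof -
    have ux: "u y \<le> u x" using dec[of x y] xy by simp
    have ax: "a x \<le> p" "A (a x) x = u x * (x - a x)" using a[of x] xy ux by auto
    have ay: "a y \<le> p" "A (a y) y = u y * (y - a y)" using a[of y] xy by auto
    \<comment> \<open>Strictness is needed for the division: equal values would force average at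
      least \<open>u x\<close> over \<open>[x, y]\<close>, where \<open>f\<close> is at most
      \<open>c0 < u x\<close>.\<close>
    have "u y \<noteq> u x"
    proof
      assume eq: "u y = u x"
      have "A x y \<le> c0 * (y - x)"
        unfolding A_def using xy h by (intro BV_integral_le f le) auto
      moreover have "c0 * (y - x) < u x * (y - x)" using ge[of x] xy by (intro mult_strict_right_mono) auto
      moreover have "A (a y) y = A (a y) x + A x y" using ay xy h by (intro A_add) auto
      moreover have "A (a y) x \<le> u x * (x - a y)" using ay xy h by (intro A_le) auto
      ultimately show False using ay(2) eq by (simp add: algebra_simps)
    qed
    with ux have lt: "u y < u x" by simp
    have "A (a y) y = A (a y) x + A x y" "A (a x) y = A (a x) x + A x y"
      using ax ay xy h by (intro A_add; simp)+
    moreover have "A (a y) x \<le> u x * (x - a y)" "A (a x) y \<le> u y * (y - a x)"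
      using ax ay xy h by (intro A_le; simp)+
    ultimately have "(u x - u y) * a y \<le> (u x - u y) * a x" using ax(2) ay(2) by (simp add: algebra_simps)
    then show ?thesis using lt by simp
  qed
  define \<kappa> where "\<kappa> x = (if u x = L then 0 else 1 / (x - a x))" for x
  have \<kappa>: "0 \<le> \<kappa> x" "\<kappa> x \<le> 1 / h" if "p + h \<le> x" "x \<le> t0" for x
  proof -
    have "h \<le> x - a x" if "u x \<noteq> L"
      using a(1)[of x] that L[of x] \<open>p + h \<le> x\<close> \<open>x \<le> t0\<close> by linarith
    then show "0 \<le> \<kappa> x" "\<kappa> x \<le> 1 / h" using h by (auto simp: \<kappa>_def frac_le)
  qed
  have \<kappa>_mono: "\<kappa> y \<le> \<kappa> x" if xy: "p + h \<le> x" "x \<le> y" "y \<le> t0" for x y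
  proof (cases "u y = L \<or> x = y")
    case False
    then have *: "L < u y" "x < y" using L[of y] xy by auto
    then have "L < u x" using dec[OF xy] by simp
    then have "0 < x - a x" using a(1)[of x] xy h by linarith
    moreover have "x - a x \<le> y - a y" using a_mono[of x y] xy * by linarith
    ultimately show ?thesis using * \<open>L < u x\<close> by (auto simp: \<kappa>_def intro!: frac_le)
  qed (use \<kappa>[of x] xy in \<open>auto simp: \<kappa>_def\<close>)
  \<comment> \<open>The maximising interval of \<open>x\<close>, prolonged to \<open>y\<close>,
    competes for \<open>u y\<close>. Monotonicity then moves all coefficients to \<open>s\<close>,
    making the slope independent of \<open>x\<close> and \<open>y\<close>.\<close>
  have upper: "u x - u y \<le> \<kappa> s * (u s - m) * (y - x)"
    if I: "p + h \<le> s" "s \<le> x" "x \<le> y" "y \<le> t0" and m: "\<And>t. x \<le> t \<Longrightarrow> t \<le> y \<Longrightarrow> m \<le> f t" for s x y m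
  proof -
    have ms: "0 \<le> u s - m" using m[of x] le[of x] ge[of s] I h by auto
    have us: "u x \<le> u s" using dec I by auto
    have nn: "0 \<le> \<kappa> s * (u s - m)" using \<kappa>[of s] ms I by simp
    show ?thesis
    proof (cases "u x = L")
      case True
      have "0 \<le> \<kappa> s * (u s - m) * (y - x)" using nn I by simp
      then show ?thesis using True L[of y] by linarith
    next
      case False
      then have ax: "a x \<le> p" "A (a x) x = u x * (x - a x)" using a[of x] I L[of x] by auto
      have pos: "0 < x - a x" using ax I h by linarith
      have "A (a x) y = A (a x) x + A x y" "A (a x) y \<le> u y * (y - a x)"
        using A_add[of "a x" x y] A_le[of "a x" y] pos I by auto
      moreover have "m * (y - x) \<le> A x y" unfolding A_def using I m by (intro BV_integral_ge f) auto
      ultimately have "(u x - u y) * (y - a x) \<le> (u x - m) * (y - x)" using ax(2) by (simp add: algebra_simps)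
      moreover have "(u x - u y) * (x - a x) \<le> (u x - u y) * (y - a x)"
        using dec[of x y] I by (intro mult_left_mono) auto
      moreover have "(u x - m) * (y - x) \<le> (u s - m) * (y - x)" using us I by (intro mult_right_mono) auto
      ultimately have "(u x - u y) * (x - a x) \<le> (u s - m) * (y - x)" by linarith
      then have "u x - u y \<le> (u s - m) * (y - x) / (x - a x)" using pos by (simp add: le_divide_eq)
      also have "\<dots> = \<kappa> x * ((u s - m) * (y - x))" using False by (simp add: \<kappa>_def)
      also have "\<dots> \<le> \<kappa> s * ((u s - m) * (y - x))"
        using \<kappa>_mono[of s x] I ms by (intro mult_right_mono) auto
      finally show ?thesis by (simp add: mult.assoc)
    qed
  qed
  \<comment> \<open>Conversely the maximising interval of \<open>y\<close>, shortened to
    \<open>x\<close>, competes for \<open>u x\<close>, and the coefficients move to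
    \<open>t\<close>.\<close>
  have lower: "\<kappa> t * (u t - m) * (y - x) \<le> u x - u y"
    if I: "p + h \<le> x" "x \<le> y" "y \<le> t" "t \<le> t0" and m: "\<And>t. x \<le> t \<Longrightarrow> t \<le> y \<Longrightarrow> f t \<le> m" for t x y m
  proof (cases "u t = L \<or> u t - m \<le> 0")
    case True
    have "\<kappa> t * (u t - m) * (y - x) \<le> 0"
    proof (cases "u t = L")
      case False
      then show ?thesis using True \<kappa>[of t] I by (intro mult_nonpos_nonneg mult_nonneg_nonpos) auto
    qed (simp add: \<kappa>_def)
    then show ?thesis using dec[of x y] I by linarith
  next
    case False
    then have mt: "0 \<le> u t - m" by simp
    have ut: "u t \<le> u y" using dec I by auto
    then have uy: "u y \<noteq> L" using False L[of t] by auto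
    then have ay: "a y \<le> p" "A (a y) y = u y * (y - a y)" using a[of y] I L[of y] by auto
    have pos: "0 < y - a y" using ay I h by linarith
    have "A (a y) y = A (a y) x + A x y" "A (a y) x \<le> u x * (x - a y)"
      using A_add[of "a y" x y] A_le[of "a y" x] ay(1) I h by auto
    moreover have "A x y \<le> m * (y - x)" unfolding A_def using I m by (intro BV_integral_le f) auto
    ultimately have "(u y - m) * (y - x) \<le> (u x - u y) * (x - a y)" using ay(2) by (simp add: algebra_simps)
    moreover have "(u x - u y) * (x - a y) \<le> (u x - u y) * (y - a y)"
      using dec[of x y] I by (intro mult_left_mono) auto
    moreover have "(u t - m) * (y - x) \<le> (u y - m) * (y - x)" using ut I by (intro mult_right_mono) auto
    ultimately have "(u t - m) * (y - x) \<le> (u x - u y) * (y - a y)" by linarith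
    then have le: "(u t - m) * (y - x) / (y - a y) \<le> u x - u y" using pos by (simp add: divide_le_eq)
    have "\<kappa> t * ((u t - m) * (y - x)) \<le> \<kappa> y * ((u t - m) * (y - x))"
      using \<kappa>_mono[of y t] I mt by (intro mult_right_mono) auto
    also have "\<dots> = (u t - m) * (y - x) / (y - a y)" using uy by (simp add: \<kappa>_def)
    finally show ?thesis using le by (simp add: mult.assoc)
  qed
  \<comment> \<open>Product rule for the variation of \<open>\<kappa>\<close> times
    \<open>u - f\<close>: the factor \<open>1 / h\<close> bounds \<open>\<kappa>\<close>,
    \<open>2 * S\<close> bounds the difference. The variation of \<open>f\<close> counts twice
    because both slope bounds below allow for it. Each of the three terms contributes
    \<open>2 * S / h\<close>.\<close>
  define \<Gamma> where "\<Gamma> x = 2 / h * variation_on f (p + h) x - u x / h - 2 * S * \<kappa> x" for x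
  have \<Gamma>_diff: "\<Gamma> t - \<Gamma> s = 2 / h * variation_on f s t + (u s - u t) / h + 2 * S * (\<kappa> s - \<kappa> t)"
    if "p + h \<le> s" "s \<le> t" for s t
    using variation_on_add[OF f that] by (simp add: \<Gamma>_def algebra_simps diff_divide_distrib add_divide_distrib)
  show ?thesis
  proof (rule that[of \<Gamma>])
    have "variation_on f (p + h) t0 \<le> S" "u (p + h) - u t0 \<le> 2 * S" "\<kappa> (p + h) - \<kappa> t0 \<le> 1 / h"
      using S(2)[OF pt] uS[of "p + h"] uS[of t0] \<kappa>[of "p + h"] \<kappa>[of t0] pt by linarith+
    then have "2 / h * variation_on f (p + h) t0 \<le> 2 / h * S" "(u (p + h) - u t0) / h \<le> 2 * S / h"
      "2 * S * (\<kappa> (p + h) - \<kappa> t0) \<le> 2 * S * (1 / h)"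
      using h S0 mult_left_mono[of "\<kappa> (p + h) - \<kappa> t0" "1 / h" "2 * S"]
      by (auto intro!: mult_left_mono divide_right_mono)
    moreover have "6 * S / h = 2 / h * S + 2 * S / h + 2 * S * (1 / h)" by (simp add: field_simps)
    ultimately show "\<Gamma> t0 - \<Gamma> (p + h) \<le> 6 * S / h" unfolding \<Gamma>_diff[OF order_refl pt] by linarith
  next
    fix x y assume xy: "p + h \<le> x" "x \<le> y" "y \<le> t0"
    have "0 \<le> 2 / h * variation_on f x y" "0 \<le> (u x - u y) / h" "0 \<le> 2 * S * (\<kappa> x - \<kappa> y)"
      using variation_on_nonneg[OF f xy(2)] dec[OF xy] \<kappa>_mono[OF xy] h S0 by auto
    then show "\<Gamma> x \<le> \<Gamma> y" using \<Gamma>_diff[OF xy(1,2)] by linarith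
  next
    fix s t assume st: "p + h \<le> s" "s \<le> t" "t \<le> t0"
    define V where "V = variation_on f s t"
    have V: "f s - V \<le> f z" "f z \<le> f s + V" if "s \<le> z" "z \<le> t" for z
      using abs_diff_le_variation_on[OF f that(1)] variation_on_mono[OF f order_refl that] unfolding V_def
      by linarith+
    \<comment> \<open>Bounds for minus the slope of \<open>u\<close> on \<open>[s, t]\<close>; the
      witness for \<open>c\<close> is \<open>- lo\<close>.\<close>
    define lo hi where "lo = \<kappa> t * (u t - (f s + V))" and "hi = \<kappa> s * (u s - (f s - V))"
    have "hi - lo = \<kappa> s * (u s - u t) + (\<kappa> s - \<kappa> t) * (u t - f s) + (\<kappa> s + \<kappa> t) * V"
      by (simp add: hi_def lo_def algebra_simps)
    also have "\<dots> \<le> 1 / h * (u s - u t) + (\<kappa> s - \<kappa> t) * (2 * S) + (1 / h + 1 / h) * V"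
    proof (intro add_mono mult_right_mono mult_left_mono)
      show "u t - f s \<le> 2 * S" using uS[of t] S(1)[of s] by linarith
    qed (use \<kappa>[of s] \<kappa>[of t] \<kappa>_mono[OF st] dec[OF st] st variation_on_nonneg[OF f st(2)] in \<open>auto simp: V_def\<close>)
    also have "\<dots> = \<Gamma> t - \<Gamma> s" unfolding \<Gamma>_diff[OF st(1,2)] V_def by (simp add: algebra_simps diff_divide_distrib)
    finally have hilo: "hi - lo \<le> \<Gamma> t - \<Gamma> s" .
    have "\<bar>u y - u x - (- lo) * (y - x)\<bar> \<le> (\<Gamma> t - \<Gamma> s) * (y - x)" if xy: "s \<le> x" "x \<le> y" "y \<le> t" for x y
    proof -
      have "u x - u y \<le> hi * (y - x)" unfolding hi_def
        using xy st V by (intro upper) auto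
      moreover have "lo * (y - x) \<le> u x - u y" unfolding lo_def
        using xy st V by (intro lower) auto
      moreover have "(hi - lo) * (y - x) \<le> (\<Gamma> t - \<Gamma> s) * (y - x)" using hilo xy by (intro mult_right_mono) auto
      ultimately show ?thesis by (simp add: algebra_simps abs_le_iff)
    qed
    then show "\<exists>c. \<forall>x y. s \<le> x \<longrightarrow> x \<le> y \<longrightarrow> y \<le> t \<longrightarrow> \<bar>u y - u x - c * (y - x)\<bar> \<le> (\<Gamma> t - \<Gamma> s) * (y - x)"
      by blast
  qed
qed

text \<open>
  A function whose derivative has bounded variation has small variation once it is uniformly small:
  cut the interval into \<open>N\<close> pieces and use that the derivative is nearly constant on each.
\<close>

lemma variation_on_le_slopes:
  assumes w: "w \<in> BV" and st: "s0 \<le> t0" and N: "0 < N" and W: "\<And>x. \<bar>w x\<bar> \<le> W"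
    and mono: "\<And>x y. s0 \<le> x \<Longrightarrow> x \<le> y \<Longrightarrow> y \<le> t0 \<Longrightarrow> \<Gamma> x \<le> \<Gamma> y"
    and slopes: "\<And>s t. s0 \<le> s \<Longrightarrow> s \<le> t \<Longrightarrow> t \<le> t0 \<Longrightarrow>
      \<exists>c. \<forall>x y. s \<le> x \<longrightarrow> x \<le> y \<longrightarrow> y \<le> t \<longrightarrow> \<bar>w y - w x - c * (y - x)\<bar> \<le> (\<Gamma> t - \<Gamma> s) * (y - x)"
  shows "variation_on w s0 t0 \<le> 2 * real N * W + 2 * ((t0 - s0) / real N) * (\<Gamma> t0 - \<Gamma> s0)"
proof -
  have piece: "variation_on w s t \<le> 2 * W + 2 * (t - s) * (\<Gamma> t - \<Gamma> s)"
    if I: "s0 \<le> s" "s \<le> t" "t \<le> t0" for s t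
  proof -
    obtain c where c: "\<And>x y. s \<le> x \<Longrightarrow> x \<le> y \<Longrightarrow> y \<le> t \<Longrightarrow> \<bar>w y - w x - c * (y - x)\<bar> \<le> (\<Gamma> t - \<Gamma> s) * (y - x)"
      using slopes[OF I] by blast
    have "variation_on w s t \<le> \<bar>c\<bar> * (t - s) + (\<Gamma> t - \<Gamma> s) * (t - s)"
    proof (rule variation_on_le[OF I(2), where G = "\<lambda>x y. \<bar>c\<bar> * (y - x) + (\<Gamma> t - \<Gamma> s) * (y - x)"])
      fix x y assume xy: "s \<le> x" "x \<le> y" "y \<le> t"
      have "\<bar>c * (y - x)\<bar> = \<bar>c\<bar> * (y - x)" using xy by (simp add: abs_mult)
      then show "\<bar>w y - w x\<bar> \<le> \<bar>c\<bar> * (y - x) + (\<Gamma> t - \<Gamma> s) * (y - x)" using c[OF xy] by linarith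
    qed (simp add: algebra_simps)
    \<comment> \<open>The slope \<open>c\<close> cannot be large, since following it across the
      piece must reproduce an increment of \<open>w\<close> of size at most
      \<open>2 * W\<close>.\<close>
    moreover have "\<bar>c\<bar> * (t - s) \<le> 2 * W + (\<Gamma> t - \<Gamma> s) * (t - s)"
    proof -
      have "\<bar>c * (t - s)\<bar> = \<bar>c\<bar> * (t - s)" using I by (simp add: abs_mult)
      then show ?thesis using c[of s t] I W[of s] W[of t] by linarith
    qed
    ultimately show ?thesis by (simp add: algebra_simps)
  qed
  define l where "l = (t0 - s0) / real N"
  have l: "0 \<le> l" "s0 + real N * l = t0" using st N by (auto simp: l_def)
  have "variation_on w s0 (s0 + real k * l) \<le> 2 * real k * W + 2 * l * (\<Gamma> (s0 + real k * l) - \<Gamma> s0)"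
    if "k \<le> N" for k
    using that
  proof (induction k)
    case (Suc k)
    define x y where "x = s0 + real k * l" and "y = s0 + real (Suc k) * l"
    have "real (Suc k) * l \<le> real N * l" using Suc.prems l by (intro mult_right_mono) auto
    then have xy: "s0 \<le> x" "x \<le> y" "y \<le> t0" "y - x = l" using l by (auto simp: x_def y_def algebra_simps)
    have "variation_on w s0 x \<le> 2 * real k * W + 2 * l * (\<Gamma> x - \<Gamma> s0)"
      using Suc by (simp add: x_def)
    moreover have "variation_on w x y \<le> 2 * W + 2 * l * (\<Gamma> y - \<Gamma> x)"
      using piece[OF xy(1-3)] xy(4) by simp
    ultimately have "variation_on w s0 y \<le> 2 * real (Suc k) * W + 2 * l * (\<Gamma> y - \<Gamma> s0)"
      using variation_on_add[OF w xy(1,2)] by (simp add: algebra_simps)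
    then show ?case by (simp add: y_def)
  qed (use w in simp)
  from this[OF order_refl] show ?thesis using l by (simp add: l_def)
qed

section \<open>Convergence of the maximal functions away from contact with the function\<close>

locale left_maximal_convergence =
  fixes F :: "nat \<Rightarrow> real \<Rightarrow> real" and f :: "real \<Rightarrow> real"
  assumes F: "BV_LIMSEQ F f"
    and f_cont: "\<forall>x. (f \<longlongrightarrow> f x) (at_left x)"
    and F_cont: "\<forall>x. (F n \<longlongrightarrow> F n x) (at_left x)"
begin

abbreviation "u \<equiv> left_maximal f"
definition "w n x = left_maximal (F n) x - u x"
abbreviation "d n \<equiv> BV_dist (F n) f"

lemma f: "f \<in> BV" and Fn: "F n \<in> BV"
  using BV_LIMSEQ_D(1,2)[OF F] by auto

lemma u_BV: "u \<in> BV" and v_BV: "left_maximal (F n) \<in> BV"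
  by (intro BV_left_maximal f Fn f_cont F_cont)+

lemma w_BV: "w n \<in> BV"
  unfolding w_def by (intro BV_diff u_BV v_BV)

lemma eventually_d: "0 < e \<Longrightarrow> \<forall>\<^sub>F n in sequentially. d n < e"
  using order_tendstoD(2)[OF BV_LIMSEQ_D(6)[OF F]] .

lemma w_le: "\<bar>w n x\<bar> \<le> d n"
  unfolding w_def by (rule left_maximal_diff[OF Fn f]) (rule BV_LIMSEQ_D(3)[OF F])

text \<open>The slope lemma applies to \<open>f\<close> and to \<open>F n\<close> with the same
  \<open>S\<close> and \<open>h\<close>, so the variation of the slopes of \<open>w n\<close> is
  bounded independently of \<open>n\<close>, while \<open>w n\<close> tends to zero
  uniformly.\<close>

lemma w_vanishes_above:
  assumes h: "0 < h" and pt: "p + h \<le> t0"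
    and le: "\<And>t. p \<le> t \<Longrightarrow> t \<le> t0 \<Longrightarrow> f t \<le> c0"
    and ge: "\<And>x. p + h \<le> x \<Longrightarrow> x \<le> t0 \<Longrightarrow> c1 \<le> u x" and c: "c0 < c1" and e: "0 < e"
  shows "\<forall>\<^sub>F n in sequentially. variation_on (w n) (p + h) t0 \<le> e"
proof -
  define S where "S = BV_norm f + 1"
  define l where "l = t0 - (p + h)"
  have S: "0 < S" by (simp add: S_def BV_norm_nonneg add_nonneg_pos)
  have l: "0 \<le> l" using pt by (simp add: l_def)
  define C where "C = 6 * S / h + 6 * S / h"
  have C: "0 < C" using S h by (simp add: C_def)
  \<comment> \<open>The number of pieces depends on \<open>e\<close> and \<open>C\<close> only;
    afterwards \<open>n\<close> is taken so large that \<open>2 * real N * d n\<close> is small as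
    well.\<close>
  obtain N :: nat where N: "4 * l * C / e + 1 \<le> real N" using real_arch_simple by blast
  have "0 \<le> 4 * l * C / e" using l C e by simp
  with N have N0: "0 < N" by (cases "N = 0") auto
  have NC: "2 * (l / real N) * C \<le> e / 2"
    using N N0 e by (simp add: field_simps)
  have fS: "\<bar>f x\<bar> \<le> S" for x using abs_le_BV_norm[OF f, of x] by (simp add: S_def)
  have fV: "variation_on f x y \<le> S" if "x \<le> y" for x y
    using variation_on_le_BV_norm[OF f that] by (simp add: S_def)
  have gt: "c0 < u x" if "p + h \<le> x" "x \<le> t0" for x using ge[OF that] c by simp
  obtain \<Gamma> where \<Gamma>: "\<Gamma> t0 - \<Gamma> (p + h) \<le> 6 * S / h"
    "\<And>x y. p + h \<le> x \<Longrightarrow> x \<le> y \<Longrightarrow> y \<le> t0 \<Longrightarrow> \<Gamma> x \<le> \<Gamma> y"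
    "\<And>s t. p + h \<le> s \<Longrightarrow> s \<le> t \<Longrightarrow> t \<le> t0 \<Longrightarrow>
      \<exists>c. \<forall>x y. s \<le> x \<longrightarrow> x \<le> y \<longrightarrow> y \<le> t \<longrightarrow> \<bar>u y - u x - c * (y - x)\<bar> \<le> (\<Gamma> t - \<Gamma> s) * (y - x)"
    by (rule left_maximal_slopes[OF f fS fV h pt le gt]) auto
  \<comment> \<open>Perturbing by less than a quarter of the gap leaves \<open>F n\<close> at most
    \<open>c0 + \<eta>\<close> and its maximal function above
    \<open>c0 + 3 * \<eta>\<close>.\<close>
  define \<eta> where "\<eta> = (c1 - c0) / 4"
  have \<eta>: "0 < \<eta>" using c by (simp add: \<eta>_def)
  have "\<forall>\<^sub>F n in sequentially. d n < min (min \<eta> 1) (e / (4 * real N))"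
    using \<eta> e N0 by (intro eventually_d) simp
  then show ?thesis
  proof eventually_elim
    case (elim n)
    let ?v = "left_maximal (F n)"
    have d: "d n < \<eta>" "d n < 1" "d n < e / (4 * real N)" using elim by auto
    have v: "\<bar>?v x - u x\<bar> \<le> d n" "\<bar>F n x - f x\<bar> \<le> d n" for x
      using w_le[of n x] BV_LIMSEQ_D(3)[OF F, of n x] by (auto simp: w_def)
    have FS: "\<bar>F n x\<bar> \<le> S" for x
      using v(2)[of x] d(2) abs_le_BV_norm[OF f, of x] unfolding S_def by linarith
    have FV: "variation_on (F n) x y \<le> S" if xy: "x \<le> y" for x y
    proof -
      have "variation_on (F n) x y \<le> variation_on f x y + variation_on (\<lambda>x. F n x - f x) x y"
        using variation_on_linear_le[OF f BV_diff[OF Fn f] xy, of 1 1 "F n"] by simp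
      then show ?thesis
        using BV_LIMSEQ_D(4)[OF F xy, of n] variation_on_le_BV_norm[OF f xy] d(2) unfolding S_def by linarith
    qed
    have le': "F n t \<le> c0 + \<eta>" if "p \<le> t" "t \<le> t0" for t using le[OF that] v(2)[of t] d(1) by linarith
    have gt': "c0 + \<eta> < ?v x" if "p + h \<le> x" "x \<le> t0" for x
    proof -
      have "c1 = c0 + 4 * \<eta>" by (simp add: \<eta>_def field_simps)
      then show ?thesis using ge[OF that] v(1)[of x] d(1) \<eta> by linarith
    qed
    obtain \<Gamma>' where \<Gamma>': "\<Gamma>' t0 - \<Gamma>' (p + h) \<le> 6 * S / h"
      "\<And>x y. p + h \<le> x \<Longrightarrow> x \<le> y \<Longrightarrow> y \<le> t0 \<Longrightarrow> \<Gamma>' x \<le> \<Gamma>' y"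
      "\<And>s t. p + h \<le> s \<Longrightarrow> s \<le> t \<Longrightarrow> t \<le> t0 \<Longrightarrow>
        \<exists>c. \<forall>x y. s \<le> x \<longrightarrow> x \<le> y \<longrightarrow> y \<le> t \<longrightarrow> \<bar>?v y - ?v x - c * (y - x)\<bar> \<le> (\<Gamma>' t - \<Gamma>' s) * (y - x)"
      by (rule left_maximal_slopes[OF Fn FS FV h pt le' gt']) auto
    have "variation_on (w n) (p + h) t0
      \<le> 2 * real N * d n + 2 * ((t0 - (p + h)) / real N) * ((\<Gamma> t0 + \<Gamma>' t0) - (\<Gamma> (p + h) + \<Gamma>' (p + h)))"
    proof (rule variation_on_le_slopes[OF w_BV pt N0 w_le, where \<Gamma> = "\<lambda>x. \<Gamma> x + \<Gamma>' x"])
      fix x y assume "p + h \<le> x" "x \<le> y" "y \<le> t0"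
      then show "\<Gamma> x + \<Gamma>' x \<le> \<Gamma> y + \<Gamma>' y" using \<Gamma>(2) \<Gamma>'(2) by (intro add_mono)
    next
      fix s t assume st: "p + h \<le> s" "s \<le> t" "t \<le> t0"
      obtain c where c: "\<And>x y. s \<le> x \<Longrightarrow> x \<le> y \<Longrightarrow> y \<le> t \<Longrightarrow> \<bar>u y - u x - c * (y - x)\<bar> \<le> (\<Gamma> t - \<Gamma> s) * (y - x)"
        using \<Gamma>(3)[OF st] by blast
      obtain c' where c': "\<And>x y. s \<le> x \<Longrightarrow> x \<le> y \<Longrightarrow> y \<le> t \<Longrightarrow> \<bar>?v y - ?v x - c' * (y - x)\<bar> \<le> (\<Gamma>' t - \<Gamma>' s) * (y - x)"
        using \<Gamma>'(3)[OF st] by blast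
      have "\<bar>w n y - w n x - (c' - c) * (y - x)\<bar> \<le> (\<Gamma> t + \<Gamma>' t - (\<Gamma> s + \<Gamma>' s)) * (y - x)"
        if xy: "s \<le> x" "x \<le> y" "y \<le> t" for x y
      proof -
        have "w n y - w n x - (c' - c) * (y - x) = (?v y - ?v x - c' * (y - x)) - (u y - u x - c * (y - x))"
          by (simp add: w_def algebra_simps)
        moreover have "(\<Gamma> t + \<Gamma>' t - (\<Gamma> s + \<Gamma>' s)) * (y - x) = (\<Gamma> t - \<Gamma> s) * (y - x) + (\<Gamma>' t - \<Gamma>' s) * (y - x)"
          by (simp add: algebra_simps)
        ultimately show ?thesis using c[OF xy] c'[OF xy] by linarith
      qed
      then show "\<exists>c. \<forall>x y. s \<le> x \<longrightarrow> x \<le> y \<longrightarrow> y \<le> t \<longrightarrow>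
        \<bar>w n y - w n x - c * (y - x)\<bar> \<le> (\<Gamma> t + \<Gamma>' t - (\<Gamma> s + \<Gamma>' s)) * (y - x)" by blast
    qed
    also have "\<dots> \<le> e / 2 + 2 * (l / real N) * C"
    proof (intro add_mono)
      show "2 * real N * d n \<le> e / 2" using d(3) N0 by (simp add: field_simps)
      show "2 * ((t0 - (p + h)) / real N) * ((\<Gamma> t0 + \<Gamma>' t0) - (\<Gamma> (p + h) + \<Gamma>' (p + h))) \<le> 2 * (l / real N) * C"
        unfolding l_def[symmetric] C_def using \<Gamma>(1) \<Gamma>'(1) l by (intro mult_left_mono) auto
    qed
    finally show ?case using NC by linarith
  qed
qed

end

text \<open>Separates a possible jump at \<open>z\<close>, which costs at most \<open>2 * W\<close>,
  from the variation to the right of it. In \<open>G\<close>, subtracting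
  \<open>variation_on g q y\<close> for intervals starting at \<open>z\<close> makes the bound
  superadditive.\<close>

lemma variation_on_le_jump_left:
  assumes g: "g \<in> BV" and W: "\<And>x. \<bar>g x\<bar> \<le> W" and zy: "z \<le> y"
    and C: "0 \<le> C" "\<And>x. z < x \<Longrightarrow> x \<le> y \<Longrightarrow> variation_on g x y \<le> C"
  shows "variation_on g z y \<le> 2 * W + C"
proof -
  define G where "G p q = (if p = z then if q = z then 0 else 2 * W + C - variation_on g q y
    else variation_on g p q)" for p q
  have "variation_on g z y \<le> G z y"
  proof (rule variation_on_le[OF zy])
    fix p q assume pq: "z \<le> p" "p \<le> q" "q \<le> y"
    show "\<bar>g q - g p\<bar> \<le> G p q"
    proof (cases "p = z \<and> q \<noteq> z")
      case True
      then show ?thesis using C(2)[of q] W[of p] W[of q] pq by (simp add: G_def)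
    qed (use abs_diff_le_variation_on[OF g pq(2)] in \<open>auto simp: G_def\<close>)
  next
    fix p q r assume pqr: "z \<le> p" "p \<le> q" "q \<le> r" "r \<le> y"
    then show "G p q + G q r \<le> G p r"
      using variation_on_add[OF g, of p q r] variation_on_add[OF g, of q r y] by (auto simp: G_def)
  qed
  also have "\<dots> \<le> 2 * W + C" using g C(1) W[of z] by (auto simp: G_def)
  finally show ?thesis .
qed

lemma variation_on_le_jump_right:
  assumes g: "g \<in> BV" and W: "\<And>x. \<bar>g x\<bar> \<le> W" and yz: "y \<le> z"
    and C: "0 \<le> C" "\<And>x. y \<le> x \<Longrightarrow> x < z \<Longrightarrow> variation_on g y x \<le> C"
  shows "variation_on g y z \<le> 2 * W + C"
proof -
  define G where "G p q = (if q = z then if p = z then 0 else 2 * W + C - variation_on g y p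
    else variation_on g p q)" for p q
  have "variation_on g y z \<le> G y z"
  proof (rule variation_on_le[OF yz])
    fix p q assume pq: "y \<le> p" "p \<le> q" "q \<le> z"
    show "\<bar>g q - g p\<bar> \<le> G p q"
    proof (cases "q = z \<and> p \<noteq> z")
      case True
      then show ?thesis using C(2)[of p] W[of p] W[of q] pq by (simp add: G_def)
    qed (use abs_diff_le_variation_on[OF g pq(2)] in \<open>auto simp: G_def\<close>)
  next
    fix p q r assume pqr: "y \<le> p" "p \<le> q" "q \<le> r" "r \<le> z"
    then show "G p q + G q r \<le> G p r"
      using variation_on_add[OF g, of p q r] variation_on_add[OF g, of y p q] by (auto simp: G_def)
  qed
  also have "\<dots> \<le> 2 * W + C" using g C(1) W[of z] by (auto simp: G_def)
  finally show ?thesis .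
qed

subsection \<open>The asymptotic defect\<close>

context left_maximal_convergence
begin

text \<open>The upper limit over \<open>n\<close>, written as infimum of the eventual bounds to stay
  within the reals; \<open>0 \<le> e\<close> bounds the set below.\<close>

definition E :: "real \<Rightarrow> real \<Rightarrow> real" where
  "E s t = Inf {e. 0 \<le> e \<and> (\<forall>\<^sub>F n in sequentially. variation_on (w n) s t \<le> e)}"

abbreviation "N \<equiv> neg_variation_on f"

lemma w_variation_le:
  assumes "x \<le> y"
  shows "variation_on (w n) x y \<le> 2 * variation_on f x y + 2 * variation_on u x y + 4 * d n"
proof -
  have w: "w n = (\<lambda>x. left_maximal (F n) x - u x)" by (auto simp: w_def)
  show ?thesis
    unfolding w by (rule left_maximal_diff_variation_le[OF f f_cont Fn F_cont])
      (use assms BV_LIMSEQ_D[OF F] in auto)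
qed

lemma E_le_eps:
  assumes c: "0 \<le> c" and ev: "\<And>e. 0 < e \<Longrightarrow> \<forall>\<^sub>F n in sequentially. variation_on (w n) s t \<le> c + e"
  shows "E s t \<le> c"
proof (rule field_le_epsilon)
  fix e :: real assume e: "0 < e"
  show "E s t \<le> c + e"
    unfolding E_def by (rule cInf_lower) (use c e ev in \<open>auto intro: bdd_belowI[of _ 0]\<close>)
qed

lemma E_less_imp_eventually:
  assumes "s \<le> t" "E s t < e"
  shows "\<forall>\<^sub>F n in sequentially. variation_on (w n) s t \<le> e"
proof -
  let ?A = "{e. 0 \<le> e \<and> (\<forall>\<^sub>F n in sequentially. variation_on (w n) s t \<le> e)}"
  \<comment> \<open>The crude bound with \<open>d n < 1\<close> shows that the infimum is over a
    nonempty set.\<close>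
  let ?c = "2 * variation_on f s t + 2 * variation_on u s t + 4"
  have "\<forall>\<^sub>F n in sequentially. d n < 1" by (rule eventually_d) simp
  then have "\<forall>\<^sub>F n in sequentially. variation_on (w n) s t \<le> ?c"
  proof eventually_elim
    case (elim n)
    then show ?case using w_variation_le[OF assms(1), of n] by linarith
  qed
  then have "?c \<in> ?A" using variation_on_nonneg[OF f assms(1)] variation_on_nonneg[OF u_BV assms(1)] by simp
  then have "?A \<noteq> {}" by blast
  moreover have "bdd_below ?A" by (auto intro: bdd_belowI[of _ 0])
  ultimately obtain e' where "e' \<in> ?A" "e' < e"
    using assms(2) unfolding E_def by (meson cInf_less_iff)
  then show ?thesis by (auto elim!: eventually_mono)
qed

lemma E_nonneg:
  assumes "s \<le> t" shows "0 \<le> E s t"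
proof (rule ccontr)
  assume "\<not> 0 \<le> E s t"
  then have "\<forall>\<^sub>F n in sequentially. variation_on (w n) s t \<le> E s t / 2"
    using E_less_imp_eventually[OF assms, of "E s t / 2"] by (simp only: not_le)
  then obtain n where "variation_on (w n) s t \<le> E s t / 2" by (auto dest: eventually_happens)
  then show False using variation_on_nonneg[OF w_BV assms, of n] \<open>\<not> 0 \<le> E s t\<close> by linarith
qed

lemma E_same [simp]: "E x x = 0"
  using E_nonneg[of x x] E_le_eps[of 0 x x] w_BV by force

lemma E_subadditive:
  assumes "x \<le> y" "y \<le> z" shows "E x z \<le> E x y + E y z"
proof (rule E_le_eps)
  fix e :: real assume e: "0 < e"
  have "\<forall>\<^sub>F n in sequentially. variation_on (w n) x y \<le> E x y + e / 2"
    "\<forall>\<^sub>F n in sequentially. variation_on (w n) y z \<le> E y z + e / 2"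
    using e assms by (intro E_less_imp_eventually; simp)+
  then show "\<forall>\<^sub>F n in sequentially. variation_on (w n) x z \<le> E x y + E y z + e"
  proof eventually_elim
    case (elim n)
    then show ?case using variation_on_add[OF w_BV assms, of n] by linarith
  qed
qed (use assms E_nonneg in force)

lemma E_vanishes_above:
  assumes "0 < h" "p + h \<le> t0" "\<And>t. p \<le> t \<Longrightarrow> t \<le> t0 \<Longrightarrow> f t \<le> c0"
    and "\<And>x. p + h \<le> x \<Longrightarrow> x \<le> t0 \<Longrightarrow> c1 \<le> u x" "c0 < c1"
  shows "E (p + h) t0 = 0"
proof (rule antisym)
  show "E (p + h) t0 \<le> 0"
    by (rule E_le_eps) (use w_vanishes_above[OF assms] in auto)
qed (rule E_nonneg[OF assms(2)])

text \<open>To the right of \<open>z\<close>, the crude bound is small because \<open>f\<close> and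
  \<open>u\<close> vary little there. Even if \<open>f\<close> jumps at \<open>z\<close>, the jump
  of \<open>w n\<close> is at most \<open>2 * d n\<close>.\<close>

lemma E_small_right:
  assumes e: "0 < e"
  obtains r where "0 < r" "\<And>y. z \<le> y \<Longrightarrow> y < z + r \<Longrightarrow> E z y \<le> e"
proof -
  have e16: "0 < e / 16" using e by simp
  obtain r1 where r1: "0 < r1" "\<And>x y. z < x \<Longrightarrow> x \<le> y \<Longrightarrow> y < z + r1 \<Longrightarrow> variation_on f x y \<le> e / 16"
    using variation_on_small_right[OF f e16] by blast
  obtain r2 where r2: "0 < r2" "\<And>x y. z < x \<Longrightarrow> x \<le> y \<Longrightarrow> y < z + r2 \<Longrightarrow> variation_on u x y \<le> e / 16"
    using variation_on_small_right[OF u_BV e16] by blast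
  have "E z y \<le> e" if y: "z \<le> y" "y < z + min r1 r2" for y
  proof (rule E_le_eps)
    fix e' :: real assume e': "0 < e'"
    have "\<forall>\<^sub>F n in sequentially. d n < e / 16" using e by (intro eventually_d) simp
    then show "\<forall>\<^sub>F n in sequentially. variation_on (w n) z y \<le> e + e'"
    proof eventually_elim
      case (elim n)
      have dn: "0 \<le> d n" by (rule BV_LIMSEQ_D(5)[OF F])
      have "variation_on (w n) z y \<le> 2 * d n + (e / 4 + 4 * d n)"
      proof (rule variation_on_le_jump_left[OF w_BV w_le y(1)])
        fix x assume x: "z < x" "x \<le> y"
        have "variation_on f x y \<le> e / 16" "variation_on u x y \<le> e / 16"
          using r1(2)[of x y] r2(2)[of x y] x y by auto
        then show "variation_on (w n) x y \<le> e / 4 + 4 * d n"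
          using w_variation_le[OF x(2), of n] by linarith
      qed (use e dn in simp)
      then show ?case using elim e e' by linarith
    qed
  qed (use e in simp)
  then show ?thesis using that[of "min r1 r2"] r1 r2 by simp
qed

lemma E_small_left:
  assumes e: "0 < e"
  obtains r where "0 < r" "\<And>y. z - r < y \<Longrightarrow> y \<le> z \<Longrightarrow> E y z \<le> e"
proof -
  have e16: "0 < e / 16" using e by simp
  obtain r1 where r1: "0 < r1" "\<And>x y. z - r1 < x \<Longrightarrow> x \<le> y \<Longrightarrow> y < z \<Longrightarrow> variation_on f x y \<le> e / 16"
    using variation_on_small_left[OF f e16] by blast
  obtain r2 where r2: "0 < r2" "\<And>x y. z - r2 < x \<Longrightarrow> x \<le> y \<Longrightarrow> y < z \<Longrightarrow> variation_on u x y \<le> e / 16"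
    using variation_on_small_left[OF u_BV e16] by blast
  have "E y z \<le> e" if y: "z - min r1 r2 < y" "y \<le> z" for y
  proof (rule E_le_eps)
    fix e' :: real assume e': "0 < e'"
    have "\<forall>\<^sub>F n in sequentially. d n < e / 16" using e by (intro eventually_d) simp
    then show "\<forall>\<^sub>F n in sequentially. variation_on (w n) y z \<le> e + e'"
    proof eventually_elim
      case (elim n)
      have dn: "0 \<le> d n" by (rule BV_LIMSEQ_D(5)[OF F])
      have "variation_on (w n) y z \<le> 2 * d n + (e / 4 + 4 * d n)"
      proof (rule variation_on_le_jump_right[OF w_BV w_le y(2)])
        fix x assume x: "y \<le> x" "x < z"
        have "variation_on f y x \<le> e / 16" "variation_on u y x \<le> e / 16"
          using r1(2)[of y x] r2(2)[of y x] x y by auto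
        then show "variation_on (w n) y x \<le> e / 4 + 4 * d n"
          using w_variation_le[OF x(1), of n] by linarith
      qed (use e dn in simp)
      then show ?case using elim e e' by linarith
    qed
  qed (use e in simp)
  then show ?thesis using that[of "min r1 r2"] r1 r2 by simp
qed

text \<open>Write \<open>w n\<close> as
  \<open>(left_maximal (F n) - F n) - (u - f) + (F n - f)\<close>. The first two differences each
  cost \<open>2 * N\<close> plus the gap at \<open>s\<close>, up to multiples of \<open>d n\<close>;
  the last costs \<open>d n\<close>.\<close>

lemma E_le_neg_variation_plus:
  assumes st: "s \<le> t"
  shows "E s t \<le> 4 * N s t + 2 * (u s - f s)"
proof (rule E_le_eps)
  show "0 \<le> 4 * N s t + 2 * (u s - f s)"
    using neg_variation_on_bounds(1)[OF f st] le_left_maximal[OF f f_cont, of s] by simp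
  fix e :: real assume e: "0 < e"
  have "\<forall>\<^sub>F n in sequentially. d n < e / 8" using e by (intro eventually_d) simp
  then show "\<forall>\<^sub>F n in sequentially. variation_on (w n) s t \<le> 4 * N s t + 2 * (u s - f s) + e"
  proof eventually_elim
    case (elim n)
    let ?v = "left_maximal (F n)"
    have wF: "(\<lambda>x. F n x - f x) \<in> BV" by (intro BV_diff f Fn)
    have a: "(\<lambda>x. ?v x - F n x) \<in> BV" "(\<lambda>x. u x - f x) \<in> BV" by (intro BV_diff u_BV v_BV f Fn)+
    let ?G = "\<lambda>x y. variation_on (\<lambda>x. ?v x - F n x) x y + variation_on (\<lambda>x. u x - f x) x y
      + variation_on (\<lambda>x. F n x - f x) x y"
    have "variation_on (w n) s t \<le> ?G s t"
    proof (rule variation_on_le[OF st])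
      fix x y :: real assume xy: "x \<le> y"
      show "\<bar>w n y - w n x\<bar> \<le> ?G x y"
        using abs_diff_le_variation_on[OF a(1) xy] abs_diff_le_variation_on[OF a(2) xy]
          abs_diff_le_variation_on[OF wF xy] unfolding w_def by linarith
    next
      fix x y z :: real assume "x \<le> y" "y \<le> z"
      then show "?G x y + ?G y z \<le> ?G x z"
        using variation_on_add[OF a(1), of x y z] variation_on_add[OF a(2), of x y z]
          variation_on_add[OF wF, of x y z] by linarith
    qed
    moreover have "variation_on (\<lambda>x. ?v x - F n x) s t \<le> 2 * neg_variation_on (F n) s t + (?v s - F n s)"
      by (rule variation_on_left_maximal_diff_self[OF Fn F_cont st])
    moreover have "variation_on (\<lambda>x. u x - f x) s t \<le> 2 * N s t + (u s - f s)"
      by (rule variation_on_left_maximal_diff_self[OF f f_cont st])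
    moreover have "variation_on (\<lambda>x. F n x - f x) s t \<le> d n" by (rule BV_LIMSEQ_D(4)[OF F st])
    moreover have "neg_variation_on (F n) s t \<le> N s t + d n"
    proof -
      have "variation_on (F n) s t \<le> variation_on f s t + variation_on (\<lambda>x. F n x - f x) s t"
        using variation_on_linear_le[OF f wF st, of 1 1 "F n"] by simp
      moreover have "\<bar>(F n t - f t) - (F n s - f s)\<bar> \<le> variation_on (\<lambda>x. F n x - f x) s t"
        by (rule abs_diff_le_variation_on[OF wF st])
      ultimately have "variation_on (F n) s t - (F n t - F n s) \<le> variation_on f s t - (f t - f s) + 2 * d n"
        using BV_LIMSEQ_D(4)[OF F st, of n] by linarith
      then show ?thesis unfolding neg_variation_on_def by (simp add: field_simps)
    qed
    moreover have "?v s - F n s \<le> u s - f s + 2 * d n"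
      using w_le[of n s] BV_LIMSEQ_D(3)[OF F, of n s] unfolding w_def by linarith
    ultimately show ?case using elim e unfolding right_diff_distrib distrib_left by linarith
  qed
qed

text \<open>If \<open>f\<close> stayed below \<open>u \<tau>\<close> by \<open>e\<close> on both
  sides of \<open>\<tau>\<close>, the defect would vanish a little beyond \<open>\<tau>\<close>, so
  \<open>\<tau>\<close> would not be the last zero.\<close>

lemma tight_if_E_maximal:
  assumes E0: "E s \<tau> = 0" and st: "s \<le> \<tau>" "\<tau> < t"
    and max: "\<And>x. \<tau> < x \<Longrightarrow> x \<le> t \<Longrightarrow> E s x \<noteq> 0" and r: "0 < r" and e: "0 < e"
  shows "\<exists>x. \<tau> - r < x \<and> x < \<tau> + r \<and> u \<tau> - e < f x"
proof (rule ccontr)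
  assume H: "\<not> ?thesis"
  obtain r' where r': "0 < r'" "\<And>y. \<bar>y - \<tau>\<bar> < r' \<Longrightarrow> u \<tau> - e / 2 \<le> u y"
    using left_maximal_lower_near[OF f, of "e / 2"] e by (metis half_gt_zero)
  define \<rho> where "\<rho> = min (min r r') (t - \<tau>) / 2"
  have \<rho>: "0 < \<rho>" "\<rho> < r" "\<rho> < r'" "\<tau> + \<rho> \<le> t"
    using r r'(1) st by (auto simp: \<rho>_def min_def field_simps)
  \<comment> \<open>The stretch of length \<open>\<rho>\<close> left of \<open>\<tau>\<close> is the
    margin for the maximising intervals; by lower semicontinuity \<open>u\<close> keeps half of the
    gap.\<close>
  have "E (\<tau> - \<rho> + \<rho>) (\<tau> + \<rho>) = 0"
  proof (rule E_vanishes_above)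
    fix x assume "\<tau> - \<rho> \<le> x" "x \<le> \<tau> + \<rho>"
    then have "\<tau> - r < x" "x < \<tau> + r" using \<rho> by linarith+
    then show "f x \<le> u \<tau> - e" using H by (meson not_less)
  next
    fix x assume "\<tau> - \<rho> + \<rho> \<le> x" "x \<le> \<tau> + \<rho>"
    then show "u \<tau> - e / 2 \<le> u x" using \<rho> by (intro r') auto
  qed (use \<rho> e in auto)
  then have "E s (\<tau> + \<rho>) \<le> 0" using E_subadditive[of s \<tau> "\<tau> + \<rho>"] E0 st \<rho> by simp
  then have "E s (\<tau> + \<rho>) = 0" using E_nonneg[of s "\<tau> + \<rho>"] st \<rho> by simp
  then show False using max[of "\<tau> + \<rho>"] \<rho> by simp
qed

text \<open>Up to the last zero \<open>\<tau>\<close> of \<open>E s\<close> nothing is paid. Near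
  \<open>\<tau>\<close> the function nearly touches \<open>u\<close>, so the gap terms in
  \<open>E_le_neg_variation_plus\<close> can be exchanged for negative variation.\<close>

lemma E_le_neg_variation:
  assumes st: "s \<le> t"
  shows "E s t \<le> 6 * N s t"
proof -
  define T where "T = {x. s \<le> x \<and> x \<le> t \<and> E s x = 0}"
  define \<tau> where "\<tau> = Sup T"
  have sT: "s \<in> T" using st by (simp add: T_def)
  have bdd: "bdd_above T" by (auto simp: T_def)
  have s\<tau>: "s \<le> \<tau>" unfolding \<tau>_def by (rule cSup_upper[OF sT bdd])
  have \<tau>t: "\<tau> \<le> t" unfolding \<tau>_def using sT by (intro cSup_least) (auto simp: T_def)
  have "E s \<tau> \<le> 0"
  proof (rule field_le_epsilon)
    fix e :: real assume "0 < e"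
    then obtain r where r: "0 < r" "\<And>y. \<tau> - r < y \<Longrightarrow> y \<le> \<tau> \<Longrightarrow> E y \<tau> \<le> e" using E_small_left by blast
    obtain x where x: "x \<in> T" "\<tau> - r < x"
      using less_cSup_iff[OF _ bdd, of "\<tau> - r"] sT r(1) unfolding \<tau>_def[symmetric] by auto
    have "x \<le> \<tau>" unfolding \<tau>_def by (rule cSup_upper[OF x(1) bdd])
    then show "E s \<tau> \<le> 0 + e" using E_subadditive[of s x \<tau>] r(2)[of x] x by (auto simp: T_def)
  qed
  then have E\<tau>: "E s \<tau> = 0" using E_nonneg[OF s\<tau>] by simp
  show ?thesis
  proof (cases "\<tau> = t")
    case True
    then show ?thesis using E\<tau> neg_variation_on_bounds(1)[OF f st] by simp
  next
    case False
    with \<tau>t have lt: "\<tau> < t" by simp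
    have max: "E s x \<noteq> 0" if "\<tau> < x" "x \<le> t" for x
      using that cSup_upper[OF _ bdd, of x] s\<tau> unfolding \<tau>_def[symmetric] by (force simp: T_def)
    show ?thesis
    proof (rule field_le_epsilon)
      fix e' :: real assume e': "0 < e'"
      define e where "e = e' / 8"
      have e: "0 < e" using e' by (simp add: e_def)
      obtain r1 where r1: "0 < r1" "\<And>x. \<tau> - r1 < x \<Longrightarrow> x \<le> \<tau> \<Longrightarrow> \<bar>f x - f \<tau>\<bar> \<le> e"
        using left_continuousD[OF f_cont e] by blast
      obtain r2 where r2: "0 < r2" "\<And>x y. \<tau> < x \<Longrightarrow> x \<le> y \<Longrightarrow> y < \<tau> + r2 \<Longrightarrow> variation_on f x y \<le> e"
        using variation_on_small_right[OF f e] by blast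
      obtain r3 where r3: "0 < r3" "\<And>y. \<tau> \<le> y \<Longrightarrow> y < \<tau> + r3 \<Longrightarrow> E \<tau> y \<le> e" using E_small_right[OF e] by blast
      define r where "r = min (min r1 r2) (min r3 (t - \<tau>))"
      have r: "0 < r" "r \<le> r1" "r \<le> r2" "r \<le> r3" "r \<le> t - \<tau>" using r1 r2 r3 lt by (auto simp: r_def)
      obtain x where x: "\<tau> - r < x" "x < \<tau> + r" "u \<tau> - e < f x"
        using tight_if_E_maximal[OF E\<tau> s\<tau> lt max r(1) e] by blast
      \<comment> \<open>The new starting point lies beyond \<open>\<tau>\<close>, because the
        near-contact point \<open>x\<close> may be on the right of a jump at \<open>\<tau>\<close>;
        reaching \<open>y\<close> costs at most \<open>e\<close>, as \<open>E\<close> has no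
        atom.\<close>
      define y where "y = \<tau> + r / 2"
      have y: "\<tau> < y" "y < \<tau> + r" "y \<le> t" using r by (auto simp: y_def)
      have osc: "\<bar>f q - f p\<bar> \<le> e" if "\<tau> < p" "p < \<tau> + r" "\<tau> < q" "q < \<tau> + r" for p q
      proof -
        have "\<bar>f q - f p\<bar> \<le> e" if "\<tau> < p" "p \<le> q" "q < \<tau> + r" for p q
          using r2(2)[of p q] abs_diff_le_variation_on[OF f that(2)] that r by linarith
        from this[of p q] this[of q p] show ?thesis using that by linarith
      qed
      have N\<tau>y: "f \<tau> - f y \<le> N \<tau> y" "0 \<le> N \<tau> y"
        using neg_variation_on_bounds[OF f, of \<tau> y] y by auto
      \<comment> \<open>If \<open>x\<close> is on the left, \<open>f x\<close> is close to
        \<open>f \<tau>\<close> and \<open>N \<tau> y\<close> pays for the decrease to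
        \<open>y\<close>; if on the right, \<open>f x\<close> is close to
        \<open>f y\<close>.\<close>
      have "u \<tau> \<le> f y + N \<tau> y + 2 * e"
      proof (cases "x \<le> \<tau>")
        case True
        then show ?thesis using r1(2)[of x] x N\<tau>y r by linarith
      next
        case False
        then show ?thesis using osc[of x y] x y N\<tau>y by linarith
      qed
      then have "u y \<le> f y + N \<tau> y + 2 * e"
      proof (rule left_maximal_step[OF f less_imp_le[OF y(1)]])
        fix q assume "\<tau> < q" "q < y"
        then show "f q \<le> f y + N \<tau> y + 2 * e" using osc[of q y] y N\<tau>y e by linarith
      qed
      moreover have "E y t \<le> 4 * N y t + 2 * (u y - f y)" using y by (intro E_le_neg_variation_plus)
      moreover have "E s t \<le> E s \<tau> + (E \<tau> y + E y t)"
        using E_subadditive[of s \<tau> t] E_subadditive[of \<tau> y t] s\<tau> lt y by linarith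
      moreover have "E \<tau> y \<le> e" using r3(2)[of y] y r by linarith
      moreover have "N s t = N s \<tau> + (N \<tau> y + N y t)"
        using neg_variation_on_add[OF f, of s \<tau> t] neg_variation_on_add[OF f, of \<tau> y t] s\<tau> lt y by linarith
      moreover have "0 \<le> N s \<tau>" "0 \<le> N y t"
        using neg_variation_on_bounds(1)[OF f] s\<tau> y by auto
      ultimately show "E s t \<le> 6 * N s t + e'" using E\<tau> N\<tau>y e'
        unfolding e_def right_diff_distrib distrib_left by linarith
    qed
  qed
qed

text \<open>If \<open>f\<close> exceeded \<open>f z\<close> on all of \<open>[x, z)\<close>, then by
  left continuity it would do so by a fixed amount on a short interval, and the average over
  \<open>[x, z]\<close> would be larger than \<open>u z\<close>.\<close>

lemma smaller_value_on_left:
  assumes "x < z" "u z \<le> f z"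
  shows "\<exists>y. x \<le> y \<and> y < z \<and> f y \<le> f z"
proof (rule ccontr)
  assume H: "\<not> ?thesis"
  then have gt: "f z < f y" if "x \<le> y" "y < z" for y using that by force
  then have ge: "f z \<le> f y" if "x \<le> y" "y \<le> z" for y using that by (cases "y = z") (auto simp: less_imp_le)
  define m where "m = (x + z) / 2"
  have m: "x < m" "m < z" using assms(1) by (auto simp: m_def)
  define \<delta> where "\<delta> = (f m - f z) / 2"
  have \<delta>: "0 < \<delta>" using gt[of m] m by (simp add: \<delta>_def)
  obtain r where r: "0 < r" "\<And>t. m - r < t \<Longrightarrow> t \<le> m \<Longrightarrow> \<bar>f t - f m\<bar> \<le> \<delta>"
    using left_continuousD[OF f_cont \<delta>] by blast
  define \<rho> where "\<rho> = min r (m - x) / 2"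
  have \<rho>: "0 < \<rho>" "\<rho> < r" "x \<le> m - \<rho>" using r(1) m by (auto simp: \<rho>_def min_def field_simps)
  have "f z * (m - \<rho> - x) \<le> integral {x..m - \<rho>} f"
    using \<rho> m by (intro BV_integral_ge f ge) auto
  moreover have "(f z + \<delta>) * (m - (m - \<rho>)) \<le> integral {m - \<rho>..m} f"
  proof (rule BV_integral_ge[OF f])
    fix t assume "m - \<rho> \<le> t" "t \<le> m"
    then have "\<bar>f t - f m\<bar> \<le> \<delta>" using \<rho> by (intro r) auto
    moreover have "f m = f z + 2 * \<delta>" by (simp add: \<delta>_def field_simps)
    ultimately show "f z + \<delta> \<le> f t" by linarith
  qed (use \<rho> in simp)
  moreover have "f z * (z - m) \<le> integral {m..z} f"
    using m by (intro BV_integral_ge f ge) auto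
  moreover have "integral {x..z} f = integral {x..m - \<rho>} f + (integral {m - \<rho>..m} f + integral {m..z} f)"
    using BV_integral_combine[OF f, of x "m - \<rho>" z] BV_integral_combine[OF f, of "m - \<rho>" m z] \<rho> m by simp
  moreover have "integral {x..z} f \<le> u z * (z - x)" using assms(1) by (intro left_maximal_ge f) simp
  moreover have "u z * (z - x) \<le> f z * (z - x)" using assms by (intro mult_right_mono) auto
  ultimately have "\<delta> * \<rho> \<le> 0" by (simp add: algebra_simps)
  then show False using \<delta> \<rho> by (simp add: mult_le_0_iff)
qed

text \<open>Continuous induction from \<open>y\<close> to the left, \<open>z\<close> being the
  infimum of the points reached. If \<open>u\<close> touches \<open>f\<close> at \<open>z\<close>,
  some smaller value of \<open>f\<close> lies on the left and any nonnegative bound does. If there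
  is a gap, \<open>E\<close> vanishes just left of \<open>z\<close> and \<open>N\<close> alone
  bounds the decrement.\<close>

lemma decrease_le_defect:
  assumes xy: "x \<le> y"
  shows "6 * (f x - f y) \<le> 6 * N x y - E x y"
proof -
  define P where "P x y = 6 * N x y - E x y" for x y
  have P_add: "P p q + P q r \<le> P p r" if "p \<le> q" "q \<le> r" for p q r
    using neg_variation_on_add[OF f that] E_subadditive[OF that] by (simp add: P_def)
  define S where "S = {z. x \<le> z \<and> z \<le> y \<and> 6 * (f z - f y) \<le> P z y}"
  define z where "z = Inf S"
  have yS: "y \<in> S" using xy f by (simp add: S_def P_def neg_variation_on_def)
  have bdd: "bdd_below S" by (auto simp: S_def)
  have z: "x \<le> z" "z \<le> y"
    unfolding z_def using yS bdd by (auto intro!: cInf_greatest cInf_lower simp: S_def)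
  \<comment> \<open>The infimum is reached although \<open>f\<close> may jump at \<open>z\<close>:
    \<open>N z q\<close> pays for the whole decrement, and \<open>E z q\<close> is small for
    \<open>q\<close> close to \<open>z\<close>.\<close>
  have zS: "6 * (f z - f y) \<le> P z y"
  proof (rule field_le_epsilon)
    fix e :: real assume "0 < e"
    then obtain r where r: "0 < r" "\<And>y. z \<le> y \<Longrightarrow> y < z + r \<Longrightarrow> E z y \<le> e" using E_small_right by blast
    obtain q where q: "q \<in> S" "q < z + r"
      using cInf_less_iff[OF _ bdd, of "z + r"] yS r(1) unfolding z_def[symmetric] by auto
    have zq: "z \<le> q" unfolding z_def by (rule cInf_lower[OF q(1) bdd])
    have "6 * (f z - f q) \<le> P z q + e"
      using neg_variation_on_bounds(2)[OF f zq] r(2)[OF zq q(2)] by (simp add: P_def)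
    moreover have "6 * (f q - f y) \<le> P q y" and "q \<le> y" using q by (auto simp: S_def)
    ultimately show "6 * (f z - f y) \<le> P z y + e" using P_add[OF zq \<open>q \<le> y\<close>]
      unfolding right_diff_distrib by linarith
  qed
  have "z = x"
  proof (rule ccontr)
    assume "z \<noteq> x"
    with z have xz: "x < z" by simp
    have "\<exists>q. x \<le> q \<and> q < z \<and> 6 * (f q - f z) \<le> P q z"
    proof (cases "u z \<le> f z")
      case True
      then obtain q where q: "x \<le> q" "q < z" "f q \<le> f z" using smaller_value_on_left[OF xz] by blast
      moreover have "0 \<le> P q z" using E_le_neg_variation[of q z] q by (simp add: P_def)
      ultimately show ?thesis by (intro exI[of _ q]) auto
    next
      case False
      \<comment> \<open>A quarter of the gap: nearby \<open>f\<close> is at most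
        \<open>f z + e\<close> and \<open>u\<close> at least \<open>f z + 3 * e\<close>.\<close>
      define e where "e = (u z - f z) / 4"
      have e: "0 < e" using False by (simp add: e_def)
      obtain r1 where r1: "0 < r1" "\<And>t. z - r1 < t \<Longrightarrow> t \<le> z \<Longrightarrow> \<bar>f t - f z\<bar> \<le> e"
        using left_continuousD[OF f_cont e] by blast
      obtain r2 where r2: "0 < r2" "\<And>t. \<bar>t - z\<bar> < r2 \<Longrightarrow> u z - e \<le> u t"
        using left_maximal_lower_near[OF f e] by blast
      define \<rho> where "\<rho> = min (min r1 r2) (z - x) / 4"
      have \<rho>: "0 < \<rho>" "2 * \<rho> < r1" "\<rho> < r2" "x \<le> z - \<rho>" using r1(1) r2(1) xz by (auto simp: \<rho>_def min_def field_simps)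
      have "E (z - 2 * \<rho> + \<rho>) z = 0"
      proof (rule E_vanishes_above)
        fix t assume "z - 2 * \<rho> \<le> t" "t \<le> z"
        then show "f t \<le> f z + e" using r1(2)[of t] \<rho> by linarith
      next
        fix t assume "z - 2 * \<rho> + \<rho> \<le> t" "t \<le> z"
        then show "u z - e \<le> u t" using \<rho> by (intro r2) linarith
      next
        have "u z = f z + 4 * e" by (simp add: e_def field_simps)
        then show "f z + e < u z - e" using e by linarith
      qed (use \<rho> in auto)
      then have "E (z - \<rho>) z = 0" by simp
      then show ?thesis using neg_variation_on_bounds(2)[OF f, of "z - \<rho>" z] \<rho>
        by (intro exI[of _ "z - \<rho>"]) (auto simp: P_def)
    qed
    then obtain q where q: "x \<le> q" "q < z" "6 * (f q - f z) \<le> P q z" by blast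
    then have "q \<in> S" using zS P_add[of q z y] z by (auto simp: S_def)
    then show False using cInf_lower[OF _ bdd, of q] q unfolding z_def by simp
  qed
  with zS show ?thesis by (simp add: P_def)
qed

text \<open>Twice the bound for decrements plus the signed increment bounds the absolute increment.
  Summing gives at most \<open>2 * N - E / 3\<close> plus the increment of \<open>f\<close>, which
  is the variation of \<open>f\<close> minus \<open>E / 3\<close>.\<close>

lemma E_eq_0:
  assumes st: "s \<le> t"
  shows "E s t = 0"
proof -
  have "variation_on f s t \<le> (6 * N s t - E s t) / 3 + (f t - f s)"
  proof (rule variation_on_le[OF st, where G = "\<lambda>x y. (6 * N x y - E x y) / 3 + (f y - f x)"])
    fix x y :: real assume xy: "x \<le> y"
    show "\<bar>f y - f x\<bar> \<le> (6 * N x y - E x y) / 3 + (f y - f x)"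
      using decrease_le_defect[OF xy] E_le_neg_variation[OF xy] by (auto simp: abs_if field_simps)
  next
    fix x y z :: real assume "x \<le> y" "y \<le> z"
    then show "(6 * N x y - E x y) / 3 + (f y - f x) + ((6 * N y z - E y z) / 3 + (f z - f y))
      \<le> (6 * N x z - E x z) / 3 + (f z - f x)"
      using neg_variation_on_add[OF f, of x y z] E_subadditive[of x y z] by (simp add: field_simps)
  qed
  then have "E s t \<le> 0" by (simp add: neg_variation_on_def field_simps)
  with E_nonneg[OF st] show ?thesis by simp
qed

lemma BV_LIMSEQ_left_maximal_left_continuous: "BV_LIMSEQ (\<lambda>n. left_maximal (F n)) u"
proof (rule BV_LIMSEQ_I[OF v_BV u_BV])
  fix e :: real assume e: "0 < e"
  have "\<forall>\<^sub>F n in sequentially. d n < e" by (rule eventually_d[OF e])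
  then show "\<forall>\<^sub>F n in sequentially. \<forall>x. \<bar>left_maximal (F n) x - u x\<bar> \<le> e"
  proof eventually_elim
    case (elim n)
    show ?case
    proof
      fix x show "\<bar>left_maximal (F n) x - u x\<bar> \<le> e" using w_le[of n x] elim unfolding w_def by linarith
    qed
  qed
  \<comment> \<open>\<open>E_eq_0\<close> settles compact intervals only. On each tail the crude
    bound gives \<open>4 * e / 16 + 4 * e / 32\<close>, that is \<open>3 * e / 8\<close>, which
    leaves \<open>e / 4\<close> for the middle.\<close>
  have e16: "0 < e / 16" using e by simp
  obtain X1 where X1: "\<And>x y. x \<le> y \<Longrightarrow> y \<le> - X1 \<or> X1 \<le> x \<Longrightarrow> variation_on f x y \<le> e / 16"
    using variation_on_small_tails[OF f e16] by blast
  obtain X2 where X2: "\<And>x y. x \<le> y \<Longrightarrow> y \<le> - X2 \<or> X2 \<le> x \<Longrightarrow> variation_on u x y \<le> e / 16"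
    using variation_on_small_tails[OF u_BV e16] by blast
  define X where "X = max 0 (max X1 X2)"
  have X: "0 \<le> X" "X1 \<le> X" "X2 \<le> X" by (auto simp: X_def)
  have "\<forall>\<^sub>F n in sequentially. variation_on (w n) (- X) X \<le> e / 4"
    using X e by (intro E_less_imp_eventually) (auto simp: E_eq_0)
  moreover have "\<forall>\<^sub>F n in sequentially. d n < e / 32" using e by (intro eventually_d) simp
  ultimately show "\<forall>\<^sub>F n in sequentially. \<forall>x y. x \<le> y \<longrightarrow>
    variation_on (\<lambda>x. left_maximal (F n) x - u x) x y \<le> e"
  proof eventually_elim
    case (elim n)
    have w: "w n = (\<lambda>x. left_maximal (F n) x - u x)" by (auto simp: w_def)
    have tail: "variation_on (w n) x y \<le> 3 * e / 8" if "x \<le> y" "y \<le> - X \<or> X \<le> x" for x y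
    proof -
      have "variation_on f x y \<le> e / 16" "variation_on u x y \<le> e / 16"
        using that X by (intro X1 X2; auto)+
      then show ?thesis using w_variation_le[OF that(1), of n] elim(2) by linarith
    qed
    have "variation_on (w n) x y \<le> e" if "x \<le> y" for x y
    proof -
      define a b where "a = min x (- X)" and "b = max y X"
      have ab: "a \<le> x" "y \<le> b" "a \<le> - X" "- X \<le> X" "X \<le> b" using X by (auto simp: a_def b_def)
      have "variation_on (w n) x y \<le> variation_on (w n) a b"
        using ab that by (intro variation_on_mono w_BV) auto
      also have "\<dots> = variation_on (w n) a (- X) + (variation_on (w n) (- X) X + variation_on (w n) X b)"
        using variation_on_add[OF w_BV, of a "- X" b n] variation_on_add[OF w_BV, of "- X" X b n] ab by simp
      also have "\<dots> \<le> 3 * e / 8 + (e / 4 + 3 * e / 8)"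
        using elim(1) ab by (intro add_mono tail) auto
      also have "\<dots> = e" by simp
      finally show ?thesis .
    qed
    then show ?case unfolding w by blast
  qed
qed

end

subsection \<open>The uncentered maximal operator\<close>

lemma BV_LIMSEQ_left_maximal:
  assumes F: "BV_LIMSEQ F f"
  shows "BV_LIMSEQ (\<lambda>n. left_maximal (F n)) (left_maximal f)"
proof -
  note bv = BV_LIMSEQ_D(1,2)[OF F]
  interpret left_maximal_convergence "\<lambda>n. left_lim (F n)" "left_lim f"
    using BV_LIMSEQ_left_lim[OF F] left_lim_left_continuous bv by unfold_locales auto
  have "left_maximal (left_lim g) = left_maximal g" if "g \<in> BV" for g
    by (auto simp: left_maximal_def integral_left_lim[OF that])
  then have "left_maximal (left_lim f) = left_maximal f"
    "(\<lambda>n. left_maximal (left_lim (F n))) = (\<lambda>n. left_maximal (F n))"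
    using bv by auto
  then show ?thesis using BV_LIMSEQ_left_maximal_left_continuous by simp
qed

section \<open>Reflection, and the reduction to one-sided averages\<close>

lemma variation_on_reflect_le:
  assumes g: "g \<in> BV" and xy: "x \<le> y"
  shows "variation_on (\<lambda>x. g (- x)) x y \<le> variation_on g (- y) (- x)"
proof (rule variation_on_le[OF xy, where G = "\<lambda>x y. variation_on g (- y) (- x)"])
  fix p q :: real assume "p \<le> q"
  then show "\<bar>g (- q) - g (- p)\<bar> \<le> variation_on g (- q) (- p)"
    using abs_diff_le_variation_on[OF g, of "- q" "- p"] by (simp add: abs_minus_commute)
next
  fix p q r :: real assume "p \<le> q" "q \<le> r"
  then show "variation_on g (- q) (- p) + variation_on g (- r) (- q) \<le> variation_on g (- r) (- p)"
    using variation_on_add[OF g, of "- r" "- q" "- p"] by simp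
qed

lemma BV_reflect:
  assumes g: "g \<in> BV" shows "(\<lambda>x. g (- x)) \<in> BV"
proof (rule BV_superadditiveI[where G = "\<lambda>x y. variation_on g (- y) (- x)"])
  fix p q :: real assume pq: "p \<le> q"
  then show "\<bar>g (- q) - g (- p)\<bar> \<le> variation_on g (- q) (- p)"
    using abs_diff_le_variation_on[OF g, of "- q" "- p"] by (simp add: abs_minus_commute)
  show "variation_on g (- q) (- p) \<le> enn2real (total_variation g)"
    using pq by (intro variation_on_le_total g) simp
next
  fix p q r :: real assume "p \<le> q" "q \<le> r"
  then show "variation_on g (- q) (- p) + variation_on g (- r) (- q) \<le> variation_on g (- r) (- p)"
    using variation_on_add[OF g, of "- r" "- q" "- p"] by simp
qed

lemma BV_LIMSEQ_reflect:
  assumes F: "BV_LIMSEQ F f"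
  shows "BV_LIMSEQ (\<lambda>n x. F n (- x)) (\<lambda>x. f (- x))"
proof (rule BV_LIMSEQ_I)
  note f = BV_LIMSEQ_D(2)[OF F] and Fn = BV_LIMSEQ_D(1)[OF F]
  show "(\<lambda>x. F n (- x)) \<in> BV" "(\<lambda>x. f (- x)) \<in> BV" for n by (intro BV_reflect f Fn)+
  fix e :: real assume e: "0 < e"
  have ev: "\<forall>\<^sub>F n in sequentially. BV_dist (F n) f \<le> e"
    using order_tendstoD(2)[OF BV_LIMSEQ_D(6)[OF F] e] by eventually_elim simp
  then show "\<forall>\<^sub>F n in sequentially. \<forall>x. \<bar>F n (- x) - f (- x)\<bar> \<le> e"
    by eventually_elim (use BV_LIMSEQ_D(3)[OF F] order_trans in blast)
  from ev show "\<forall>\<^sub>F n in sequentially. \<forall>x y. x \<le> y \<longrightarrow> variation_on (\<lambda>x. F n (- x) - f (- x)) x y \<le> e"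
  proof eventually_elim
    case (elim n)
    have "variation_on (\<lambda>x. F n (- x) - f (- x)) x y \<le> e" if "x \<le> y" for x y
      using variation_on_reflect_le[OF BV_diff[OF Fn f] that, of n] BV_LIMSEQ_D(4)[OF F, of "- y" "- x" n]
        that elim by simp
    then show ?case by blast
  qed
qed

text \<open>Up to its two endpoints a bounded interval is open. This passes from arbitrary intervals
  and the Lebesgue integral to closed intervals and the gauge integral.\<close>

lemma interval_average:
  fixes I :: "real set"
  assumes g: "g \<in> BV" and I: "is_interval I" "bounded I" "measure lborel I > 0" "x \<in> I"
  obtains a b where "a \<le> x" "x \<le> b" "a < b" "measure lborel I = b - a"
    "(LINT t:I|lborel. g t) = integral {a..b} g"
proof -
  define a b where "a = Inf I" and "b = Sup I"
  have bdd: "bdd_below I" "bdd_above I" using I(2) by (auto intro: bounded_imp_bdd_below bounded_imp_bdd_above)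
  have sub: "I \<subseteq> {a..b}" using bdd by (auto simp: a_def b_def intro: cInf_lower cSup_upper)
  have sup: "{a<..<b} \<subseteq> I"
  proof
    fix t assume "t \<in> {a<..<b}"
    then obtain p q where "p \<in> I" "p < t" "q \<in> I" "t < q"
      using cInf_less_iff[OF _ bdd(1), of t] less_cSup_iff[OF _ bdd(2), of t] I(4)
      by (auto simp: a_def b_def)
    then show "t \<in> I" using I(1) unfolding is_interval_1 by (meson less_imp_le)
  qed
  have ab: "a \<le> x" "x \<le> b" using sub I(4) by auto
  have "I = {a<..<b} \<union> (I \<inter> {a, b})" using sub sup by force
  moreover have "I \<inter> {a, b} \<in> sets lborel" by (intro countable_imp_null_set_lborel[THEN null_setsD2]) auto
  ultimately have meas: "I \<in> sets lborel" by (metis greaterThanLessThan_borel sets.Un sets_lborel)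
  have fin: "emeasure lborel I < \<infinity>"
    using emeasure_mono[OF sub, of lborel] by (auto simp: emeasure_lborel_Icc_eq intro: le_less_trans)
  have "measure lborel I \<le> measure lborel {a..b}"
    using meas by (intro measure_mono_fmeasurable sub) (auto simp: fmeasurable_def emeasure_lborel_Icc_eq)
  moreover have "measure lborel {a<..<b} \<le> measure lborel I"
    using meas fin by (intro measure_mono_fmeasurable sup) (auto simp: fmeasurable_def)
  ultimately have m: "measure lborel I = b - a" using ab by simp
  with I(3) have "a < b" by simp
  have "set_integrable lborel I g"
    unfolding set_integrable_def
  proof (rule integrableI_bounded_set_indicator[where B = "BV_norm g"])
    show "AE t in lborel. t \<in> I \<longrightarrow> norm (g t) \<le> BV_norm g" using abs_le_BV_norm[OF g] by simp
  qed (use meas fin BV_borel_measurable[OF g] in auto)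
  then have "(LINT t:I|lborel. g t) = integral I g" by (rule set_borel_integral_eq_integral(2))
  also have "\<dots> = integral {a..b} g"
  proof (rule integral_spike_set)
    show "negligible {t \<in> I - {a..b}. g t \<noteq> 0}" using sub by (simp add: Diff_eq_empty_iff[THEN iffD2])
    have "{t \<in> {a..b} - I. g t \<noteq> 0} \<subseteq> {a, b}" using sup by force
    then show "negligible {t \<in> {a..b} - I. g t \<noteq> 0}" by (meson finite.emptyI finite_insert negligible_finite negligible_subset)
  qed
  finally show ?thesis using that ab \<open>a < b\<close> m by blast
qed

lemma uncentered_maximal_eq_max:
  assumes f: "f \<in> BV"
  shows "uncentered_maximal f x
    = max (left_maximal (\<lambda>t. \<bar>f t\<bar>) x) (left_maximal (\<lambda>t. \<bar>f (- t)\<bar>) (- x))"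
proof -
  define g where "g t = \<bar>f t\<bar>" for t
  have g: "g \<in> BV" using BV_abs[OF f] by (simp add: g_def[abs_def])
  have gr: "(\<lambda>t. g (- t)) \<in> BV" by (rule BV_reflect[OF g])
  define l r where "l = left_maximal g x" and "r = left_maximal (\<lambda>t. g (- t)) (- x)"
  have l: "integral {a..x} g \<le> l * (x - a)" if "a \<le> x" for a
    unfolding l_def by (rule left_maximal_ge[OF g that])
  have r: "integral {x..b} g \<le> r * (b - x)" if "x \<le> b" for b
    using left_maximal_ge[OF gr, of "- b" "- x"] that unfolding r_def by simp
  let ?J = "{I. is_interval I \<and> bounded I \<and> measure lborel I > 0 \<and> x \<in> I}"
  let ?avg = "\<lambda>I. (LINT t:I|lborel. g t) / measure lborel I"
  have upper: "?avg I \<le> max l r" if "I \<in> ?J" for I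
  proof -
    obtain a b where ab: "a \<le> x" "x \<le> b" "a < b" "measure lborel I = b - a"
      "(LINT t:I|lborel. g t) = integral {a..b} g"
      using interval_average[OF g, of I x] \<open>I \<in> ?J\<close> by blast
    have "integral {a..b} g \<le> l * (x - a) + r * (b - x)"
      using l[OF ab(1)] r[OF ab(2)] BV_integral_combine[OF g ab(1,2)] by linarith
    also have "\<dots> \<le> max l r * (x - a) + max l r * (b - x)"
      using ab by (intro add_mono mult_right_mono) auto
    also have "\<dots> = max l r * (b - a)" by (simp add: algebra_simps)
    finally show ?thesis using ab by (simp add: divide_le_eq)
  qed
  then have bdd: "bdd_above (?avg ` ?J)" by (auto simp: bdd_above_def)
  have lower: "integral {a..b} g / (b - a) \<le> (SUP I\<in>?J. ?avg I)" if ab: "a \<le> x" "x \<le> b" "a < b" for a b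
  proof -
    have J: "{a..b} \<in> ?J" using ab by (auto simp: is_interval_cc)
    have "set_integrable lborel {a..b} g"
      unfolding set_integrable_def
    proof (rule integrableI_bounded_set_indicator[where B = "BV_norm g"])
      show "AE t in lborel. t \<in> {a..b} \<longrightarrow> norm (g t) \<le> BV_norm g" using abs_le_BV_norm[OF g] by simp
    qed (use BV_borel_measurable[OF g] in \<open>auto simp: emeasure_lborel_Icc_eq\<close>)
    then have "(LINT t:{a..b}|lborel. g t) = integral {a..b} g" by (rule set_borel_integral_eq_integral(2))
    then show ?thesis using cSUP_upper[OF J bdd] ab by simp
  qed
  have "(SUP I\<in>?J. ?avg I) = max l r"
  proof (rule antisym)
    have "{x - 1..x} \<in> ?J" by (auto simp: is_interval_cc)
    then have "?J \<noteq> {}" by blast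
    then show "(SUP I\<in>?J. ?avg I) \<le> max l r" using upper by (rule cSUP_least)
    have "l \<le> (SUP I\<in>?J. ?avg I)"
      unfolding l_def by (rule left_maximal_le) (use lower[of _ x] in \<open>simp add: divide_le_eq\<close>)
    moreover have "r \<le> (SUP I\<in>?J. ?avg I)"
      unfolding r_def
    proof (rule left_maximal_le)
      fix a assume "a < - x"
      then show "integral {a..- x} (\<lambda>t. g (- t)) \<le> (SUP I\<in>?J. ?avg I) * (- x - a)"
        using lower[of x "- a"] Henstock_Kurzweil_Integration.integral_reflect_real[of "- a" x g]
        by (simp add: divide_le_eq minus_diff_commute)
    qed
    ultimately show "max l r \<le> (SUP I\<in>?J. ?avg I)" by simp
  qed
  then show ?thesis by (simp add: uncentered_maximal_def l_def r_def g_def[abs_def])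
qed

lemma BV_LIMSEQ_uncentered_maximal:
  assumes F: "BV_LIMSEQ F f"
  shows "BV_LIMSEQ (\<lambda>n. uncentered_maximal (F n)) (uncentered_maximal f)"
proof -
  have A: "BV_LIMSEQ (\<lambda>n x. \<bar>F n x\<bar>) (\<lambda>x. \<bar>f x\<bar>)" by (rule BV_LIMSEQ_abs[OF F])
  have "BV_LIMSEQ (\<lambda>n x. max (left_maximal (\<lambda>t. \<bar>F n t\<bar>) x) (left_maximal (\<lambda>t. \<bar>F n (- t)\<bar>) (- x)))
    (\<lambda>x. max (left_maximal (\<lambda>t. \<bar>f t\<bar>) x) (left_maximal (\<lambda>t. \<bar>f (- t)\<bar>) (- x)))"
    by (intro BV_LIMSEQ_max BV_LIMSEQ_left_maximal A BV_LIMSEQ_reflect[OF BV_LIMSEQ_left_maximal]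
        BV_LIMSEQ_reflect[OF A])
  moreover have "uncentered_maximal g = (\<lambda>x. max (left_maximal (\<lambda>t. \<bar>g t\<bar>) x) (left_maximal (\<lambda>t. \<bar>g (- t)\<bar>) (- x)))"
    if "g \<in> BV" for g
    using uncentered_maximal_eq_max[OF that] by auto
  ultimately show ?thesis using BV_LIMSEQ_D(1,2)[OF F] by simp
qed

theorem theorem1:
  shows "continuous_map BV.mtopology BV.mtopology uncentered_maximal"
proof -
  have const: "BV_LIMSEQ (\<lambda>_. f) f" if "f \<in> BV" for f
    using that by (simp add: BV_LIMSEQ_def)
  \<comment> \<open>That the operator maps \<open>BV\<close> to itself is read off from the constant
    sequence.\<close>
  have M: "uncentered_maximal f \<in> BV" if "f \<in> BV" for f
    using BV_LIMSEQ_D(2)[OF BV_LIMSEQ_uncentered_maximal[OF const[OF that]]] .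
  have "\<exists>\<delta>>0. \<forall>g. g \<in> BV \<and> BV_dist f g < \<delta> \<longrightarrow> BV_dist (uncentered_maximal f) (uncentered_maximal g) < e"
    if f: "f \<in> BV" and e: "0 < e" for f e
  proof (rule ccontr)
    \<comment> \<open>A failure of continuity at \<open>f\<close> yields a sequence converging at
      rate \<open>1 / (real n + 1)\<close> whose images stay at distance at least
      \<open>e\<close>.\<close>
    assume H: "\<not> ?thesis"
    have "\<exists>g. g \<in> BV \<and> BV_dist f g < 1 / (real n + 1) \<and> e \<le> BV_dist (uncentered_maximal f) (uncentered_maximal g)" for n
    proof -
      have "0 < 1 / (real n + 1)" by simp
      then show ?thesis using H by (meson not_less)
    qed
    then obtain F where F: "\<And>n. F n \<in> BV" "\<And>n. BV_dist f (F n) < 1 / (real n + 1)"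
      "\<And>n. e \<le> BV_dist (uncentered_maximal f) (uncentered_maximal (F n))" by metis
    have "(\<lambda>n. BV_dist (F n) f) \<longlonglongrightarrow> 0"
    proof (rule tendsto_sandwich[OF _ _ tendsto_const])
      show "(\<lambda>n. 1 / (real n + 1)) \<longlonglongrightarrow> 0"
        using LIMSEQ_inverse_real_of_nat by (simp add: inverse_eq_divide add.commute)
      show "\<forall>\<^sub>F n in sequentially. BV_dist (F n) f \<le> 1 / (real n + 1)"
        using F(2) by (auto intro!: always_eventually less_imp_le simp: BV_dist_commute)
    qed (simp add: BV_dist_def BV_norm_nonneg)
    then have "BV_LIMSEQ F f" using F f by (simp add: BV_LIMSEQ_def)
    from BV_LIMSEQ_D(6)[OF BV_LIMSEQ_uncentered_maximal[OF this]] e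
    have "\<forall>\<^sub>F n in sequentially. BV_dist (uncentered_maximal (F n)) (uncentered_maximal f) < e"
      by (rule order_tendstoD(2))
    then obtain n where "BV_dist (uncentered_maximal (F n)) (uncentered_maximal f) < e"
      by (auto dest: eventually_happens)
    with F(3)[of n] show False by (simp add: BV_dist_commute)
  qed
  then show ?thesis
    using M by (auto simp: BV.metric_continuous_map[OF BV.Metric_space_axioms])
qed

end
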